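(* Let $\mathcal{F}$ be a minor-closed family of graphs. Then $\mathcal{F}$ has bounded bridge-depth (there is a constant $c$ with ${\sf bd}(G)\le c$ for all $G\in\mathcal{F}$) if and only if there is a constant $b$ such that every inclusion-wise minimal blocking set of every graph in $\mathcal{F}$ has size at most $b$.
   Context: All graphs are finite, undirected and simple. $\alpha(G)$ denotes the independence number of $G$. A set $Y\subseteq V(G)$ is a blocking set in $G$ if $\alpha(G\setminus Y)<\alpha(G)$. An edge is a bridge if its removal increases the number of connected components. For a graph $G$, $\bar G$ denotes the simple graph obtained from $G$ by contracting all bridges of $G$. The bridge-depth ${\sf bd}(G)$ is defined recursively: ${\sf bd}(G)=0$ if $G$ has no vertices; if $G$ is disconnected, ${\sf bd}(G)$ is the maximum bridge-depth of its components; if $G$ is connected and nonempty, ${\sf bd}(G)=1+\min_{v\in V(\bar G)}{\sf bd}(\bar G\setminus v)$. *)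

theory Defs
  imports "Graph_Theory.Digraph_Isomorphism"
begin

text \<open>
  Following the \<^locale>\<open>pair_graph\<close> convention, a finite simple undirected graph is a finite
  loopless symmetric digraph without parallel arcs; an undirected edge is a pair of opposite arcs.
  Since arcs are symmetric, the strongly connected components \<^const>\<open>pre_digraph.sccs_verts\<close>
  are the vertex sets of the connected components.
\<close>

definition pinduce :: "'a pair_pre_digraph \<Rightarrow> 'a set \<Rightarrow> 'a pair_pre_digraph" where
  "pinduce G S = \<lparr>pverts = S, parcs = parcs G \<inter> S \<times> S\<rparr>"

definition pdel_verts :: "'a pair_pre_digraph \<Rightarrow> 'a set \<Rightarrow> 'a pair_pre_digraph" where
  "pdel_verts G Y = pinduce G (pverts G - Y)"

definition pdel_edge :: "'a pair_pre_digraph \<Rightarrow> 'a \<Rightarrow> 'a \<Rightarrow> 'a pair_pre_digraph" where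
  "pdel_edge G u v = \<lparr>pverts = pverts G, parcs = parcs G - {(u, v), (v, u)}\<rparr>"

text \<open>
  Contraction of a symmetric set \<open>B\<close> of arcs: the components of the graph \<open>(V(G), B)\<close> are merged
  to single vertices, loops and multiple arcs are dropped. The merged vertex is named after a chosen
  element of the component, so that the vertex type does not change.
\<close>

definition contract_rep :: "'a pair_pre_digraph \<Rightarrow> 'a rel \<Rightarrow> 'a \<Rightarrow> 'a" where
  "contract_rep G B u =
     (SOME v. v \<in> pre_digraph.scc_of (with_proj \<lparr>pverts = pverts G, parcs = B\<rparr>) u)"

definition pcontract :: "'a pair_pre_digraph \<Rightarrow> 'a rel \<Rightarrow> 'a pair_pre_digraph" where
  "pcontract G B =
     \<lparr>pverts = contract_rep G B ` pverts G,
      parcs = {(contract_rep G B u, contract_rep G B v) | u v.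
                 (u, v) \<in> parcs G \<and> contract_rep G B u \<noteq> contract_rep G B v}\<rparr>"

inductive graph_minor :: "'a pair_pre_digraph \<Rightarrow> 'a pair_pre_digraph \<Rightarrow> bool" where
  refl: "graph_minor G G"
| del_vert: "graph_minor H G \<Longrightarrow> v \<in> pverts H \<Longrightarrow> graph_minor (pdel_verts H {v}) G"
| del_edge: "graph_minor H G \<Longrightarrow> (u, v) \<in> parcs H \<Longrightarrow> graph_minor (pdel_edge H u v) G"
| contract_edge:
    "graph_minor H G \<Longrightarrow> (u, v) \<in> parcs H \<Longrightarrow> graph_minor (pcontract H {(u, v), (v, u)}) G"
| iso: "graph_minor H G \<Longrightarrow> digraph_iso (with_proj H) (with_proj H') \<Longrightarrow> graph_minor H' G"
(* the first argument is the minor, the second one the host graph *)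

definition minor_closed :: "'a pair_pre_digraph set \<Rightarrow> bool" where
  "minor_closed \<F> \<longleftrightarrow> (\<forall>G\<in>\<F>. \<forall>H. graph_minor H G \<longrightarrow> H \<in> \<F>)"

definition independent_set :: "'a pair_pre_digraph \<Rightarrow> 'a set \<Rightarrow> bool" where
  "independent_set G S \<longleftrightarrow> S \<subseteq> pverts G \<and> (\<forall>u\<in>S. \<forall>v\<in>S. (u, v) \<notin> parcs G)"

definition independence_number :: "'a pair_pre_digraph \<Rightarrow> nat" where
  "independence_number G = Max (card ` {S. independent_set G S})"

definition blocking_set :: "'a pair_pre_digraph \<Rightarrow> 'a set \<Rightarrow> bool" where
  "blocking_set G Y \<longleftrightarrow>
     Y \<subseteq> pverts G \<and> independence_number (pdel_verts G Y) < independence_number G"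

definition minimal_blocking_set :: "'a pair_pre_digraph \<Rightarrow> 'a set \<Rightarrow> bool" where
  "minimal_blocking_set G Y \<longleftrightarrow> blocking_set G Y \<and> (\<forall>Z. Z \<subset> Y \<longrightarrow> \<not> blocking_set G Z)"

definition bridges :: "'a pair_pre_digraph \<Rightarrow> 'a rel" where
  "bridges G =
     {(u, v). (u, v) \<in> parcs G \<and>
        card (pre_digraph.sccs_verts (with_proj (pdel_edge G u v)))
          > card (pre_digraph.sccs_verts (with_proj G))}"

definition contract_bridges :: "'a pair_pre_digraph \<Rightarrow> 'a pair_pre_digraph" where
  "contract_bridges G = pcontract G (bridges G)"

lemma pverts_pinduce [simp]: "pverts (pinduce G S) = S"
  and parcs_pinduce [simp]: "parcs (pinduce G S) = parcs G \<inter> S \<times> S"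
  by (simp_all add: pinduce_def)

lemma pverts_pdel_verts [simp]: "pverts (pdel_verts G Y) = pverts G - Y"
  by (simp add: pdel_verts_def)

lemma with_proj_pinduce: "with_proj (pinduce G S) = with_proj G \<restriction> S"
  by (auto simp: with_proj_def pinduce_def induce_subgraph_def)

lemma contract_rep_in:
  assumes "u \<in> pverts G"
  shows "contract_rep G B u \<in> pverts G"
proof -
  let ?H = "with_proj \<lparr>pverts = pverts G, parcs = B\<rparr>"
  have "u \<in> pre_digraph.scc_of ?H u"
    using assms by (simp add: pre_digraph.scc_of_def reachable_def)
  then have "contract_rep G B u \<in> pre_digraph.scc_of ?H u"
    unfolding contract_rep_def by (rule someI)
  then show ?thesis
    by (auto simp: pre_digraph.scc_of_def elim: reachable_in_vertsE)
qed

lemma pverts_pcontract_subset: "pverts (pcontract G B) \<subseteq> pverts G"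
  using contract_rep_in by (fastforce simp: pcontract_def)

lemma pair_graph_finite: "pair_graph G \<Longrightarrow> finite (pverts G)"
  by (simp add: pair_graph_def pair_digraph_def pair_fin_digraph.pair_finite_verts)

lemma pair_graph_iff:
  "pair_graph G \<longleftrightarrow> finite (pverts G) \<and> parcs G \<subseteq> pverts G \<times> pverts G \<and> sym (parcs G)
     \<and> (\<forall>v. (v, v) \<notin> parcs G)"
proof
  assume "pair_graph G"
  then interpret pair_graph G .
  show "finite (pverts G) \<and> parcs G \<subseteq> pverts G \<times> pverts G \<and> sym (parcs G)
     \<and> (\<forall>v. (v, v) \<notin> parcs G)"
    using pair_finite_verts arcs_symmetric no_loops' by (auto intro: symI dest: wellformed')
next
  assume *: "finite (pverts G) \<and> parcs G \<subseteq> pverts G \<times> pverts G \<and> sym (parcs G)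
     \<and> (\<forall>v. (v, v) \<notin> parcs G)"
  then have "finite (parcs G)"
    by (meson finite_SigmaI finite_subset)
  with * show "pair_graph G"
    by unfold_locales (auto simp: symmetric_def)
qed

text \<open>The operations above do not leave the class of finite simple graphs.\<close>

lemma pair_graph_pinduce: "pair_graph G \<Longrightarrow> S \<subseteq> pverts G \<Longrightarrow> pair_graph (pinduce G S)"
  by (auto simp: pair_graph_iff sym_def intro: finite_subset)

lemma pair_graph_pdel_verts: "pair_graph G \<Longrightarrow> pair_graph (pdel_verts G Y)"
  by (simp add: pdel_verts_def pair_graph_pinduce)

lemma pair_graph_pdel_edge: "pair_graph G \<Longrightarrow> pair_graph (pdel_edge G u v)"
  by (auto simp: pair_graph_iff sym_def pdel_edge_def)

lemma pair_graph_pcontract: "pair_graph G \<Longrightarrow> pair_graph (pcontract G B)"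
  by (fastforce simp: pair_graph_iff sym_def pcontract_def)

lemma pair_graph_iso:
  assumes "pair_graph G" and "digraph_iso (with_proj G) (with_proj H)"
  shows "pair_graph H"
proof -
  interpret pair_graph G by fact
  obtain f where f: "digraph_isomorphism f" and H: "with_proj H = app_iso f (with_proj G)"
    using assms(2) by (auto simp: digraph_iso_def)
  have V: "pverts H = iso_verts f ` pverts G" and A: "parcs H = iso_arcs f ` parcs G"
    and hd: "iso_head f = snd" and tl: "iso_tail f = fst"
    using arg_cong[OF H, of verts] arg_cong[OF H, of arcs] arg_cong[OF H, of head]
      arg_cong[OF H, of tail] by simp_all
  have inj: "inj_on (iso_verts f) (pverts G)"
    and iso: "\<And>u v. (u, v) \<in> parcs G \<Longrightarrow> iso_arcs f (u, v) = (iso_verts f u, iso_verts f v)"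
    using f by (auto simp: digraph_isomorphism_def hd tl prod_eq_iff)
  have "parcs H = map_prod (iso_verts f) (iso_verts f) ` parcs G"
    unfolding A using iso by (intro image_cong) auto
  moreover have "iso_verts f u \<noteq> iso_verts f v" if "(u, v) \<in> parcs G" for u v
    using that inj wellformed' no_loops' by (metis inj_on_def)
  ultimately show ?thesis
    using assms(1) V unfolding pair_graph_iff sym_def by fastforce
qed

lemma pair_graph_minor: "graph_minor H G \<Longrightarrow> pair_graph G \<Longrightarrow> pair_graph H"
  by (induction rule: graph_minor.induct)
     (auto intro: pair_graph_pdel_verts pair_graph_pdel_edge pair_graph_pcontract pair_graph_iso)

lemma sccs_verts_psubset:
  assumes G: "pair_graph G" and C: "C \<in> pre_digraph.sccs_verts (with_proj G)"
    and nc: "\<not> connected (with_proj G)"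
  shows "C \<subset> pverts G"
proof -
  interpret pair_graph G by fact
  have reach: "\<And>u v. u \<in> C \<Longrightarrow> v \<in> C \<Longrightarrow> u \<rightarrow>\<^sup>*\<^bsub>with_proj G\<^esub> v" and "C \<noteq> {}"
    using C by (auto simp: sccs_verts_def)
  then have "C \<subseteq> pverts G"
    using reachable_in_verts(1) by blast
  moreover have "C \<noteq> pverts G"
  proof
    assume "C = pverts G"
    then have "strongly_connected (mk_symmetric (with_proj G))"
      using reach \<open>C \<noteq> {}\<close> reachable_mk_symmetricI
      by (intro strongly_connectedI) auto
    then show False using nc by (simp add: connected_def)
  qed
  ultimately show ?thesis by blast
qed

(* the value 0 on arguments that are not finite simple graphs is a dummy *)
function bridge_depth :: "'a pair_pre_digraph \<Rightarrow> nat" where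
  "bridge_depth G =
     (if \<not> pair_graph G \<or> pverts G = {} then 0
      else if \<not> connected (with_proj G) then
        Max ((\<lambda>C. bridge_depth (pinduce G C)) ` pre_digraph.sccs_verts (with_proj G))
      else
        1 + Min ((\<lambda>v. bridge_depth (pdel_verts (contract_bridges G) {v}))
                   ` pverts (contract_bridges G)))"
  by auto
termination
proof (relation "measure (\<lambda>G. card (pverts G))")
  fix G :: "'a pair_pre_digraph" and C
  assume "\<not> (\<not> pair_graph G \<or> pverts G = {})" "\<not> connected (with_proj G)"
    and "C \<in> pre_digraph.sccs_verts (with_proj G)"
  then show "(pinduce G C, G) \<in> measure (\<lambda>G. card (pverts G))"
    using sccs_verts_psubset[of G C] by (auto intro!: psubset_card_mono pair_graph_finite)
next
  fix G :: "'a pair_pre_digraph" and v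
  assume G: "\<not> (\<not> pair_graph G \<or> pverts G = {})" and v: "v \<in> pverts (contract_bridges G)"
  have "finite (pverts G)"
    using G pair_graph_finite by auto
  moreover have "pverts (contract_bridges G) - {v} \<subset> pverts G"
    using v pverts_pcontract_subset[of G "bridges G"] by (auto simp: contract_bridges_def)
  ultimately show "(pdel_verts (contract_bridges G) {v}, G) \<in> measure (\<lambda>G. card (pverts G))"
    by (auto intro!: psubset_card_mono)
qed auto

(* the recursive equation loops as a rewrite rule *)
declare bridge_depth.simps [simp del]

end

theory Submission
  imports Defs "HOL-Library.Ramsey"
begin

text \<open>
  Bounded bridge-depth implies small minimal blocking sets: deleting a vertex of the bridge
  contraction means deleting a tree \<open>T\<close> of bridges. If blocking sets of \<open>G - T\<close> (and of its induced
  subgraphs) can be reduced to size \<open>b\<close>, dynamic programming along \<open>T\<close> reduces those of \<open>G\<close> to size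
  \<open>2b\<close>: a loss of independence number on a tree is witnessed at one or two of its vertices. Hence
  minimal blocking sets have size at most \<open>2\<close> to the power of the bridge-depth.

  Conversely, consider a necklace: disjoint connected bags, consecutive ones joined by at least two
  edges. In a connected bridgeless graph any two longest necklaces intersect, so the path and linkage
  argument for brambles yields either a longer necklace or a bounded hitting set; deleting the latter
  shortens the longest necklace, and induction bounds the bridge-depth. A long necklace contains a
  long path of triangles as a minor, and the tips of the triangles together with the two ends of the
  path are a large minimal blocking set there.
\<close>

section \<open>Connectivity and bridges\<close>

text \<open>Two obstacles shape the first direction. Bridge-depth recurses on contractions, but
  contracting changes independence numbers; so the induction keeps the original graph beside each
  contracted one, with a map between them whose fibres are trees of bridges. Moreover, a rooted part
  can lose independence number with or without its root, and sometimes both losses are needed at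
  once, which takes the union of two witnesses. The invariant \<open>controlled\<close> keeps these
  unions from piling up along a tree: the bound is \<open>2 * b\<close> for trees of any size. In
  the converse, bags are joined by two edges because single edges may all be bridges: a tree has
  bridge-depth at most 1, however long its paths are. Two edges between disjoint connected bags lie
  on a cycle, and this cycle is what yields a triangle. Ramsey's theorem enters because disjoint
  connections between two parts of a path may attach in any order, whereas the bags of a necklace
  have to follow both parts monotonically.\<close>

abbreviation rs :: "'a rel \<Rightarrow> 'a set \<Rightarrow> 'a rel" where
  "rs E S \<equiv> E \<inter> S \<times> S"

definition conn_on :: "'a rel \<Rightarrow> 'a set \<Rightarrow> bool" where
  "conn_on E S \<longleftrightarrow> S \<noteq> {} \<and> (\<forall>x\<in>S. \<forall>y\<in>S. (x, y) \<in> (rs E S)\<^sup>*)"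

definition comp_of :: "'a rel \<Rightarrow> 'a set \<Rightarrow> 'a \<Rightarrow> 'a set" where
  "comp_of E S x = {y. (x, y) \<in> (rs E S)\<^sup>*}"

text \<open>Only separation is demanded, not that \<open>(u, v)\<close> is an edge; so the property
  passes to every subrelation of \<open>E\<close>, in particular to induced subgraphs.\<close>

definition bridge_in :: "'a rel \<Rightarrow> 'a \<Rightarrow> 'a \<Rightarrow> bool" where
  "bridge_in E u v \<longleftrightarrow> (u, v) \<notin> (E - {(u, v), (v, u)})\<^sup>*"

lemma rtrancl_sym: "sym r \<Longrightarrow> (x, y) \<in> r\<^sup>* \<Longrightarrow> (y, x) \<in> r\<^sup>*"
  by (meson sym_rtrancl symE)

lemma sym_rs: "sym E \<Longrightarrow> sym (rs E S)"
  by (auto simp: sym_def)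

lemma sym_diff_edge: "sym E \<Longrightarrow> sym (E - {(u, v), (v, u)})"
  by (auto simp: sym_def)

lemma rtrancl_rs_mono: "(x, y) \<in> (rs E S)\<^sup>* \<Longrightarrow> S \<subseteq> S' \<Longrightarrow> (x, y) \<in> (rs E S')\<^sup>*"
  by (rule subsetD[OF rtrancl_mono]) auto

lemma rtrancl_rs_closed: "(x, y) \<in> (rs E S)\<^sup>* \<Longrightarrow> x \<in> S \<Longrightarrow> y \<in> S"
  by (induction rule: rtrancl_induct) auto

lemma rtrancl_cross:
  assumes "(x, y) \<in> r\<^sup>*" "x \<in> Q" "y \<notin> Q"
  obtains a b where "(a, b) \<in> r" "a \<in> Q" "b \<notin> Q"
proof -
  have "y \<notin> Q \<longrightarrow> (\<exists>a b. (a, b) \<in> r \<and> a \<in> Q \<and> b \<notin> Q)"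
    using assms(1,2) by (induction rule: rtrancl_induct) auto
  then show thesis using assms that by blast
qed

lemma bridge_in_sym: "sym E \<Longrightarrow> bridge_in E u v \<longleftrightarrow> bridge_in E v u"
  using rtrancl_sym[OF sym_diff_edge[of E u v], of u v] rtrancl_sym[OF sym_diff_edge[of E u v], of v u]
  unfolding bridge_in_def insert_commute[of "(v, u)"] by blast

lemma bridge_in_mono: "bridge_in E u v \<Longrightarrow> E' \<subseteq> E \<Longrightarrow> bridge_in E' u v"
  unfolding bridge_in_def by (meson Diff_mono rtrancl_mono subsetD subset_refl)

text \<open>The path is cut after its last visit to \<open>x\<close>; the tail then avoids
  \<open>x\<close> altogether.\<close>

lemma rtrancl_last_exit:
  assumes "(x, y) \<in> B\<^sup>*" "x \<noteq> y"
  shows "\<exists>z. (x, z) \<in> B \<and> z \<noteq> x \<and> (z, y) \<in> (B \<inter> (- {x}) \<times> (- {x}))\<^sup>*"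
proof -
  have "x \<noteq> y \<longrightarrow> (\<exists>z. (x, z) \<in> B \<and> z \<noteq> x \<and> (z, y) \<in> (B \<inter> (- {x}) \<times> (- {x}))\<^sup>*)"
    using assms(1)
  proof (induction rule: rtrancl_induct)
    case (step y z)
    show ?case
    proof (cases "x = y")
      case True then show ?thesis using step by blast
    next
      case False
      with step obtain w where w: "(x, w) \<in> B" "w \<noteq> x" "(w, y) \<in> (B \<inter> (- {x}) \<times> (- {x}))\<^sup>*"
        by blast
      then show ?thesis using step False
        by (metis Compl_iff IntI SigmaI rtrancl.rtrancl_into_rtrancl singletonD)
    qed
  qed simp
  then show ?thesis using assms by blast
qed

text \<open>Bridges lie on no cycle. Let \<open>z\<close> follow the last visit to \<open>x\<close>
  on the path in \<open>B\<close>: the tail from \<open>z\<close> to \<open>y\<close> avoids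
  \<open>x\<close> and the second path avoids \<open>B\<close>, so together they go around the
  bridge \<open>(x, z)\<close>.\<close>

lemma bridges_forest:
  assumes "sym E" "B \<subseteq> E" "\<And>u v. (u, v) \<in> B \<Longrightarrow> bridge_in E u v"
    and "(x, y) \<in> B\<^sup>*" and "(x, y) \<in> (E - B - B\<inverse>)\<^sup>*"
  shows "x = y"
proof (rule ccontr)
  assume "x \<noteq> y"
  then obtain z where z: "(x, z) \<in> B" "z \<noteq> x" "(z, y) \<in> (B \<inter> (- {x}) \<times> (- {x}))\<^sup>*"
    using rtrancl_last_exit assms(4) by metis
  let ?E = "E - {(x, z), (z, x)}"
  have "(z, y) \<in> ?E\<^sup>*"
    by (rule subsetD[OF rtrancl_mono z(3)]) (use assms(2) in auto)
  moreover have "(x, y) \<in> ?E\<^sup>*"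
    by (rule subsetD[OF rtrancl_mono assms(5)]) (use z(1) in auto)
  ultimately have "(x, z) \<in> ?E\<^sup>*"
    using sym_diff_edge[OF assms(1)] by (meson rtrancl_sym rtrancl_trans)
  then show False using assms(3) z(1) by (auto simp: bridge_in_def)
qed

lemma conn_on_singleton [simp]: "conn_on E {x}"
  by (auto simp: conn_on_def)

lemma conn_on_nonempty: "conn_on E S \<Longrightarrow> S \<noteq> {}"
  by (auto simp: conn_on_def)

lemma conn_onD: "conn_on E S \<Longrightarrow> x \<in> S \<Longrightarrow> y \<in> S \<Longrightarrow> (x, y) \<in> (rs E S)\<^sup>*"
  by (auto simp: conn_on_def)

lemma conn_onI_root:
  assumes "sym E" "r \<in> S" "\<And>x. x \<in> S \<Longrightarrow> (r, x) \<in> (rs E S)\<^sup>*"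
  shows "conn_on E S"
  unfolding conn_on_def
  using assms by (metis rtrancl_sym rtrancl_trans sym_rs empty_iff)

lemma conn_on_Un:
  assumes "sym E" "conn_on E A" "conn_on E B" "A \<inter> B \<noteq> {}"
  shows "conn_on E (A \<union> B)"
proof -
  obtain r where r: "r \<in> A" "r \<in> B" using assms(4) by auto
  show ?thesis
  proof (rule conn_onI_root[OF assms(1), of r])
    fix x assume "x \<in> A \<union> B"
    then show "(r, x) \<in> (rs E (A \<union> B))\<^sup>*"
      using conn_onD[OF assms(2) r(1)] conn_onD[OF assms(3) r(2)] rtrancl_rs_mono
      by (metis Un_iff sup_ge1 sup_ge2)
  qed (use r in auto)
qed

lemma conn_on_edge:
  assumes "sym E" "(x, y) \<in> E"
  shows "conn_on E {x, y}"
  by (rule conn_onI_root[OF assms(1), of x]) (use assms in auto)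

lemma conn_on_Un_edge:
  assumes "sym E" "conn_on E A" "conn_on E B" "(x, y) \<in> E" "x \<in> A" "y \<in> B"
  shows "conn_on E (A \<union> B)"
proof -
  have "conn_on E (A \<union> {x, y})"
    using conn_on_Un[OF assms(1,2) conn_on_edge[OF assms(1,4)]] assms by auto
  then have "conn_on E (A \<union> {x, y} \<union> B)"
    by (rule conn_on_Un[OF assms(1) _ assms(3)]) (use assms in auto)
  moreover have "A \<union> {x, y} \<union> B = A \<union> B" using assms by auto
  ultimately show ?thesis by simp
qed

lemma conn_on_closed:
  assumes "conn_on E A" "A \<subseteq> S" "A \<inter> C \<noteq> {}"
    and "\<And>x y. x \<in> C \<Longrightarrow> y \<in> S \<Longrightarrow> (x, y) \<in> E \<Longrightarrow> y \<in> C"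
  shows "A \<subseteq> C"
proof
  fix y assume "y \<in> A"
  obtain x where x: "x \<in> A" "x \<in> C" using assms(3) by auto
  have "(x, y) \<in> (rs E A)\<^sup>*" using conn_onD[OF assms(1) x(1) \<open>y \<in> A\<close>] .
  then show "y \<in> C"
    by (induction rule: rtrancl_induct) (use x assms in auto)
qed

lemma comp_of_self [simp]: "x \<in> comp_of E S x"
  by (auto simp: comp_of_def)

lemma comp_of_subset: "x \<in> S \<Longrightarrow> comp_of E S x \<subseteq> S"
  by (auto simp: comp_of_def dest: rtrancl_rs_closed)

lemma comp_of_closed: "x \<in> comp_of E S r \<Longrightarrow> r \<in> S \<Longrightarrow> y \<in> S \<Longrightarrow> (x, y) \<in> E \<Longrightarrow> y \<in> comp_of E S r"
  using comp_of_subset[of r S E] rtrancl.rtrancl_into_rtrancl[of r x "rs E S" y]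
  unfolding comp_of_def by blast

lemma comp_of_conn:
  assumes "sym E" "r \<in> S"
  shows "conn_on E (comp_of E S r)"
proof (rule conn_onI_root[OF assms(1), of r])
  fix x assume "x \<in> comp_of E S r"
  then have "(r, x) \<in> (rs E S)\<^sup>*" by (simp add: comp_of_def)
  then show "(r, x) \<in> (rs E (comp_of E S r))\<^sup>*"
  proof (induction rule: rtrancl_induct)
    case (step y z)
    then have "y \<in> comp_of E S r" "z \<in> comp_of E S r"
      by (auto simp: comp_of_def intro: rtrancl.rtrancl_into_rtrancl)
    then show ?case using step by (meson IntD1 IntI SigmaI rtrancl.rtrancl_into_rtrancl)
  qed simp
qed simp

lemma comp_of_maximal:
  assumes "conn_on E A" "A \<subseteq> S" "r \<in> S" "A \<inter> comp_of E S r \<noteq> {}"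
  shows "A \<subseteq> comp_of E S r"
  by (rule conn_on_closed[OF assms(1,2,4)]) (use assms(3) in \<open>auto intro: comp_of_closed\<close>)

lemma comp_of_eq:
  assumes "sym E" "y \<in> comp_of E S x"
  shows "comp_of E S y = comp_of E S x"
proof -
  have xy: "(x, y) \<in> (rs E S)\<^sup>*" using assms(2) by (simp add: comp_of_def)
  then have yx: "(y, x) \<in> (rs E S)\<^sup>*" using rtrancl_sym[OF sym_rs[OF assms(1)]] by blast
  show ?thesis
    unfolding comp_of_def using rtrancl_trans[OF xy] rtrancl_trans[OF yx] by blast
qed

text \<open>A path from \<open>r\<close> to \<open>v\<close> in \<open>D\<close> can leave the
  component of \<open>r\<close> only through \<open>v\<close>.\<close>

lemma conn_on_del_vertex_adj:
  assumes "sym E" "conn_on E D" "v \<in> D" "r \<in> D" "r \<noteq> v"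
  obtains w where "w \<in> comp_of E (D - {v}) r" "(v, w) \<in> E"
proof -
  let ?C = "comp_of E (D - {v}) r"
  have C: "?C \<subseteq> D - {v}" using assms comp_of_subset[of r "D - {v}"] by auto
  have "(r, v) \<in> (rs E D)\<^sup>*" using assms conn_onD by metis
  then obtain a b where ab: "(a, b) \<in> rs E D" "a \<in> ?C" "b \<notin> ?C"
    using C by (elim rtrancl_cross[of _ _ _ ?C]) auto
  then have "b = v" using comp_of_closed[of a E "D - {v}" r b] assms by auto
  then show thesis using ab that assms(1) by (auto dest: symD)
qed

text \<open>Every other component of \<open>D - {v}\<close> keeps its neighbour \<open>v\<close>, so
  all of them stay joined through \<open>v\<close>.\<close>

lemma conn_on_Diff_comp:
  assumes "sym E" "conn_on E D" "v \<in> D" "r \<in> D" "r \<noteq> v"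
  shows "conn_on E (D - comp_of E (D - {v}) r)"
proof -
  let ?C = "comp_of E (D - {v}) r"
  have C: "?C \<subseteq> D - {v}" using assms comp_of_subset[of r "D - {v}"] by auto
  show ?thesis
  proof (rule conn_onI_root[OF assms(1), of v])
    show "v \<in> D - ?C" using C assms by auto
    fix x assume x: "x \<in> D - ?C"
    show "(v, x) \<in> (rs E (D - ?C))\<^sup>*"
    proof (cases "x = v")
      case False
      let ?K = "comp_of E (D - {v}) x"
      obtain w where w: "w \<in> ?K" "(v, w) \<in> E"
        using conn_on_del_vertex_adj[OF assms(1,2,3), of x] x False by auto
      have K: "?K \<inter> ?C = {}"
        using comp_of_eq[OF assms(1)] x by (metis DiffD2 comp_of_self disjoint_iff)
      have "?K \<subseteq> D - {v}" using comp_of_subset[of x "D - {v}" E] x False by auto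
      have 1: "conn_on E ({v} \<union> ?K)"
        using conn_on_Un_edge[OF assms(1) conn_on_singleton comp_of_conn[OF assms(1)] w(2) _ w(1)]
          x False by auto
      have 2: "{v} \<union> ?K \<subseteq> D - ?C" using K \<open>?K \<subseteq> _\<close> C assms by auto
      then show ?thesis using rtrancl_rs_mono[OF conn_onD[OF 1] 2] by auto
    qed simp
  qed
qed

section \<open>Blocking sets along a tree of bridges\<close>

definition independent_in :: "'a rel \<Rightarrow> 'a set \<Rightarrow> bool" where
  "independent_in E I \<longleftrightarrow> (\<forall>u\<in>I. \<forall>v\<in>I. (u, v) \<notin> E)"

definition alpha :: "'a rel \<Rightarrow> 'a set \<Rightarrow> nat" where
  "alpha E S = Max (card ` {I. I \<subseteq> S \<and> independent_in E I})"

lemma finite_independent_cards: "finite S \<Longrightarrow> finite (card ` {I. I \<subseteq> S \<and> independent_in E I})"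
  by (rule finite_imageI) (rule finite_subset[of _ "Pow S"], auto)

lemma alpha_ge: "finite S \<Longrightarrow> I \<subseteq> S \<Longrightarrow> independent_in E I \<Longrightarrow> card I \<le> alpha E S"
  unfolding alpha_def using finite_independent_cards by (intro Max_ge) auto

lemma alpha_witness:
  assumes "finite S"
  obtains I where "I \<subseteq> S" "independent_in E I" "card I = alpha E S"
proof -
  have "{} \<in> {I. I \<subseteq> S \<and> independent_in E I}" by (auto simp: independent_in_def)
  then have "card ` {I. I \<subseteq> S \<and> independent_in E I} \<noteq> {}" by blast
  then have "alpha E S \<in> card ` {I. I \<subseteq> S \<and> independent_in E I}"
    unfolding alpha_def by (intro Max_in finite_independent_cards assms)
  then show thesis using that by auto
qed

lemma alpha_le:
  assumes "finite S" "\<And>I. I \<subseteq> S \<Longrightarrow> independent_in E I \<Longrightarrow> card I \<le> n"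
  shows "alpha E S \<le> n"
  by (metis alpha_witness assms)

lemma independent_in_subset: "independent_in E I \<Longrightarrow> J \<subseteq> I \<Longrightarrow> independent_in E J"
  by (auto simp: independent_in_def)

lemma alpha_mono: "finite S \<Longrightarrow> S' \<subseteq> S \<Longrightarrow> alpha E S' \<le> alpha E S"
  by (rule alpha_le) (auto intro: finite_subset alpha_ge)

lemma alpha_del_vertex:
  assumes "finite S"
  shows "alpha E S \<le> Suc (alpha E (S - {p}))"
proof (rule alpha_le[OF assms])
  fix I assume I: "I \<subseteq> S" "independent_in E I"
  have "card (I - {p}) \<le> alpha E (S - {p})"
    using I assms by (intro alpha_ge) (auto intro: independent_in_subset)
  moreover have "card I \<le> Suc (card (I - {p}))"
    using card_Diff_singleton_if[of I p] by (auto split: if_splits)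
  ultimately show "card I \<le> Suc (alpha E (S - {p}))" by linarith
qed

lemma alpha_Un_le:
  assumes "finite A" "finite C"
  shows "alpha E (A \<union> C) \<le> alpha E A + alpha E C"
proof (rule alpha_le)
  fix I assume I: "I \<subseteq> A \<union> C" "independent_in E I"
  have "card I \<le> card (I \<inter> A) + card (I \<inter> C)"
    using I by (metis Int_Un_distrib card_Un_le inf.absorb_iff1)
  also have "\<dots> \<le> alpha E A + alpha E C"
    using I assms by (intro add_mono alpha_ge) (auto intro: independent_in_subset)
  finally show "card I \<le> alpha E A + alpha E C" .
qed (use assms in auto)

lemma alpha_Un_disjoint:
  assumes "finite A" "finite C" "A \<inter> C = {}" "sym E" "E \<inter> A \<times> C = {}"
  shows "alpha E (A \<union> C) = alpha E A + alpha E C"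
proof (rule antisym[OF alpha_Un_le[OF assms(1,2)]])
  obtain I where I: "I \<subseteq> A" "independent_in E I" "card I = alpha E A" using alpha_witness assms by metis
  obtain J where J: "J \<subseteq> C" "independent_in E J" "card J = alpha E C" using alpha_witness assms by metis
  have "independent_in E (I \<union> J)"
    using I(1,2) J(1,2) assms(4,5) unfolding independent_in_def by (blast dest: symD)
  moreover have "card (I \<union> J) = card I + card J"
    using I J assms by (intro card_Un_disjoint) (auto intro: finite_subset)
  ultimately show "alpha E A + alpha E C \<le> alpha E (A \<union> C)"
    using alpha_ge[of "A \<union> C" "I \<union> J" E] I J assms by auto
qed

text \<open>An independent set misses \<open>p\<close> or misses \<open>c\<close>; in either case no
  edge is left between the two sides, and their independence numbers add up.\<close>

lemma alpha_Un_edge: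
  assumes fin: "finite A" "finite C" and disj: "A \<inter> C = {}" and "sym E"
    and AC: "E \<inter> A \<times> C \<subseteq> {(p, c)}" and pc: "(p, c) \<in> E"
  shows "alpha E (A \<union> C) = max (alpha E (A - {p}) + alpha E C) (alpha E A + alpha E (C - {c}))"
proof (rule antisym)
  show "alpha E (A \<union> C) \<le> max (alpha E (A - {p}) + alpha E C) (alpha E A + alpha E (C - {c}))"
  proof (rule alpha_le)
    fix I assume I: "I \<subseteq> A \<union> C" "independent_in E I"
    have "I \<subseteq> (A - {p}) \<union> C \<or> I \<subseteq> A \<union> (C - {c})"
      using I pc unfolding independent_in_def by blast
    then have "card I \<le> alpha E ((A - {p}) \<union> C) \<or> card I \<le> alpha E (A \<union> (C - {c}))"
      using I fin by (metis alpha_ge finite_Diff finite_UnI)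
    then show "card I \<le> max (alpha E (A - {p}) + alpha E C) (alpha E A + alpha E (C - {c}))"
      using alpha_Un_le[of "A - {p}" C E] alpha_Un_le[of A "C - {c}" E] fin by auto
  qed (use fin in auto)
  have "alpha E (A - {p}) + alpha E C = alpha E ((A - {p}) \<union> C)"
    using assms by (intro alpha_Un_disjoint[symmetric]) auto
  moreover have "alpha E A + alpha E (C - {c}) = alpha E (A \<union> (C - {c}))"
    using assms by (intro alpha_Un_disjoint[symmetric]) auto
  moreover have "alpha E ((A - {p}) \<union> C) \<le> alpha E (A \<union> C)" "alpha E (A \<union> (C - {c})) \<le> alpha E (A \<union> C)"
    using fin by (auto intro!: alpha_mono)
  ultimately show "max (alpha E (A - {p}) + alpha E C) (alpha E A + alpha E (C - {c})) \<le> alpha E (A \<union> C)"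
    by simp
qed

section \<open>Rooted independence numbers and their loss under deletion\<close>

definition lowers_within :: "nat \<Rightarrow> 'a set \<Rightarrow> ('a set \<Rightarrow> nat) \<Rightarrow> bool" where
  "lowers_within n Y f \<longleftrightarrow> (\<exists>Z\<subseteq>Y. finite Z \<and> card Z \<le> n \<and> f Z < f {})"

definition blocked_by :: "'a rel \<Rightarrow> nat \<Rightarrow> 'a set \<Rightarrow> bool" where
  "blocked_by E b S \<longleftrightarrow>
     (\<forall>Y. alpha E (S - Y) < alpha E S \<longrightarrow> lowers_within b Y (\<lambda>Z. alpha E (S - Z)))"

text \<open>Rooting at \<open>p\<close> looks at the set without \<open>p\<close> and its
  neighbours, and cutting at a bridge looks at its two sides; a bound for \<open>S\<close> itself
  need not pass to such subsets.\<close>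

definition hereditarily_blocked_by :: "'a rel \<Rightarrow> nat \<Rightarrow> 'a set \<Rightarrow> bool" where
  "hereditarily_blocked_by E b S \<longleftrightarrow> (\<forall>S'\<subseteq>S. blocked_by E b S')"

definition profile :: "('a set \<Rightarrow> nat) \<Rightarrow> ('a set \<Rightarrow> nat) \<Rightarrow> bool" where
  "profile a e \<longleftrightarrow> antimono a \<and> antimono e \<and> (\<forall>Z. a Z \<le> e Z \<and> e Z \<le> Suc (a Z))"

text \<open>Here \<open>e Z\<close> and \<open>a Z\<close> stand for the independence numbers of a rooted graph with and without its
  root after the deletion of \<open>Z\<close>. Deleting \<open>Y\<close> may lower both; if no small part of \<open>Y\<close> already does so,
  then every single effect of \<open>Y\<close> is caused by \<open>b\<close> vertices, and \<open>e\<close> is only lowered when the root is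
  in all maximum independent sets.\<close>

definition controlled :: "nat \<Rightarrow> 'a set \<Rightarrow> ('a set \<Rightarrow> nat) \<Rightarrow> ('a set \<Rightarrow> nat) \<Rightarrow> bool" where
  "controlled b Y a e \<longleftrightarrow>
     (\<exists>Z\<subseteq>Y. finite Z \<and> card Z \<le> 2 * b \<and> a Z < a {} \<and> e Z < e {}) \<or>
     ((a Y < a {} \<longrightarrow> lowers_within b Y a) \<and>
      (e Y < e {} \<longrightarrow> e {} = Suc (a {}) \<and> lowers_within b Y e))"

lemma lowers_withinI:
  "Z \<subseteq> Y \<Longrightarrow> finite Z \<Longrightarrow> card Z \<le> n \<Longrightarrow> f Z < f {} \<Longrightarrow> lowers_within n Y f"
  by (auto simp: lowers_within_def)

lemma lowers_withinE:
  assumes "lowers_within n Y f"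
  obtains Z where "Z \<subseteq> Y" "finite Z" "card Z \<le> n" "f Z < f {}"
  using assms by (auto simp: lowers_within_def)

lemma lowers_within_le: "lowers_within n Y f \<Longrightarrow> n \<le> m \<Longrightarrow> lowers_within m Y f"
  by (auto simp: lowers_within_def intro: order_trans)

text \<open>Both losses survive in the union of the two witnesses because deletion is antitone. This
  union is the source of the factor 2.\<close>

lemma lowers_within_combine:
  assumes "lowers_within b Y f" "lowers_within b Y g" "antimono f" "antimono g"
  obtains Z where "Z \<subseteq> Y" "finite Z" "card Z \<le> 2 * b" "f Z < f {}" "g Z < g {}"
proof -
  obtain Z1 where 1: "Z1 \<subseteq> Y" "finite Z1" "card Z1 \<le> b" "f Z1 < f {}"
    using assms(1) by (rule lowers_withinE)
  obtain Z2 where 2: "Z2 \<subseteq> Y" "finite Z2" "card Z2 \<le> b" "g Z2 < g {}"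
    using assms(2) by (rule lowers_withinE)
  have "f (Z1 \<union> Z2) \<le> f Z1" "g (Z1 \<union> Z2) \<le> g Z2" using assms(3,4) by (auto intro: antimonoD)
  then show thesis
    using 1 2 card_Un_le[of Z1 Z2] by (intro that[of "Z1 \<union> Z2"]) auto
qed

lemma controlled_totalI:
  "Z \<subseteq> Y \<Longrightarrow> finite Z \<Longrightarrow> card Z \<le> 2 * b \<Longrightarrow> a Z < a {} \<Longrightarrow> e Z < e {} \<Longrightarrow> controlled b Y a e"
  by (auto simp: controlled_def)

lemma controlled_restI:
  "(a Y < a {} \<Longrightarrow> lowers_within b Y a) \<Longrightarrow>
   (e Y < e {} \<Longrightarrow> e {} = Suc (a {}) \<and> lowers_within b Y e) \<Longrightarrow> controlled b Y a e"
  by (auto simp: controlled_def)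

lemma controlledE:
  assumes "controlled b Y a e"
  obtains Z where "Z \<subseteq> Y" "finite Z" "card Z \<le> 2 * b" "a Z < a {}" "e Z < e {}"
  | "a Y < a {} \<Longrightarrow> lowers_within b Y a" "e Y < e {} \<Longrightarrow> e {} = Suc (a {}) \<and> lowers_within b Y e"
  using assms unfolding controlled_def by blast

lemma controlled_imp_lowers:
  assumes "controlled b Y a e" "e Y < e {}"
  shows "lowers_within (2 * b) Y e"
  using assms(1)
proof (cases rule: controlledE)
  case (1 Z)
  then show ?thesis unfolding lowers_within_def by blast
next
  case 2
  then show ?thesis using assms(2) by (auto intro: lowers_within_le)
qed

lemma lowers_within_mono:
  assumes "lowers_within b Y f" "\<And>Z. Z \<subseteq> Y \<Longrightarrow> f Z < f {} \<Longrightarrow> g Z < g {}"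
  shows "lowers_within b Y g"
  using assms by (auto simp: lowers_within_def)

lemma profileD:
  assumes "profile a e"
  shows "a Z \<le> a {}" "e Z \<le> e {}" "a Z \<le> e Z" "e Z \<le> Suc (a Z)" "antimono a" "antimono e"
  using assms by (auto simp: profile_def intro: antimonoD)

text \<open>\<open>n\<close> is the share of a part detached from the root. If it drops, one witness
  for it lowers both sums; otherwise it is unchanged, and each drop of a sum is a drop of
  \<open>a\<close> or of \<open>e\<close>.\<close>

lemma controlled_add:
  assumes 1: "controlled b Y a e" "profile a e" and n: "antimono n"
    "n Y < n {} \<Longrightarrow> lowers_within (2 * b) Y n"
  shows "controlled b Y (\<lambda>Z. a Z + n Z) (\<lambda>Z. e Z + n Z)"
proof -
  note p = profileD[OF 1(2)]
  have nZ: "n Z \<le> n {}" for Z using n(1) by (auto intro: antimonoD)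
  show ?thesis
  proof (cases "n Y < n {}")
    case True
    then obtain Z where Z: "Z \<subseteq> Y" "finite Z" "card Z \<le> 2 * b" "n Z < n {}"
      using n(2) lowers_withinE by metis
    then show ?thesis using p(1,2)[of Z] by (intro controlled_totalI[of Z]) auto
  next
    case False
    with nZ have nY: "n Y = n {}" by (metis le_neq_implies_less)
    from 1(1) show ?thesis
    proof (cases rule: controlledE)
      case (1 Z)
      then show ?thesis using nZ[of Z] by (intro controlled_totalI[of Z]) auto
    next
      case 2
      show ?thesis
      proof (rule controlled_restI)
        assume "a Y + n Y < a {} + n {}"
        then show "lowers_within b Y (\<lambda>Z. a Z + n Z)"
          using 2(1) nY nZ by (auto elim!: lowers_within_mono intro: add_less_le_mono)
      next
        assume "e Y + n Y < e {} + n {}"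
        then show "e {} + n {} = Suc (a {} + n {}) \<and> lowers_within b Y (\<lambda>Z. e Z + n Z)"
          using 2(2) nY nZ by (auto elim!: lowers_within_mono intro: add_less_le_mono)
      qed
    qed
  qed
qed

text \<open>Two rooted parts are joined by an edge between their roots \<open>p\<close> and
  \<open>c\<close>, and \<open>p\<close> is the new root: without \<open>p\<close> the value is
  \<open>a1 + e2\<close>, with it the better of excluding \<open>p\<close> and excluding
  \<open>c\<close>. The proof sorts by the gaps \<open>e1 - a1\<close> and \<open>e2 - a2\<close>,
  each 0 or 1.\<close>

lemma controlled_join:
  assumes 1: "controlled b Y a1 e1" "profile a1 e1" and 2: "controlled b Y a2 e2" "profile a2 e2"
  shows "controlled b Y (\<lambda>Z. a1 Z + e2 Z) (\<lambda>Z. max (a1 Z + e2 Z) (e1 Z + a2 Z))"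
    (is "controlled b Y ?a ?e")
proof -
  note p = profileD[OF 1(2)] note q = profileD[OF 2(2)]
  have total: ?thesis if "Z \<subseteq> Y" "finite Z" "card Z \<le> 2 * b" "a1 Z < a1 {} \<or> e2 Z < e2 {}"
    "a1 Z + e2 Z < ?e {}" "e1 Z + a2 Z < ?e {}" for Z
  proof (rule controlled_totalI[OF that(1-3)])
    show "?a Z < ?a {}" using that(4) p(1,2)[of Z] q(1,2)[of Z] by linarith
    show "?e Z < ?e {}" using that(5,6) by simp
  qed
  have max0: "a1 {} + e2 {} \<le> ?e {}" "e1 {} + a2 {} \<le> ?e {}" by simp_all
  from 1(1) show ?thesis
  proof (cases rule: controlledE)
    case (1 Z)
    then show ?thesis using q(1,2)[of Z] max0 by (intro total[of Z]) linarith+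
  next
    case c1: 2
    from 2(1) show ?thesis
    proof (cases rule: controlledE)
      case (1 Z)
      then show ?thesis using p(1,2)[of Z] max0 by (intro total[of Z]) linarith+
    next
      case c2: 2
      show ?thesis
      proof (cases "?e Y < ?e {} \<and> ?e {} = ?a {}")
        case False
        show ?thesis
        proof (rule controlled_restI)
          assume "?a Y < ?a {}"
          then have "a1 Y < a1 {} \<or> e2 Y < e2 {}" by linarith
          then have "lowers_within b Y a1 \<or> lowers_within b Y e2" using c1 c2 by blast
          then show "lowers_within b Y ?a"
            using p(1) q(2) by (auto elim!: lowers_within_mono intro: add_less_le_mono add_le_less_mono)
        next
          assume eY: "?e Y < ?e {}"
          with False have ne: "?e {} \<noteq> ?a {}" by blast
          \<comment> \<open>The joined gap is 1 only if the first gap is 1 and the second is 0; then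
            \<open>e1 + a2\<close> is the unique larger term, and any loss in it is a loss of the
            maximum.\<close>
          then have d: "e1 {} = Suc (a1 {})" "e2 {} = a2 {}"
            using p(3,4)[of "{}"] q(3,4)[of "{}"] by (auto simp: max_def split: if_splits)
          then have "e1 Y < e1 {} \<or> a2 Y < a2 {}" using eY by (auto simp: max_def split: if_splits)
          then have "lowers_within b Y e1 \<or> lowers_within b Y a2" using c1 c2 by blast
          moreover have "?e Z < ?e {}" if "e1 Z < e1 {} \<or> a2 Z < a2 {}" for Z
            using that d p(1,2)[of Z] q(1,2)[of Z] by auto
          ultimately have "lowers_within b Y ?e"
            by (auto elim!: lowers_within_mono)
          then show "?e {} = Suc (?a {}) \<and> lowers_within b Y ?e" using d by auto
        qed
      next
        case True
        then have Y: "a1 Y + e2 Y < ?a {}" "e1 Y + a2 Y < ?a {}" by auto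
        \<comment> \<open>First gap 1 with second gap 0 would make the joined gap 1, so three
          combinations are left.\<close>
        have cases: "(e1 {} = a1 {} \<and> e2 {} = a2 {}) \<or> (e1 {} = a1 {} \<and> e2 {} = Suc (a2 {}))
           \<or> (e1 {} = Suc (a1 {}) \<and> e2 {} = Suc (a2 {}))"
          using True p(3,4)[of "{}"] q(3,4)[of "{}"] by (auto simp: max_def split: if_splits)
        have l1: "lowers_within b Y a1 \<or> lowers_within b Y e2"
          using Y(1) c1 c2 by (metis add_le_mono not_le)
        from cases show ?thesis
        proof (elim disjE conjE)
          \<comment> \<open>Without gaps the invariant forbids a loss of \<open>e1\<close> or
            \<open>e2\<close>. So \<open>a1\<close> and \<open>a2\<close> both drop, and uniting
            their witnesses lowers both terms.\<close>
          assume d: "e1 {} = a1 {}" "e2 {} = a2 {}"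
          then have "\<not> e1 Y < e1 {}" "\<not> e2 Y < e2 {}" using c1 c2 by auto
          then have "a1 Y < a1 {}" "a2 Y < a2 {}" using Y d by auto
          then obtain Z where "Z \<subseteq> Y" "finite Z" "card Z \<le> 2 * b" "a1 Z < a1 {}" "a2 Z < a2 {}"
            using lowers_within_combine[of b Y a1 a2] c1 c2 p q by metis
          then have Z: "Z \<subseteq> Y" "finite Z" "card Z \<le> 2 * b" "a1 Z < a1 {}" "a2 Z < a2 {}"
            by blast+
          then show ?thesis using d p(1-4)[of Z] q(1-4)[of Z] max0 by (intro total[of Z]) linarith+
        next
          \<comment> \<open>The term \<open>e1 + a2\<close> already lies below the maximum; one
            witness for \<open>a1 + e2\<close> suffices.\<close>
          assume d: "e1 {} = a1 {}" "e2 {} = Suc (a2 {})"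
          from l1 obtain Z where "Z \<subseteq> Y" "finite Z" "card Z \<le> b" "a1 Z < a1 {} \<or> e2 Z < e2 {}"
            by (metis lowers_withinE)
          then show ?thesis using d p(1-4)[of Z] q(1-4)[of Z] max0 by (intro total[of Z]) linarith+
        next
          \<comment> \<open>The two terms tie, so each of them needs a witness.\<close>
          assume d: "e1 {} = Suc (a1 {})" "e2 {} = Suc (a2 {})"
          have "e1 Y < e1 {} \<or> a2 Y < a2 {}" using Y d by linarith
          then have l2: "lowers_within b Y e1 \<or> lowers_within b Y a2" using c1 c2 by blast
          then obtain Z where "Z \<subseteq> Y" "finite Z" "card Z \<le> 2 * b" "a1 Z < a1 {} \<or> e2 Z < e2 {}"
              "e1 Z < e1 {} \<or> a2 Z < a2 {}"
            using l1 p(5,6) q(5,6) by (metis lowers_within_combine)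
          then show ?thesis using d p(1-4)[of Z] q(1-4)[of Z] max0 by (intro total[of Z]) linarith+
        qed
      qed
    qed
  qed
qed

lemma antimono_alpha: "finite S \<Longrightarrow> antimono (\<lambda>Z. alpha E (S - Z))"
  by (intro antimonoI alpha_mono) auto

lemma profile_alpha:
  assumes "finite S"
  shows "profile (\<lambda>Z. alpha E (S - {p} - Z)) (\<lambda>Z. alpha E (S - Z))"
proof -
  have "alpha E (S - {p} - Z) \<le> alpha E (S - Z)" for Z
    using assms by (intro alpha_mono) auto
  moreover have "alpha E (S - Z) \<le> Suc (alpha E (S - {p} - Z))" for Z
  proof -
    have "S - Z - {p} = S - {p} - Z" by auto
    then show ?thesis using alpha_del_vertex[of "S - Z" E p] assms by simp
  qed
  ultimately show ?thesis
    using assms by (auto simp: profile_def intro!: antimono_alpha)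
qed

text \<open>The base of the recursion along the tree. For \<open>Z\<close> avoiding
  \<open>p\<close>, the second function is the larger of two alternatives: \<open>?a Z\<close> for
  independent sets without \<open>p\<close>, and \<open>Suc (?c Z)\<close> for those with
  \<open>p\<close> and hence without its neighbours.\<close>

lemma controlled_root:
  assumes fin: "finite S" and "1 \<le> b" and p: "p \<in> S" "(p, p) \<notin> E" and "sym E"
    and hb: "hereditarily_blocked_by E b (S - {p})"
  shows "controlled b Y (\<lambda>Z. alpha E (S - {p} - Z)) (\<lambda>Z. alpha E (S - Z))"
    (is "controlled b Y ?a ?e")
proof -
  let ?N = "{x. (p, x) \<in> E}"
  let ?c = "\<lambda>Z. alpha E (S - {p} - ?N - Z)"
  have prof: "profile ?a ?e" by (rule profile_alpha[OF fin])
  note pr = profileD[OF prof]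
  have le: "?e Z \<le> max (?a Z) (Suc (?c Z))" for Z
  proof (rule alpha_le)
    fix I assume I: "I \<subseteq> S - Z" "independent_in E I"
    show "card I \<le> max (?a Z) (Suc (?c Z))"
    proof (cases "p \<in> I")
      case True
      have "card (I - {p}) \<le> ?c Z"
        using I True fin by (intro alpha_ge) (auto simp: independent_in_def)
      moreover have "Suc (card (I - {p})) = card I"
        using True I fin by (intro card_Suc_Diff1) (auto intro: finite_subset)
      ultimately show ?thesis by simp
    next
      case False
      then have "I \<subseteq> S - {p} - Z" using I by auto
      then have "card I \<le> ?a Z" using I fin by (intro alpha_ge) auto
      then show ?thesis by simp
    qed
  qed (use fin in auto)
  have ge: "Suc (?c Z) \<le> ?e Z" if pZ: "p \<notin> Z" for Z
  proof -
    obtain I where I: "I \<subseteq> S - {p} - ?N - Z" "independent_in E I" "card I = ?c Z"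
      by (rule alpha_witness[of "S - {p} - ?N - Z" E]) (use fin in auto)
    have "independent_in E (insert p I)" using I p \<open>sym E\<close> by (auto simp: independent_in_def dest: symD)
    then have "card (insert p I) \<le> ?e Z" using I p pZ fin by (intro alpha_ge) auto
    moreover have "card (insert p I) = Suc (card I)"
      using I fin by (intro card_insert_disjoint) (auto intro: finite_subset)
    ultimately show ?thesis using I by simp
  qed
  have ge0: "Suc (?c {}) \<le> ?e {}" by (rule ge) blast
  have la: "lowers_within b Y ?a" if "?a Y < ?a {}"
    using hb that by (auto simp: hereditarily_blocked_by_def blocked_by_def)
  have lc: "lowers_within b Y ?c" if "?c Y < ?c {}"
    using hb that unfolding hereditarily_blocked_by_def blocked_by_def
    by (metis Diff_empty Diff_subset)
  have cZ: "?c Z \<le> ?c {}" for Z using fin by (intro alpha_mono) auto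
  have pY: "?e Z = ?a Z" if "p \<in> Z" for Z
  proof -
    have "S - {p} - Z = S - Z" using that by auto
    then show ?thesis by simp
  qed
  have cY: "?c Y < ?c {}" if "?e Y < ?e {}" "Suc (?c {}) = ?e {}" "p \<notin> Y"
    using ge[OF that(3)] that by linarith
  show ?thesis
  proof (cases "?e Y < ?e {} \<and> ?e {} = ?a {}")
    case False
    show ?thesis
    proof (rule controlled_restI[OF la])
      assume eY: "?e Y < ?e {}"
      with False have e: "?e {} = Suc (?a {})" using pr(3,4)[of "{}"] by auto
      then have c: "Suc (?c {}) = ?e {}" using le[of "{}"] ge0
        unfolding le_max_iff_disj by linarith
      have "lowers_within b Y ?e"
      proof (cases "p \<in> Y")
        case True
        have "?e {p} = ?a {p}" by (rule pY) simp
        then have less: "?e {p} < ?e {}" using pr(1)[of "{p}"] e by linarith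
        show ?thesis
          by (rule lowers_withinI[of "{p}", OF _ _ _ less]) (use True \<open>1 \<le> b\<close> in simp_all)
      next
        case False
        show ?thesis
        proof (rule lowers_within_mono[OF lc[OF cY[OF eY c False]]])
          fix Z assume "?c Z < ?c {}"
          then show "?e Z < ?e {}" using le[of Z] pr(1)[of Z] e c unfolding le_max_iff_disj by linarith
        qed
      qed
      then show "?e {} = Suc (?a {}) \<and> lowers_within b Y ?e" using e by simp
    qed auto
  next
    case True
    then have "?a Y < ?a {}" using pr(3)[of Y] by linarith
    then have la': "lowers_within b Y ?a" by (rule la)
    then obtain Z1 where Z1: "Z1 \<subseteq> Y" "finite Z1" "card Z1 \<le> b" "?a Z1 < ?a {}"
      by (rule lowers_withinE)
    \<comment> \<open>Both alternatives must be lowered. The one using \<open>p\<close> is already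
      smaller, or disappears by deleting \<open>p\<close> (a witness of size \<open>b + 1\<close>,
      at most \<open>2 * b\<close>), or needs a witness of its own.\<close>
    consider "Suc (?c {}) < ?e {}" | "p \<in> Y" | "Suc (?c {}) = ?e {}" "p \<notin> Y"
      using ge0 by linarith
    then show ?thesis
    proof cases
      case 1
      then have "?e Z1 < ?e {}" using Z1(4) le[of Z1] cZ[of Z1] True unfolding le_max_iff_disj by linarith
      then show ?thesis using Z1 \<open>1 \<le> b\<close> by (intro controlled_totalI[of Z1]) linarith+
    next
      case 2
      have "?a (insert p Z1) \<le> ?a Z1" using fin by (intro alpha_mono) auto
      then have "?a (insert p Z1) < ?a {}" "?e (insert p Z1) < ?e {}"
        using Z1(4) pY[of "insert p Z1"] True by simp_all
      moreover have "card (insert p Z1) \<le> 2 * b"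
        using card_insert_le_m1[of "Suc (card Z1)" Z1 p] Z1(2,3) \<open>1 \<le> b\<close> by (simp add: card_insert_if)
      ultimately show ?thesis using Z1 2
        by (intro controlled_totalI[of "insert p Z1"]) simp_all
    next
      case 3
      have "antimono ?a" "antimono ?c" using fin by (auto intro!: antimono_alpha)
      then obtain Z where Z: "Z \<subseteq> Y" "finite Z" "card Z \<le> 2 * b" "?a Z < ?a {}" "?c Z < ?c {}"
        using lowers_within_combine[OF la' lc[OF cY]] True 3 by metis
      then have "?e Z < ?e {}" using le[of Z] True 3 unfolding le_max_iff_disj by linarith
      with Z show ?thesis by (intro controlled_totalI[of Z])
    qed
  qed
qed

text \<open>If \<open>p\<close> has a neighbour in \<open>T\<close>, cutting this bridge leaves two
  smaller rooted instances to be joined; otherwise the component of \<open>p\<close> contains no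
  other vertex of \<open>T\<close>, and \<open>controlled_root\<close> applies to it. The hypotheses
  say that edges within \<open>T\<close> are bridges and that \<open>T\<close> is linked in no other
  way; both pass to subsets, so \<open>T\<close> may fall apart on the way.\<close>

lemma controlled_tree:
  assumes "finite S" "1 \<le> b" "sym E" "\<And>v. (v, v) \<notin> E" "T \<subseteq> S" "p \<in> T"
    and "\<And>x y. x \<in> T \<Longrightarrow> y \<in> T \<Longrightarrow> (x, y) \<in> E \<Longrightarrow> bridge_in (rs E S) x y"
    and "\<And>x y. x \<in> T \<Longrightarrow> y \<in> T \<Longrightarrow> (x, y) \<in> (rs E S - T \<times> T)\<^sup>* \<Longrightarrow> x = y"
    and "hereditarily_blocked_by E b (S - T)"
  shows "controlled b Y (\<lambda>Z. alpha E (S - {p} - Z)) (\<lambda>Z. alpha E (S - Z))"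
  using assms(1,5-)
proof (induction "card S" arbitrary: S T p rule: less_induct)
  case less
  note fin = \<open>finite S\<close> and TS = \<open>T \<subseteq> S\<close> and pT = \<open>p \<in> T\<close>
  note br = less.prems(4) and sep = less.prems(5) and hb = less.prems(6)
  have sub: "controlled b Y (\<lambda>Z. alpha E (A - {q} - Z)) (\<lambda>Z. alpha E (A - Z))"
    if A: "A \<subseteq> S" "A \<noteq> S" "q \<in> T \<inter> A" for A q
  proof (rule less.hyps[of A "T \<inter> A" q])
    show "card A < card S" using A fin by (auto intro: psubset_card_mono)
    show "finite A" using A fin finite_subset by blast
    show "T \<inter> A \<subseteq> A" "q \<in> T \<inter> A" using A by auto
    show "bridge_in (rs E A) x y" if "x \<in> T \<inter> A" "y \<in> T \<inter> A" "(x, y) \<in> E" for x y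
      using br[of x y] that A by (auto intro: bridge_in_mono)
    show "x = y" if xy: "x \<in> T \<inter> A" "y \<in> T \<inter> A"
      and *: "(x, y) \<in> (rs E A - (T \<inter> A) \<times> (T \<inter> A))\<^sup>*" for x y
    proof -
      have "rs E A - (T \<inter> A) \<times> (T \<inter> A) \<subseteq> rs E S - T \<times> T" using A by auto
      then have "(x, y) \<in> (rs E S - T \<times> T)\<^sup>*" using * rtrancl_mono by blast
      then show ?thesis using sep xy by auto
    qed
    have "A - T \<inter> A \<subseteq> S - T" using A by auto
    then show "hereditarily_blocked_by E b (A - T \<inter> A)"
      using hb unfolding hereditarily_blocked_by_def by (meson subset_trans)
  qed
  show ?case
  proof (cases "\<exists>c\<in>T. (p, c) \<in> E")
    case True
    then obtain c where c: "c \<in> T" "(p, c) \<in> E" by auto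
    define D where "D = rs E S - {(p, c), (c, p)}"
    define A where "A = {x. (p, x) \<in> D\<^sup>*}"
    have pA: "p \<in> A" by (simp add: A_def)
    have cA: "c \<notin> A" using br[OF pT c] by (simp add: bridge_in_def A_def D_def)
    have AS: "A \<subseteq> S"
    proof
      fix x assume "x \<in> A"
      then have "(p, x) \<in> D\<^sup>*" by (simp add: A_def)
      then show "x \<in> S" by (induction rule: rtrancl_induct) (use pT TS in \<open>auto simp: D_def\<close>)
    qed
    have edge: "E \<inter> A \<times> (S - A) \<subseteq> {(p, c)}"
    proof clarify
      fix x y assume xy: "(x, y) \<in> E" "x \<in> A" "y \<in> S" "y \<notin> A"
      then have "(x, y) \<notin> D" by (auto simp: A_def intro: rtrancl.rtrancl_into_rtrancl)
      then show "x = p \<and> y = c" using xy AS pA by (auto simp: D_def)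
    qed
    have cS: "c \<in> S - A" using c TS cA by auto
    have S: "A \<union> (S - A) = S" using AS by auto
    have 1: "controlled b Y (\<lambda>Z. alpha E (A - {p} - Z)) (\<lambda>Z. alpha E (A - Z))"
      using AS cS pT pA by (intro sub) auto
    have 2: "controlled b Y (\<lambda>Z. alpha E (S - A - {c} - Z)) (\<lambda>Z. alpha E (S - A - Z))"
      using AS cS pT pA c TS by (intro sub) auto
    have finA: "finite A" using AS fin finite_subset by blast
    have a: "alpha E (S - {p} - Z) = alpha E (A - {p} - Z) + alpha E (S - A - Z)" for Z
    proof -
      have "S - {p} - Z = (A - {p} - Z) \<union> (S - A - Z)" using AS pA by auto
      then show ?thesis using edge fin finA \<open>sym E\<close> by (auto intro!: alpha_Un_disjoint)
    qed
    have e: "alpha E (S - Z) = max (alpha E (A - {p} - Z) + alpha E (S - A - Z))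
        (alpha E (A - Z) + alpha E (S - A - {c} - Z))" for Z
    proof -
      have *: "S - Z = (A - Z) \<union> (S - A - Z)" "A - {p} - Z = A - Z - {p}"
        "S - A - {c} - Z = S - A - Z - {c}" using AS by auto
      show ?thesis unfolding * by (rule alpha_Un_edge) (use edge fin finA \<open>sym E\<close> c in auto)
    qed
    show ?thesis unfolding a e
      by (rule controlled_join[OF 1 _ 2]) (use fin finA in \<open>auto intro!: profile_alpha\<close>)
  next
    case False
    define A where "A = comp_of E S p"
    have pS: "p \<in> S" using pT TS by auto
    have AS: "A \<subseteq> S" using comp_of_subset[OF pS] by (simp add: A_def)
    have finA: "finite A" using AS fin finite_subset by blast
    have pA: "p \<in> A" by (simp add: A_def)
    \<comment> \<open>No walk from \<open>p\<close> uses an edge inside \<open>T\<close>: it would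
      first reach an end of that edge without such edges, by \<open>sep\<close> this end is
      \<open>p\<close>, and \<open>p\<close> has no neighbour in \<open>T\<close>.\<close>
    have reach: "(p, y) \<in> (rs E S - T \<times> T)\<^sup>*" if "(p, y) \<in> (rs E S)\<^sup>*" for y
      using that
    proof (induction rule: rtrancl_induct)
      case (step y z)
      show ?case
      proof (cases "(y, z) \<in> T \<times> T")
        case True
        then have "y = p" using sep[of p y] step(3) pT by auto
        then show ?thesis using False True step(2) by auto
      next
        case False
        then show ?thesis using step by (meson DiffI rtrancl.rtrancl_into_rtrancl)
      qed
    qed simp
    have TA: "T \<inter> A = {p}"
      using reach sep pT pA by (auto simp: A_def comp_of_def)
    have none: "E \<inter> A \<times> (S - A) = {}"
      using comp_of_closed[of _ E S p, OF _ pS] by (auto simp: A_def)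
    have "A - {p} \<subseteq> S - T" using TA AS by auto
    then have "hereditarily_blocked_by E b (A - {p})"
      using hb unfolding hereditarily_blocked_by_def by (meson subset_trans)
    then have 1: "controlled b Y (\<lambda>Z. alpha E (A - {p} - Z)) (\<lambda>Z. alpha E (A - Z))"
      using finA assms(2,3,4) pA by (intro controlled_root) auto
    have n: "lowers_within (2 * b) Y (\<lambda>Z. alpha E (S - A - Z))"
      if "alpha E (S - A - Y) < alpha E (S - A - {})"
    proof (cases "T \<inter> (S - A) = {}")
      case True
      then have "S - A \<subseteq> S - T" by auto
      then have "blocked_by E b (S - A)" using hb by (auto simp: hereditarily_blocked_by_def)
      then have "lowers_within b Y (\<lambda>Z. alpha E (S - A - Z))"
        using that unfolding blocked_by_def Diff_empty by blast
      then show ?thesis by (rule lowers_within_le) simp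
    next
      case False
      then obtain q where "q \<in> T \<inter> (S - A)" by auto
      then have "controlled b Y (\<lambda>Z. alpha E (S - A - {q} - Z)) (\<lambda>Z. alpha E (S - A - Z))"
        using pA pS by (intro sub) auto
      then show ?thesis using that by (rule controlled_imp_lowers)
    qed
    have a: "alpha E (S - {p} - Z) = alpha E (A - {p} - Z) + alpha E (S - A - Z)" for Z
    proof -
      have "S - {p} - Z = (A - {p} - Z) \<union> (S - A - Z)" using AS pA by auto
      then show ?thesis using none fin finA \<open>sym E\<close> by (auto intro!: alpha_Un_disjoint)
    qed
    have e: "alpha E (S - Z) = alpha E (A - Z) + alpha E (S - A - Z)" for Z
    proof -
      have "S - Z = (A - Z) \<union> (S - A - Z)" using AS pA by auto
      then show ?thesis using none fin finA \<open>sym E\<close> by (auto intro!: alpha_Un_disjoint)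
    qed
    show ?thesis unfolding a e
      by (rule controlled_add[OF 1]) (use fin finA n in \<open>auto intro!: profile_alpha antimono_alpha\<close>)
  qed
qed

text \<open>Any tree vertex serves as the root, since only the loss of the second function, the
  unrooted independence number, is in question.\<close>

lemma hereditarily_blocked_tree:
  assumes "finite S" "1 \<le> b" "sym E" "\<And>v. (v, v) \<notin> E" "T \<subseteq> S"
    and br: "\<And>x y. x \<in> T \<Longrightarrow> y \<in> T \<Longrightarrow> (x, y) \<in> E \<Longrightarrow> bridge_in (rs E S) x y"
    and sep: "\<And>x y. x \<in> T \<Longrightarrow> y \<in> T \<Longrightarrow> (x, y) \<in> (rs E S - T \<times> T)\<^sup>* \<Longrightarrow> x = y"
    and hb: "hereditarily_blocked_by E b (S - T)"
  shows "hereditarily_blocked_by E (2 * b) S"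
  unfolding hereditarily_blocked_by_def
proof (intro allI impI)
  fix A assume A: "A \<subseteq> S"
  have hbA: "hereditarily_blocked_by E b (A - T \<inter> A)"
    using hb A unfolding hereditarily_blocked_by_def by blast
  show "blocked_by E (2 * b) A"
    unfolding blocked_by_def
  proof (intro allI impI)
    fix Y assume Y: "alpha E (A - Y) < alpha E A"
    show "lowers_within (2 * b) Y (\<lambda>Z. alpha E (A - Z))"
    proof (cases "T \<inter> A = {}")
      case True
      then have "blocked_by E b A" using hbA by (auto simp: hereditarily_blocked_by_def)
      then have "lowers_within b Y (\<lambda>Z. alpha E (A - Z))"
        using Y unfolding blocked_by_def by blast
      then show ?thesis by (rule lowers_within_le) simp
    next
      case False
      then obtain q where q: "q \<in> T \<inter> A" by auto
      have "controlled b Y (\<lambda>Z. alpha E (A - {q} - Z)) (\<lambda>Z. alpha E (A - Z))"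
      proof (rule controlled_tree[where T = "T \<inter> A"])
        show "finite A" using A assms finite_subset by blast
        show "bridge_in (rs E A) x y" if "x \<in> T \<inter> A" "y \<in> T \<inter> A" "(x, y) \<in> E" for x y
          using br[of x y] that A by (auto intro: bridge_in_mono)
        show "x = y" if xy: "x \<in> T \<inter> A" "y \<in> T \<inter> A"
          and *: "(x, y) \<in> (rs E A - (T \<inter> A) \<times> (T \<inter> A))\<^sup>*" for x y
        proof -
          have "rs E A - (T \<inter> A) \<times> (T \<inter> A) \<subseteq> rs E S - T \<times> T" using A by auto
          then have "(x, y) \<in> (rs E S - T \<times> T)\<^sup>*" using * rtrancl_mono by blast
          then show ?thesis using sep xy by auto
        qed
      qed (use assms q hbA in auto)
      then show ?thesis by (rule controlled_imp_lowers) (use Y in simp)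
    qed
  qed
qed

section \<open>Bridge-depth bounds minimal blocking sets\<close>

lemma rtrancl_on_iff:
  assumes "B \<subseteq> V \<times> V"
  shows "(u, v) \<in> rtrancl_on V B \<longleftrightarrow> u \<in> V \<and> (u, v) \<in> B\<^sup>*"
proof
  assume "(u, v) \<in> rtrancl_on V B"
  then show "u \<in> V \<and> (u, v) \<in> B\<^sup>*"
    by (induction rule: rtrancl_on_induct) (auto intro: rtrancl.rtrancl_into_rtrancl)
next
  assume *: "u \<in> V \<and> (u, v) \<in> B\<^sup>*"
  then have "(u, v) \<in> B\<^sup>*" by simp
  then show "(u, v) \<in> rtrancl_on V B"
  proof (induction rule: rtrancl_induct)
    case (step y z)
    then show ?case using assms by (auto intro: rtrancl_on_into_rtrancl_on)
  qed (use * in simp)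
qed

lemma reachable_with_proj:
  assumes "parcs G \<subseteq> pverts G \<times> pverts G"
  shows "reachable (with_proj G) u v \<longleftrightarrow> u \<in> pverts G \<and> (u, v) \<in> (parcs G)\<^sup>*"
  unfolding reachable_def with_proj_simps(3) using rtrancl_on_iff[OF assms] by simp

lemma pair_graphD:
  assumes "pair_graph G"
  shows "finite (pverts G)" "parcs G \<subseteq> pverts G \<times> pverts G" "sym (parcs G)" "(v, v) \<notin> parcs G"
    "rs (parcs G) (pverts G) = parcs G"
  using assms by (auto simp: pair_graph_iff)

lemma sccs_verts_with_proj:
  assumes "parcs G \<subseteq> pverts G \<times> pverts G" "sym (parcs G)"
  shows "pre_digraph.sccs_verts (with_proj G) = (\<lambda>x. (parcs G)\<^sup>* `` {x}) ` pverts G"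
proof -
  let ?R = "(parcs G)\<^sup>*"
  have sy: "(x, y) \<in> ?R \<Longrightarrow> (y, x) \<in> ?R" for x y using rtrancl_sym[OF assms(2)] .
  have cl: "y \<in> pverts G" if "(x, y) \<in> ?R" "x \<in> pverts G" for x y
    using that by (induction rule: rtrancl_induct) (use assms(1) in auto)
  have "C \<in> pre_digraph.sccs_verts (with_proj G) \<longleftrightarrow> C \<in> (\<lambda>x. ?R `` {x}) ` pverts G" for C
  proof
    assume "C \<in> pre_digraph.sccs_verts (with_proj G)"
    then have C: "C \<noteq> {}" "\<And>u v. u \<in> C \<Longrightarrow> v \<in> C \<Longrightarrow> u \<in> pverts G \<and> (u, v) \<in> ?R"
      "\<And>u v. u \<in> C \<Longrightarrow> v \<notin> C \<Longrightarrow> \<not> ((u, v) \<in> ?R \<and> v \<in> pverts G \<and> (v, u) \<in> ?R)"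
      by (auto simp: pre_digraph.sccs_verts_def reachable_with_proj[OF assms(1)])
    then obtain x where x: "x \<in> C" by auto
    then have "C = ?R `` {x}" using C(2)[OF x] C(3)[OF x] sy[of x] cl[of x] by blast
    then show "C \<in> (\<lambda>x. ?R `` {x}) ` pverts G" using C(2)[OF x x] by blast
  next
    assume "C \<in> (\<lambda>x. ?R `` {x}) ` pverts G"
    then obtain x where x: "x \<in> pverts G" "C = ?R `` {x}" by auto
    have 1: "u \<in> pverts G \<and> (u, v) \<in> ?R" if "u \<in> C" "v \<in> C" for u v
    proof -
      have "(x, u) \<in> ?R" "(x, v) \<in> ?R" using that x by auto
      then show ?thesis using cl[OF _ x(1)] rtrancl_trans[OF sy] by blast
    qed
    have 2: "v \<in> C" if "u \<in> C" "(u, v) \<in> ?R" for u v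
      using that x rtrancl_trans[of x u "parcs G" v] by auto
    have 3: "x \<in> C" using x by simp
    show "C \<in> pre_digraph.sccs_verts (with_proj G)"
      unfolding pre_digraph.sccs_verts_def reachable_with_proj[OF assms(1)] mem_Collect_eq
      by (intro conjI ballI allI impI) (use 3 in blast, (use 1 in blast)+, use 2 in blast)
  qed
  then show ?thesis by blast
qed

lemma sccs_verts_pair_graph:
  assumes "pair_graph G"
  shows "pre_digraph.sccs_verts (with_proj G) = comp_of (parcs G) (pverts G) ` pverts G"
  using sccs_verts_with_proj[OF pair_graphD(2,3)[OF assms]]
  unfolding comp_of_def pair_graphD(5)[OF assms] by (simp add: Image_singleton)

lemma connected_iff_conn_on:
  assumes "pair_graph G"
  shows "connected (with_proj G) \<longleftrightarrow> conn_on (parcs G) (pverts G)"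
proof -
  note g = pair_graphD[OF assms]
  have "mk_symmetric (with_proj G) = \<lparr>pverts = pverts G, parcs = parcs G\<rparr>"
    using g(3) by (auto simp: mk_symmetric_def dest: symD)
  then have "mk_symmetric (with_proj G) = G" by simp
  then show ?thesis
    unfolding connected_def strongly_connected_def conn_on_def g(5)
    using reachable_with_proj[OF g(2)] by auto
qed

text \<open>Each new component lies in one old component; \<open>h\<close> sends it there and
  reaches every old one. So the count grows as soon as \<open>h\<close> is not injective, which the
  components of \<open>u\<close> and \<open>v\<close> witness.\<close>

lemma card_Image_rtrancl_less_iff:
  assumes "finite V" "E \<subseteq> V \<times> V" "sym E" "(u, v) \<in> E"
  defines "E' \<equiv> E - {(u, v), (v, u)}"
  shows "card ((\<lambda>x. E\<^sup>* `` {x}) ` V) < card ((\<lambda>x. E'\<^sup>* `` {x}) ` V) \<longleftrightarrow> (u, v) \<notin> E'\<^sup>*"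
proof (cases "(u, v) \<in> E'\<^sup>*")
  case True
  have symE': "sym E'" using sym_diff_edge[OF assms(3)] by (simp add: E'_def)
  have "E \<subseteq> E'\<^sup>*" using True rtrancl_sym[OF symE' True] by (auto simp: E'_def)
  then have "E\<^sup>* = E'\<^sup>*" by (intro rtrancl_subset) (auto simp: E'_def)
  then show ?thesis using True by simp
next
  case False
  have symE': "sym E'" using sym_diff_edge[OF assms(3)] by (simp add: E'_def)
  have sub: "E'\<^sup>* \<subseteq> E\<^sup>*" by (rule rtrancl_mono) (auto simp: E'_def)
  define h where "h A = E\<^sup>* `` A" for A
  have hE: "h (E'\<^sup>* `` {x}) = E\<^sup>* `` {x}" for x
  proof
    show "h (E'\<^sup>* `` {x}) \<subseteq> E\<^sup>* `` {x}"
    proof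
      fix z assume "z \<in> h (E'\<^sup>* `` {x})"
      then obtain y where "(x, y) \<in> E'\<^sup>*" "(y, z) \<in> E\<^sup>*" by (auto simp: h_def)
      then have "(x, z) \<in> E\<^sup>*" using sub rtrancl_trans[of x y E z] by blast
      then show "z \<in> E\<^sup>* `` {x}" by simp
    qed
    show "E\<^sup>* `` {x} \<subseteq> h (E'\<^sup>* `` {x})" by (auto simp: h_def)
  qed
  let ?A = "(\<lambda>x. E'\<^sup>* `` {x}) ` V"
  have im: "h ` ?A = (\<lambda>x. E\<^sup>* `` {x}) ` V" unfolding image_image hE ..
  have fin: "finite ?A" using assms(1) by simp
  have uv: "u \<in> V" "v \<in> V" using assms(2,4) by auto
  have "E'\<^sup>* `` {u} \<noteq> E'\<^sup>* `` {v}" using False by auto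
  moreover have "E\<^sup>* `` {u} = E\<^sup>* `` {v}"
  proof -
    have "(u, v) \<in> E\<^sup>*" "(v, u) \<in> E\<^sup>*" using assms(3,4) by (auto dest: symD)
    then show ?thesis using rtrancl_trans[of u v E] rtrancl_trans[of v u E] by blast
  qed
  ultimately have "\<not> inj_on h ?A"
    using inj_onD[of h ?A "E'\<^sup>* `` {u}" "E'\<^sup>* `` {v}"] uv unfolding hE by blast
  then have "card (h ` ?A) < card ?A"
    using card_image_le[OF fin, of h] eq_card_imp_inj_on[OF fin, of h] by linarith
  then show ?thesis using False by (simp add: im)
qed

lemma bridges_iff:
  assumes "pair_graph G"
  shows "(u, v) \<in> bridges G \<longleftrightarrow> (u, v) \<in> parcs G \<and> bridge_in (parcs G) u v"
proof (cases "(u, v) \<in> parcs G")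
  case True
  note g = pair_graphD[OF assms] and g' = pair_graphD[OF pair_graph_pdel_edge[OF assms, of u v]]
  have "parcs (pdel_edge G u v) = parcs G - {(u, v), (v, u)}" "pverts (pdel_edge G u v) = pverts G"
    by (simp_all add: pdel_edge_def)
  then show ?thesis
    using card_Image_rtrancl_less_iff[OF g(1,2,3) True] True sccs_verts_with_proj[OF g(2,3)]
      sccs_verts_with_proj[OF g'(2,3)]
    by (simp add: bridges_def bridge_in_def)
qed (auto simp: bridges_def)

lemma sym_bridges:
  assumes "pair_graph G"
  shows "sym (bridges G)"
proof (rule symI)
  fix u v assume "(u, v) \<in> bridges G"
  then show "(v, u) \<in> bridges G"
    using pair_graphD(3)[OF assms] bridge_in_sym[of "parcs G" u v]
    by (auto simp: bridges_iff[OF assms] dest: symD)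
qed

lemma contract_rep:
  assumes "B \<subseteq> pverts G \<times> pverts G" "sym B" "u \<in> pverts G"
  shows "contract_rep G B u \<in> pverts G" "(u, contract_rep G B u) \<in> B\<^sup>*"
    "v \<in> pverts G \<Longrightarrow> contract_rep G B u = contract_rep G B v \<longleftrightarrow> (u, v) \<in> B\<^sup>*"
proof -
  let ?H = "\<lparr>pverts = pverts G, parcs = B\<rparr>"
  have scc: "pre_digraph.scc_of (with_proj ?H) x = {y. (x, y) \<in> B\<^sup>*}" if "x \<in> pverts G" for x
  proof -
    have "y \<in> pverts G" if "(x, y) \<in> B\<^sup>*" for y
      using that by (induction rule: rtrancl_induct) (use assms(1) \<open>x \<in> pverts G\<close> in auto)
    then show ?thesis
      using rtrancl_sym[OF assms(2)] that reachable_with_proj[of ?H] assms(1)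
      unfolding pre_digraph.scc_of_def by auto
  qed
  show "contract_rep G B u \<in> pverts G" using assms(3) by (rule contract_rep_in)
  have rep: "(x, contract_rep G B x) \<in> B\<^sup>*" if "x \<in> pverts G" for x
    unfolding contract_rep_def scc[OF that] using someI[of "\<lambda>v. v \<in> {y. (x, y) \<in> B\<^sup>*}" x] by simp
  then show "(u, contract_rep G B u) \<in> B\<^sup>*" using assms(3) .
  assume v: "v \<in> pverts G"
  show "contract_rep G B u = contract_rep G B v \<longleftrightarrow> (u, v) \<in> B\<^sup>*"
  proof
    assume "contract_rep G B u = contract_rep G B v"
    then have "(u, contract_rep G B v) \<in> B\<^sup>*" "(contract_rep G B v, v) \<in> B\<^sup>*"
      using rep[OF assms(3)] rtrancl_sym[OF assms(2) rep[OF v]] by simp_all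
    then show "(u, v) \<in> B\<^sup>*" by (rule rtrancl_trans)
  next
    assume uv: "(u, v) \<in> B\<^sup>*"
    then have "{y. (u, y) \<in> B\<^sup>*} = {y. (v, y) \<in> B\<^sup>*}"
      using rtrancl_trans[OF uv] rtrancl_trans[OF rtrancl_sym[OF assms(2) uv]] by blast
    then show "contract_rep G B u = contract_rep G B v"
      unfolding contract_rep_def scc[OF assms(3)] scc[OF v] by simp
  qed
qed

text \<open>Bridge-depth contracts again and again, while blocking sets live in the original graph.
  This relation ties the two together: \<open>F\<close> on \<open>W\<close> is a quotient of
  \<open>E\<close> on \<open>S\<close> with connected fibres. It composes and restricts, so it
  survives the whole recursion.\<close>

definition contraction_map ::
  "('a \<Rightarrow> 'b) \<Rightarrow> 'a rel \<Rightarrow> 'a set \<Rightarrow> 'b rel \<Rightarrow> 'b set \<Rightarrow> bool" where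
  "contraction_map f E S F W \<longleftrightarrow> f ` S = W
     \<and> (\<forall>x\<in>S. \<forall>y\<in>S. (x, y) \<in> E \<longrightarrow> f x \<noteq> f y \<longrightarrow> (f x, f y) \<in> F)
     \<and> (\<forall>u\<in>W. \<forall>v\<in>W. (u, v) \<in> F \<longrightarrow> (\<exists>x\<in>S. \<exists>y\<in>S. (x, y) \<in> E \<and> f x = u \<and> f y = v))
     \<and> (\<forall>x\<in>S. \<forall>y\<in>S. f x = f y \<longrightarrow> (x, y) \<in> (rs E {z\<in>S. f z = f x})\<^sup>*)"

lemma contraction_mapD:
  assumes "contraction_map f E S F W"
  shows "f ` S = W"
    "\<And>x y. x \<in> S \<Longrightarrow> y \<in> S \<Longrightarrow> (x, y) \<in> E \<Longrightarrow> f x \<noteq> f y \<Longrightarrow> (f x, f y) \<in> F"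
    "\<And>u v. u \<in> W \<Longrightarrow> v \<in> W \<Longrightarrow> (u, v) \<in> F \<Longrightarrow> \<exists>x\<in>S. \<exists>y\<in>S. (x, y) \<in> E \<and> f x = u \<and> f y = v"
    "\<And>x y. x \<in> S \<Longrightarrow> y \<in> S \<Longrightarrow> f x = f y \<Longrightarrow> (x, y) \<in> (rs E {z\<in>S. f z = f x})\<^sup>*"
proof -
  note c = assms[unfolded contraction_map_def]
  note c1 = c[THEN conjunct1] and c2 = c[THEN conjunct2, THEN conjunct1]
    and c3 = c[THEN conjunct2, THEN conjunct2, THEN conjunct1]
    and c4 = c[THEN conjunct2, THEN conjunct2, THEN conjunct2]
  show "f ` S = W" by (rule c1)
  show "\<And>x y. x \<in> S \<Longrightarrow> y \<in> S \<Longrightarrow> (x, y) \<in> E \<Longrightarrow> f x \<noteq> f y \<Longrightarrow> (f x, f y) \<in> F"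
    by (rule c2[rule_format])
  show "\<And>u v. u \<in> W \<Longrightarrow> v \<in> W \<Longrightarrow> (u, v) \<in> F \<Longrightarrow> \<exists>x\<in>S. \<exists>y\<in>S. (x, y) \<in> E \<and> f x = u \<and> f y = v"
    by (rule c3[rule_format])
  show "\<And>x y. x \<in> S \<Longrightarrow> y \<in> S \<Longrightarrow> f x = f y \<Longrightarrow> (x, y) \<in> (rs E {z\<in>S. f z = f x})\<^sup>*"
    by (rule c4[rule_format])
qed

lemma contraction_map_id: "contraction_map (\<lambda>x. x) E S E S"
  by (auto simp: contraction_map_def)

lemma contraction_map_restrict:
  assumes "contraction_map f E S F W" "C \<subseteq> W"
  shows "contraction_map f E {z\<in>S. f z \<in> C} (rs F C) C"
  unfolding contraction_map_def
proof (intro conjI ballI impI)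
  note c = contraction_mapD[OF assms(1)]
  show "f ` {z\<in>S. f z \<in> C} = C" using c(1) assms(2) by auto
  fix x y assume xy: "x \<in> {z\<in>S. f z \<in> C}" "y \<in> {z\<in>S. f z \<in> C}"
  show "(f x, f y) \<in> rs F C" if "(x, y) \<in> E" "f x \<noteq> f y" using c(2)[of x y] xy that by auto
  show "(x, y) \<in> (rs E {z \<in> {z\<in>S. f z \<in> C}. f z = f x})\<^sup>*" if "f x = f y"
  proof -
    have "{z \<in> {z\<in>S. f z \<in> C}. f z = f x} = {z\<in>S. f z = f x}" using xy by auto
    then show ?thesis using c(4)[of x y] xy that by simp
  qed
next
  fix u v assume "u \<in> C" "v \<in> C" "(u, v) \<in> rs F C"
  then show "\<exists>x\<in>{z\<in>S. f z \<in> C}. \<exists>y\<in>{z\<in>S. f z \<in> C}. (x, y) \<in> E \<and> f x = u \<and> f y = v"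
    using contraction_mapD(3)[OF assms(1), of u v] assms(2) by auto
qed

text \<open>Each edge of \<open>F\<close> lifts to an edge of \<open>E\<close>, and consecutive
  lifts are connected inside their common fibre.\<close>

lemma contraction_map_lift_path:
  assumes c: "contraction_map f E S F W" and "C \<subseteq> W" and "(u, v) \<in> (rs F C)\<^sup>*" "u \<in> C"
    and "x \<in> S" "f x = u" "y \<in> S" "f y = v"
  shows "(x, y) \<in> (rs E {z\<in>S. f z \<in> C})\<^sup>*"
  using assms(3,7,8)
proof (induction arbitrary: y rule: rtrancl_induct)
  case base
  then have "(x, y) \<in> (rs E {z\<in>S. f z = f x})\<^sup>*" using contraction_mapD(4)[OF c] assms by auto
  then show ?case by (rule rtrancl_rs_mono) (use assms in auto)
next
  case (step v w)
  then obtain p q where pq: "p \<in> S" "q \<in> S" "(p, q) \<in> E" "f p = v" "f q = w"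
    using contraction_mapD(3)[OF c, of v w] assms(2) by blast
  have "(x, p) \<in> (rs E {z\<in>S. f z \<in> C})\<^sup>*" using step pq by blast
  moreover have "(p, q) \<in> rs E {z\<in>S. f z \<in> C}" using pq step by auto
  moreover have "(q, y) \<in> (rs E {z\<in>S. f z \<in> C})\<^sup>*"
  proof -
    have "(q, y) \<in> (rs E {z\<in>S. f z = f q})\<^sup>*" using contraction_mapD(4)[OF c pq(2), of y] pq step by simp
    then show ?thesis by (rule rtrancl_rs_mono) (use pq step in auto)
  qed
  ultimately show ?case by (rule rtrancl_trans[OF rtrancl.rtrancl_into_rtrancl])
qed

lemma contraction_map_lift_conn:
  assumes "contraction_map f E S F W" "conn_on F C" "C \<subseteq> W"
  shows "conn_on E {z\<in>S. f z \<in> C}"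
  unfolding conn_on_def
proof (intro conjI ballI)
  show "{z\<in>S. f z \<in> C} \<noteq> {}"
    using contraction_mapD(1)[OF assms(1)] conn_on_nonempty[OF assms(2)] assms(3) by blast
  fix x y assume xy: "x \<in> {z\<in>S. f z \<in> C}" "y \<in> {z\<in>S. f z \<in> C}"
  show "(x, y) \<in> (rs E {z\<in>S. f z \<in> C})\<^sup>*"
    by (rule contraction_map_lift_path[OF assms(1,3) conn_onD[OF assms(2), of "f x" "f y"]])
       (use xy in auto)
qed

lemma contraction_map_comp:
  assumes "contraction_map f E S F W" "contraction_map g F W K U"
  shows "contraction_map (\<lambda>x. g (f x)) E S K U"
  unfolding contraction_map_def
proof (intro conjI ballI impI)
  note c = contraction_mapD[OF assms(1)] and d = contraction_mapD[OF assms(2)]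
  show "(\<lambda>x. g (f x)) ` S = U" using c(1) d(1) by auto
  fix x y assume xy: "x \<in> S" "y \<in> S"
  have W: "f x \<in> W" "f y \<in> W" using xy c(1) by auto
  show "(g (f x), g (f y)) \<in> K" if "(x, y) \<in> E" "g (f x) \<noteq> g (f y)"
  proof -
    have "f x \<noteq> f y" using that by auto
    then show ?thesis using d(2)[OF W c(2)[OF xy that(1)]] that by simp
  qed
  show "(x, y) \<in> (rs E {z\<in>S. g (f z) = g (f x)})\<^sup>*" if "g (f x) = g (f y)"
  proof -
    have "(x, y) \<in> (rs E {z\<in>S. f z \<in> {w\<in>W. g w = g (f x)}})\<^sup>*"
      by (rule contraction_map_lift_path[OF assms(1) _ d(4)[OF W that]]) (use W xy in auto)
    then show ?thesis by (rule rtrancl_rs_mono) auto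
  qed
next
  note c = contraction_mapD[OF assms(1)] and d = contraction_mapD[OF assms(2)]
  fix u v assume "u \<in> U" "v \<in> U" "(u, v) \<in> K"
  then obtain p q where "p \<in> W" "q \<in> W" "(p, q) \<in> F" "g p = u" "g q = v" using d(3) by blast
  then show "\<exists>x\<in>S. \<exists>y\<in>S. (x, y) \<in> E \<and> g (f x) = u \<and> g (f y) = v" using c(3)[of p q] by auto
qed

lemma contraction_map_pcontract:
  assumes G: "pair_graph G" and B: "B \<subseteq> parcs G" "sym B"
  shows "contraction_map (contract_rep G B) (parcs G) (pverts G) (parcs (pcontract G B)) (pverts (pcontract G B))"
    (is "contraction_map ?r _ _ _ _")
  unfolding contraction_map_def
proof (intro conjI ballI impI)
  note g = pair_graphD[OF G]
  have BV: "B \<subseteq> pverts G \<times> pverts G" using B g by blast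
  note rep = contract_rep(3)[OF BV B(2)]
  show "?r ` pverts G = pverts (pcontract G B)" by (simp add: pcontract_def)
  fix x y assume xy: "x \<in> pverts G" "y \<in> pverts G"
  show "(?r x, ?r y) \<in> parcs (pcontract G B)" if "(x, y) \<in> parcs G" "?r x \<noteq> ?r y"
    using that by (auto simp: pcontract_def)
  show "(x, y) \<in> (rs (parcs G) {z \<in> pverts G. ?r z = ?r x})\<^sup>*" if "?r x = ?r y"
  proof -
    have "(x, y) \<in> B\<^sup>*" using rep xy that by blast
    then have "y \<in> pverts G \<and> (x, y) \<in> (rs (parcs G) {z \<in> pverts G. ?r z = ?r x})\<^sup>*"
    proof (induction rule: rtrancl_induct)
      case (step y z)
      have z: "z \<in> pverts G" using step BV by auto
      have "?r x = ?r y" "?r x = ?r z"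
        using rep[of x y] rep[of x z] step z xy rtrancl.rtrancl_into_rtrancl[OF step(1,2)] by blast+
      then have "(y, z) \<in> rs (parcs G) {z \<in> pverts G. ?r z = ?r x}" using step z B by auto
      then show ?case using step(3) z rtrancl.rtrancl_into_rtrancl[of x y _ z] by blast
    qed (use xy in simp)
    then show ?thesis by simp
  qed
next
  fix u v assume "(u, v) \<in> parcs (pcontract G B)"
  then obtain x y where "(x, y) \<in> parcs G" "u = ?r x" "v = ?r y" by (auto simp: pcontract_def)
  then show "\<exists>x\<in>pverts G. \<exists>y\<in>pverts G. (x, y) \<in> parcs G \<and> ?r x = u \<and> ?r y = v"
    using pair_graphD(2)[OF G] by blast
qed

lemma contraction_map_bridges:
  assumes "pair_graph G"
  shows "contraction_map (contract_rep G (bridges G)) (parcs G) (pverts G)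
    (parcs (contract_bridges G)) (pverts (contract_bridges G))"
  unfolding contract_bridges_def
  by (rule contraction_map_pcontract[OF assms _ sym_bridges[OF assms]]) (simp add: bridges_def split_beta Collect_mono_iff subset_iff)

text \<open>Contracting bridges of a simple graph creates no parallel edges: two edges over the same
  edge of the contraction would close a cycle through bridges.\<close>

lemma unique_edge_lift:
  assumes c: "contraction_map f E S F W" and "sym E"
    and br: "\<And>x y. x \<in> S \<Longrightarrow> y \<in> S \<Longrightarrow> (x, y) \<in> E \<Longrightarrow> f x = f y \<Longrightarrow> bridge_in (rs E S) x y"
    and e: "(x, y) \<in> rs E S" "(x', y') \<in> rs E S" "f x = f x'" "f y = f y'" "f x \<noteq> f y"
  shows "x = x'"
proof -
  let ?A = "{z\<in>S. f z = f x}"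
  let ?N = "rs E S - rs E ?A - (rs E ?A)\<inverse>"
  have "(x, x') \<in> (rs E ?A)\<^sup>*"
    using contraction_mapD(4)[OF c, of x x'] e by auto
  moreover have "(x, x') \<in> ?N\<^sup>*"
  proof -
    have 1: "(x, y) \<in> ?N" and 2: "(y', x') \<in> ?N" using e \<open>sym E\<close> by (auto dest: symD)
    have 3: "(y, y') \<in> ?N\<^sup>*"
    proof -
      have "(y, y') \<in> (rs E {z\<in>S. f z = f y})\<^sup>*" using contraction_mapD(4)[OF c, of y y'] e by auto
      then show ?thesis by (rule subsetD[OF rtrancl_mono, rotated]) (use e(5) in auto)
    qed
    show ?thesis
      by (rule rtrancl.rtrancl_into_rtrancl[OF converse_rtrancl_into_rtrancl[OF 1 3] 2])
  qed
  moreover have "bridge_in (rs E S) u v" if "(u, v) \<in> rs E ?A" for u v using that br by auto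
  ultimately show ?thesis
    by (intro bridges_forest[of "rs E S" "rs E ?A"]) (use sym_rs[OF \<open>sym E\<close>] in auto)
qed

text \<open>A way around \<open>(x, y)\<close> maps to a walk in \<open>F\<close>. By
  \<open>unique_edge_lift\<close> no other edge lies over \<open>(f x, f y)\<close>, so this walk
  would go around a bridge of \<open>F\<close>.\<close>

lemma bridge_lift:
  assumes c: "contraction_map f E S F W" and "sym E" "sym F" "F \<subseteq> W \<times> W"
    and br: "\<And>x y. x \<in> S \<Longrightarrow> y \<in> S \<Longrightarrow> (x, y) \<in> E \<Longrightarrow> f x = f y \<Longrightarrow> bridge_in (rs E S) x y"
    and xy: "(x, y) \<in> rs E S" "f x \<noteq> f y" and uv: "bridge_in F (f x) (f y)"
  shows "bridge_in (rs E S) x y"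
  unfolding bridge_in_def
proof
  define D where "D = rs E S - {(x, y), (y, x)}"
  define u v where "u = f x" and "v = f y"
  define F' where "F' = F - {(u, v), (v, u)}"
  have symE: "sym (rs E S)" using \<open>sym E\<close> by (rule sym_rs)
  have lift: "a = a'" if "(a, b) \<in> rs E S" "(a', b') \<in> rs E S" "f a = f a'" "f b = f b'" "f a \<noteq> f b"
    for a b a' b'
    by (rule unique_edge_lift[OF c \<open>sym E\<close> _ that]) (rule br)
  assume "(x, y) \<in> (rs E S - {(x, y), (y, x)})\<^sup>*"
  then have "(x, y) \<in> D\<^sup>*" by (simp add: D_def)
  then have "(f x, f y) \<in> F'\<^sup>*"
  proof (induction rule: rtrancl_induct)
    case (step p q)
    have pqD: "(p, q) \<in> rs E S" "(p, q) \<noteq> (x, y)" "(p, q) \<noteq> (y, x)" using step(2) by (auto simp: D_def)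
    show ?case
    proof (cases "f p = f q")
      case False
      have "(f p, f q) \<in> F" using contraction_mapD(2)[OF c, of p q] pqD False by auto
      moreover have "(f p, f q) \<noteq> (u, v)"
      proof
        assume "(f p, f q) = (u, v)"
        then have *: "f p = f x" "f q = f y" by (simp_all add: u_def v_def)
        have pq: "(p, q) \<in> rs E S" using pqD by simp
        have yx: "(y, x) \<in> rs E S" and qp: "(q, p) \<in> rs E S" using xy pq symE by (auto dest: symD)
        have "x = p" by (rule lift[OF xy(1) pq]) (use * xy in auto)
        moreover have "y = q" by (rule lift[OF yx qp]) (use * xy in auto)
        ultimately show False using pqD by simp
      qed
      moreover have "(f p, f q) \<noteq> (v, u)"
      proof
        assume "(f p, f q) = (v, u)"
        then have *: "f p = f y" "f q = f x" by (simp_all add: u_def v_def)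
        have qp: "(q, p) \<in> rs E S" using pqD \<open>sym E\<close> by (auto dest: symD)
        have yx: "(y, x) \<in> rs E S" and pq: "(p, q) \<in> rs E S" using xy qp symE by (auto dest: symD)
        have "x = q" by (rule lift[OF xy(1) qp]) (use * xy in auto)
        moreover have "y = p" by (rule lift[OF yx pq]) (use * xy in auto)
        ultimately show False using pqD by simp
      qed
      ultimately have "(f p, f q) \<in> F'" by (simp add: F'_def)
      with step(3) show ?thesis by (rule rtrancl.rtrancl_into_rtrancl)
    next
      case True
      show ?thesis using step(3) unfolding True .
    qed
  qed simp
  then show False using uv by (simp add: bridge_in_def F'_def u_def v_def)
qed

text \<open>A non-bridge whose ends are joined by bridges would close a cycle through bridges. So
  every edge inside a fibre of the bridge contraction is a bridge.\<close>

lemma fibre_edge_bridge: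
  assumes H: "pair_graph H" and B: "(u, v) \<in> parcs H" "(u, v) \<in> (bridges H)\<^sup>*"
  shows "bridge_in (parcs H) u v"
proof (rule ccontr)
  note h = pair_graphD[OF H]
  assume nb: "\<not> bridge_in (parcs H) u v"
  then have "(u, v) \<notin> bridges H" "(v, u) \<notin> bridges H"
    using bridge_in_sym[OF h(3), of u v] by (auto simp: bridges_iff[OF H])
  then have "(u, v) \<in> (parcs H - bridges H - (bridges H)\<inverse>)\<^sup>*" using B by auto
  then have "u = v"
    by (intro bridges_forest[OF h(3) _ _ B(2)]) (auto simp: bridges_iff[OF H])
  then show False using B h(4) by simp
qed

text \<open>Independence numbers add up over classes without edges between them, so a loss is
  already a loss in a single class and needs no larger witness.\<close>

lemma blocked_by_partition:
  assumes "finite S" "sym E" "\<And>i. hereditarily_blocked_by E b {x\<in>S. g x = i}"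
    "\<And>x y. x \<in> S \<Longrightarrow> y \<in> S \<Longrightarrow> (x, y) \<in> E \<Longrightarrow> g x = g y"
  shows "blocked_by E b S"
  using assms(1,3,4)
proof (induction "card S" arbitrary: S rule: less_induct)
  case less
  show ?case
    unfolding blocked_by_def
  proof (intro allI impI)
    fix Y assume Y: "alpha E (S - Y) < alpha E S"
    then have "S \<noteq> {}" by auto
    then obtain x where x: "x \<in> S" by auto
    define A where "A = {z\<in>S. g z = g x}"
    define C where "C = S - A"
    have fin: "finite A" "finite C" using less.prems(1) by (auto simp: A_def C_def)
    have split: "alpha E (S - Z) = alpha E (A - Z) + alpha E (C - Z)" for Z
    proof -
      have "S - Z = (A - Z) \<union> (C - Z)" by (auto simp: A_def C_def)
      moreover have "E \<inter> (A - Z) \<times> (C - Z) = {}" using less.prems(3) by (fastforce simp: A_def C_def)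
      ultimately show ?thesis
        using fin \<open>sym E\<close> by (auto intro!: alpha_Un_disjoint simp: C_def)
    qed
    have bA: "blocked_by E b A"
      using less.prems(2)[of "g x"] by (simp add: A_def hereditarily_blocked_by_def)
    have "card C < card S" using x less.prems(1) by (intro psubset_card_mono) (auto simp: C_def A_def)
    then have bC: "blocked_by E b C"
    proof (rule less.hyps[OF _ fin(2)])
      fix i
      have "{x\<in>C. g x = i} \<subseteq> {x\<in>S. g x = i}" by (auto simp: C_def)
      then show "hereditarily_blocked_by E b {x\<in>C. g x = i}"
        using less.prems(2)[of i] unfolding hereditarily_blocked_by_def by (meson subset_trans)
    qed (use less.prems(3) in \<open>auto simp: C_def\<close>)
    have le: "alpha E (A - Z) \<le> alpha E (A - {})" "alpha E (C - Z) \<le> alpha E (C - {})" for Z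
      using fin by (auto intro!: alpha_mono)
    have "alpha E (A - Y) < alpha E A \<or> alpha E (C - Y) < alpha E C"
      using Y split[of Y] split[of "{}"] unfolding Diff_empty by linarith
    then show "lowers_within b Y (\<lambda>Z. alpha E (S - Z))"
    proof
      assume "alpha E (A - Y) < alpha E A"
      then have "lowers_within b Y (\<lambda>Z. alpha E (A - Z))" using bA by (simp add: blocked_by_def)
      then show ?thesis
        by (rule lowers_within_mono) (use split le in \<open>metis add_less_le_mono\<close>)
    next
      assume "alpha E (C - Y) < alpha E C"
      then have "lowers_within b Y (\<lambda>Z. alpha E (C - Z))" using bC by (simp add: blocked_by_def)
      then show ?thesis
        by (rule lowers_within_mono) (use split le in \<open>metis add_le_less_mono\<close>)
    qed
  qed
qed

lemma hereditarily_blocked_by_mono: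
  assumes "hereditarily_blocked_by E b S" "b \<le> b'"
  shows "hereditarily_blocked_by E b' S"
  using assms unfolding hereditarily_blocked_by_def blocked_by_def by (meson lowers_within_le)

lemma hereditarily_blocked_partition:
  assumes "finite S" "sym E" "\<And>i. hereditarily_blocked_by E b {x\<in>S. g x = i}"
    "\<And>x y. x \<in> S \<Longrightarrow> y \<in> S \<Longrightarrow> (x, y) \<in> E \<Longrightarrow> g x = g y"
  shows "hereditarily_blocked_by E b S"
  unfolding hereditarily_blocked_by_def
proof (intro allI impI)
  fix A assume A: "A \<subseteq> S"
  show "blocked_by E b A"
  proof (rule blocked_by_partition[where g = g])
    fix i
    have "{x\<in>A. g x = i} \<subseteq> {x\<in>S. g x = i}" using A by auto
    then show "hereditarily_blocked_by E b {x\<in>A. g x = i}"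
      using assms(3)[of i] unfolding hereditarily_blocked_by_def by (meson subset_trans)
    show "finite A" using A assms(1) finite_subset by blast
    show "g x = g y" if "x \<in> A" "y \<in> A" "(x, y) \<in> E" for x y
      using assms(4)[of x y] A that by blast
  qed (rule assms(2))
qed

lemma bridge_depth_component:
  assumes "pair_graph G" "\<not> connected (with_proj G)" "x \<in> pverts G"
  shows "bridge_depth (pinduce G (comp_of (parcs G) (pverts G) x)) \<le> bridge_depth G"
proof -
  have "bridge_depth G = Max ((\<lambda>C. bridge_depth (pinduce G C)) ` comp_of (parcs G) (pverts G) ` pverts G)"
    using assms by (subst bridge_depth.simps) (auto simp: sccs_verts_pair_graph)
  then show ?thesis using assms pair_graphD(1)[OF assms(1)] by auto
qed

lemma bridge_depth_connected:
  assumes "pair_graph G" "connected (with_proj G)" "pverts G \<noteq> {}"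
  shows "bridge_depth G = Suc (Min ((\<lambda>v. bridge_depth (pdel_verts (contract_bridges G) {v}))
                   ` pverts (contract_bridges G)))"
  using assms by (subst bridge_depth.simps) auto

lemma pair_graph_contract_bridges: "pair_graph G \<Longrightarrow> pair_graph (contract_bridges G)"
  by (simp add: contract_bridges_def pair_graph_pcontract)

lemma card_contract_bridges_del:
  assumes "pair_graph H" "v \<in> pverts (contract_bridges H)"
  shows "card (pverts (pdel_verts (contract_bridges H) {v})) < card (pverts H)"
proof -
  have "pverts (contract_bridges H) - {v} \<subset> pverts H"
    using assms pverts_pcontract_subset[of H "bridges H"] by (auto simp: contract_bridges_def)
  then show ?thesis using pair_graphD(1)[OF assms(1)] by (auto intro!: psubset_card_mono)
qed

text \<open>The induction follows the recursion for \<open>H\<close>, while \<open>S\<close> is the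
  part of the original graph lying over \<open>H\<close>. The invariant is that edges inside fibres
  are bridges of \<open>S\<close>; so a vertex of \<open>contract_bridges H\<close> has a tree of
  bridges as its preimage, and deleting it doubles the bound.\<close>

lemma hereditarily_blocked_bridge_depth:
  fixes f :: "'a \<Rightarrow> 'b"
  assumes "pair_graph H" "finite S" "sym E" "\<And>v. (v, v) \<notin> E"
    and "contraction_map f E S (parcs H) (pverts H)"
    and "\<And>x y. x \<in> S \<Longrightarrow> y \<in> S \<Longrightarrow> (x, y) \<in> E \<Longrightarrow> f x = f y \<Longrightarrow> bridge_in (rs E S) x y"
  shows "hereditarily_blocked_by E (2 ^ bridge_depth H) S"
  using assms(1,2,5,6)
proof (induction "card (pverts H)" arbitrary: H S f rule: less_induct)
  case less
  note H = less.prems(1) and fin = less.prems(2) and c = less.prems(3) and br = less.prems(4)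
  note h = pair_graphD[OF H] and cd = contraction_mapD[OF c]
  have sub: "hereditarily_blocked_by E (2 ^ bridge_depth K) A"
    if "pair_graph K" "card (pverts K) < card (pverts H)" "A \<subseteq> S"
      "contraction_map k E A (parcs K) (pverts K)"
      "\<And>x y. x \<in> A \<Longrightarrow> y \<in> A \<Longrightarrow> (x, y) \<in> E \<Longrightarrow> k x = k y \<Longrightarrow> bridge_in (rs E S) x y"
    for K :: "'b pair_pre_digraph" and A and k :: "'a \<Rightarrow> 'b"
  proof (rule less.hyps)
    show "card (pverts K) < card (pverts H)" "pair_graph K" "contraction_map k E A (parcs K) (pverts K)"
      by (rule that)+
    show "finite A" using \<open>A \<subseteq> S\<close> fin finite_subset by blast
    show "bridge_in (rs E A) x y" if "x \<in> A" "y \<in> A" "(x, y) \<in> E" "k x = k y" for x y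
      using \<open>A \<subseteq> S\<close> \<open>\<And>x y. x \<in> A \<Longrightarrow> y \<in> A \<Longrightarrow> (x, y) \<in> E \<Longrightarrow> k x = k y \<Longrightarrow> bridge_in (rs E S) x y\<close> that
      by (auto intro: bridge_in_mono)
  qed
  consider "pverts H = {}" | "pverts H \<noteq> {}" "\<not> connected (with_proj H)"
    | "pverts H \<noteq> {}" "connected (with_proj H)" by blast
  then show ?case
  proof cases
    case 1
    then have "S = {}" using cd(1) by auto
    then show ?thesis by (simp add: hereditarily_blocked_by_def blocked_by_def)
  next
    case 2
    let ?C = "\<lambda>x. comp_of (parcs H) (pverts H) x"
    have Csub: "?C u \<subseteq> pverts H" if "u \<in> pverts H" for u using comp_of_subset[OF that] .
    have cc: "hereditarily_blocked_by E (2 ^ bridge_depth H) {x\<in>S. f x \<in> ?C u}" if u: "u \<in> pverts H" for u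
    proof (rule hereditarily_blocked_by_mono)
      show "(2::nat) ^ bridge_depth (pinduce H (?C u)) \<le> 2 ^ bridge_depth H"
        using bridge_depth_component[OF H 2(2) u] by (intro power_increasing) auto
      have "?C u \<in> pre_digraph.sccs_verts (with_proj H)" using u by (simp add: sccs_verts_pair_graph[OF H])
      then have "?C u \<subset> pverts H" using sccs_verts_psubset[OF H _ 2(2)] by blast
      then have less': "card (pverts (pinduce H (?C u))) < card (pverts H)"
        using h(1) by (auto intro!: psubset_card_mono)
      have cm: "contraction_map f E {x\<in>S. f x \<in> ?C u} (parcs (pinduce H (?C u))) (pverts (pinduce H (?C u)))"
        using contraction_map_restrict[OF c Csub[OF u]] by simp
      show "hereditarily_blocked_by E (2 ^ bridge_depth (pinduce H (?C u))) {x\<in>S. f x \<in> ?C u}"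
        by (rule sub[OF pair_graph_pinduce[OF H Csub[OF u]] less' _ cm]) (use br in auto)
    qed
    have fS: "f x \<in> pverts H" if "x \<in> S" for x using cd(1) that by auto
    show ?thesis
    proof (rule hereditarily_blocked_partition[OF fin \<open>sym E\<close>, where g = "\<lambda>x. ?C (f x)"])
      fix i
      show "hereditarily_blocked_by E (2 ^ bridge_depth H) {x\<in>S. ?C (f x) = i}"
      proof (cases "{x\<in>S. ?C (f x) = i} = {}")
        case True
        show ?thesis unfolding True by (simp add: hereditarily_blocked_by_def blocked_by_def)
      next
        case False
        then obtain x where x: "x \<in> S" "?C (f x) = i" by auto
        have "{x\<in>S. ?C (f x) = i} \<subseteq> {z\<in>S. f z \<in> ?C (f x)}"
        proof clarify
          fix z assume "z \<in> S" "i = ?C (f z)"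
          then show "f z \<in> ?C (f x)" using x(2) comp_of_self[of "f z"] by simp
        qed
        then show ?thesis using cc[OF fS[OF x(1)]] unfolding hereditarily_blocked_by_def
          by (meson subset_trans)
      qed
    next
      fix x y assume xy: "x \<in> S" "y \<in> S" "(x, y) \<in> E"
      show "?C (f x) = ?C (f y)"
      proof (cases "f x = f y")
        case False
        then have "(f x, f y) \<in> parcs H" using cd(2) xy by blast
        then have "f y \<in> ?C (f x)"
          using comp_of_closed[OF comp_of_self fS[OF xy(1)] fS[OF xy(2)]] by blast
        then show ?thesis by (rule comp_of_eq[OF h(3), symmetric])
      qed simp
    qed
  next
    case 3
    let ?K = "contract_bridges H" and ?r = "contract_rep H (bridges H)"
    let ?g = "\<lambda>x. ?r (f x)"
    have cg: "contraction_map ?g E S (parcs ?K) (pverts ?K)"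
      by (rule contraction_map_comp[OF c contraction_map_bridges[OF H]])
    have K: "pair_graph ?K" using H by (rule pair_graph_contract_bridges)
    have Kne: "pverts ?K \<noteq> {}" using 3 by (simp add: contract_bridges_def pcontract_def)
    define m where "m v = bridge_depth (pdel_verts ?K {v})" for v
    have "Min (m ` pverts ?K) \<in> m ` pverts ?K"
      using Kne pair_graphD(1)[OF K] by (intro Min_in) auto
    then obtain v where v: "v \<in> pverts ?K" "m v = Min (m ` pverts ?K)" by auto
    have bd: "bridge_depth H = Suc (m v)"
      using bridge_depth_connected[OF H 3(2,1)] v(2) by (simp add: m_def)
    have brg: "bridge_in (rs E S) x y" if xy: "x \<in> S" "y \<in> S" "(x, y) \<in> E" "?g x = ?g y" for x y
    proof (cases "f x = f y")
      case False
      \<comment> \<open>An edge between two fibres of \<open>f\<close> that the next contraction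
        merges: its image is a bridge of \<open>H\<close>, and that bridge lifts.\<close>
      have F: "(f x, f y) \<in> parcs H" using cd(2) xy False by blast
      have fxy: "f x \<in> pverts H" "f y \<in> pverts H" using cd(1) xy by auto
      have "bridges H \<subseteq> pverts H \<times> pverts H" using h(2) by (auto simp: bridges_def)
      then have "(f x, f y) \<in> (bridges H)\<^sup>*"
        using contract_rep(3)[OF _ sym_bridges[OF H] fxy] xy(4) by blast
      then have "bridge_in (parcs H) (f x) (f y)" by (rule fibre_edge_bridge[OF H F])
      then show ?thesis
        by (intro bridge_lift[OF c \<open>sym E\<close> h(3,2) _ _ False]) (rule br, use xy in auto)
    qed (use br xy in blast)
    define T where "T = {x\<in>S. ?g x = v}"
    have ST: "{z\<in>S. ?g z \<in> pverts ?K - {v}} = S - T"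
      using contraction_mapD(1)[OF cg] by (auto simp: T_def)
    have cm: "contraction_map ?g E (S - T) (parcs (pdel_verts ?K {v})) (pverts (pdel_verts ?K {v}))"
      using contraction_map_restrict[OF cg, of "pverts ?K - {v}"] unfolding ST
      by (simp add: pdel_verts_def)
    have hb: "hereditarily_blocked_by E (2 ^ m v) (S - T)"
      unfolding m_def
      by (rule sub[OF pair_graph_pdel_verts[OF K] card_contract_bridges_del[OF H v(1)] _ cm])
         (use brg in auto)
    have "hereditarily_blocked_by E (2 * 2 ^ m v) S"
    proof (rule hereditarily_blocked_tree[OF fin _ assms(3,4) _ _ _ hb])
      show "T \<subseteq> S" "(1::nat) \<le> 2 ^ m v" by (auto simp: T_def)
      show "bridge_in (rs E S) x y" if "x \<in> T" "y \<in> T" "(x, y) \<in> E" for x y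
        using brg[of x y] that by (simp add: T_def)
      fix x y assume xy: "x \<in> T" "y \<in> T" and *: "(x, y) \<in> (rs E S - T \<times> T)\<^sup>*"
      have "{z\<in>S. ?g z = ?g x} = T" using xy by (auto simp: T_def)
      then have B: "(x, y) \<in> (rs E T)\<^sup>*"
        using contraction_mapD(4)[OF cg, of x y] xy by (simp add: T_def)
      have eq: "rs E S - rs E T - (rs E T)\<inverse> = rs E S - T \<times> T"
        using \<open>sym E\<close> by (auto dest: symD)
      show "x = y"
        by (rule bridges_forest[OF sym_rs[OF \<open>sym E\<close>] _ _ B *[folded eq]]) (use brg in \<open>auto simp: T_def\<close>)
    qed
    then show ?thesis by (simp add: bd)
  qed
qed

lemma independence_number_eq: "independence_number G = alpha (parcs G) (pverts G)"
  by (simp add: independence_number_def alpha_def independent_set_def independent_in_def)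

lemma alpha_cong:
  assumes "rs E S = rs F S"
  shows "alpha E S = alpha F S"
proof -
  have "I \<subseteq> S \<Longrightarrow> independent_in E I \<longleftrightarrow> independent_in F I" for I using assms unfolding independent_in_def by blast
  then show ?thesis unfolding alpha_def by (metis (no_types, lifting))
qed

lemma independence_number_pdel_verts: "independence_number (pdel_verts G Y) = alpha (parcs G) (pverts G - Y)"
  unfolding independence_number_eq by (simp add: pdel_verts_def) (rule alpha_cong, auto)

lemma blocking_set_alpha:
  "blocking_set G Y \<longleftrightarrow> Y \<subseteq> pverts G \<and> alpha (parcs G) (pverts G - Y) < alpha (parcs G) (pverts G)"
  unfolding blocking_set_def independence_number_pdel_verts unfolding independence_number_eq ..

theorem minimal_blocking_set_bridge_depth:
  assumes G: "pair_graph G" and Y: "minimal_blocking_set G Y"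
  shows "card Y \<le> 2 ^ bridge_depth G"
proof -
  note g = pair_graphD[OF G]
  have "hereditarily_blocked_by (parcs G) (2 ^ bridge_depth G) (pverts G)"
  proof (rule hereditarily_blocked_bridge_depth[where f = "\<lambda>x. x" and H = G])
    show "contraction_map (\<lambda>x. x) (parcs G) (pverts G) (parcs G) (pverts G)"
      by (rule contraction_map_id)
    \<comment> \<open>Under the identity every fibre is a single vertex, so an edge inside one would
      be a loop.\<close>
    show "bridge_in (rs (parcs G) (pverts G)) x y" if "(x, y) \<in> parcs G" "x = y" for x y
      using that g(4)[of x] by simp
  qed (rule G g(1) g(3) g(4))+
  then have "blocked_by (parcs G) (2 ^ bridge_depth G) (pverts G)"
    by (simp add: hereditarily_blocked_by_def)
  moreover have b: "alpha (parcs G) (pverts G - Y) < alpha (parcs G) (pverts G)" "Y \<subseteq> pverts G"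
    using Y[unfolded minimal_blocking_set_def, THEN conjunct1]
    by (simp_all add: blocking_set_alpha)
  ultimately have "lowers_within (2 ^ bridge_depth G) Y (\<lambda>Z. alpha (parcs G) (pverts G - Z))"
    by (simp add: blocked_by_def)
  then obtain Z where Z: "Z \<subseteq> Y" "card Z \<le> 2 ^ bridge_depth G"
    "alpha (parcs G) (pverts G - Z) < alpha (parcs G) (pverts G - {})" by (rule lowers_withinE)
  then have "blocking_set G Z" using b by (auto simp: blocking_set_alpha)
  then have "Z = Y" using Y Z(1) unfolding minimal_blocking_set_def by blast
  then show ?thesis using Z by simp
qed

section \<open>Disjoint connectors\<close>

text \<open>The separator side of Menger's theorem: fewer than \<open>k\<close> vertices never
  separate \<open>A\<close> from \<open>B\<close>. A common vertex of \<open>A\<close> and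
  \<open>B\<close> is connected to itself, so the two sets may overlap.\<close>

definition linked :: "'a rel \<Rightarrow> 'a set \<Rightarrow> 'a set \<Rightarrow> nat \<Rightarrow> bool" where
  "linked E A B k \<longleftrightarrow>
     (\<forall>Z. finite Z \<longrightarrow> card Z < k \<longrightarrow> (\<exists>a\<in>A - Z. \<exists>b\<in>B - Z. (a, b) \<in> (rs E (- Z))\<^sup>*))"

lemma linkedD:
  assumes "linked E A B k" "finite Z" "card Z < k"
  obtains a b where "a \<in> A - Z" "b \<in> B - Z" "(a, b) \<in> (rs E (- Z))\<^sup>*"
  using assms unfolding linked_def by blast

lemma linked_sym: "sym E \<Longrightarrow> linked E A B k \<Longrightarrow> linked E B A k"
  unfolding linked_def using rtrancl_sym[OF sym_rs, of E] by metis

text \<open>Connected sets stand in for Menger's paths: they can be glued by unions, without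
  arranging their vertices in order.\<close>

definition disjoint_connectors :: "'a rel \<Rightarrow> 'a set \<Rightarrow> 'a set \<Rightarrow> 'a set set \<Rightarrow> bool" where
  "disjoint_connectors E A B \<L> \<longleftrightarrow>
     (\<forall>L\<in>\<L>. conn_on E L \<and> L \<inter> A \<noteq> {} \<and> L \<inter> B \<noteq> {})
     \<and> (\<forall>L\<in>\<L>. \<forall>M\<in>\<L>. L \<noteq> M \<longrightarrow> L \<inter> M = {})"

text \<open>With as many disjoint connectors as \<open>X\<close> has vertices, one vertex of
  \<open>X\<close> picked from each exhausts \<open>X\<close>; hence the vertices of
  \<open>X\<close> can name the connectors.\<close>

lemma connectors_indexed:
  assumes "disjoint_connectors E A X \<C>" "finite X" "card \<C> = card X" "finite \<C>"
  obtains c where "\<And>s. s \<in> X \<Longrightarrow> s \<in> c s \<and> conn_on E (c s) \<and> c s \<inter> A \<noteq> {}"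
    "\<And>s t. s \<in> X \<Longrightarrow> t \<in> X \<Longrightarrow> s \<noteq> t \<Longrightarrow> c s \<inter> c t = {}"
proof -
  note d = assms(1)[unfolded disjoint_connectors_def]
  define f where "f C = (SOME s. s \<in> C \<inter> X)" for C
  have f: "f C \<in> C \<inter> X" if "C \<in> \<C>" for C
  proof -
    have "\<exists>s. s \<in> C \<inter> X" using d that by blast
    then show ?thesis unfolding f_def by (rule someI_ex)
  qed
  have inj: "inj_on f \<C>"
  proof (rule inj_onI)
    fix C D assume "C \<in> \<C>" "D \<in> \<C>" "f C = f D"
    then show "C = D" using f[of C] f[of D] d by (metis IntD1 disjoint_iff)
  qed
  have "f ` \<C> = X"
    by (rule card_subset_eq[OF assms(2)]) (use f inj assms in \<open>auto simp: card_image\<close>)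
  then have ex: "\<exists>C\<in>\<C>. f C = s" if "s \<in> X" for s using that by auto
  define c where "c s = (SOME C. C \<in> \<C> \<and> f C = s)" for s
  have c: "c s \<in> \<C> \<and> f (c s) = s" if "s \<in> X" for s
  proof -
    have "\<exists>C. C \<in> \<C> \<and> f C = s" using ex[OF that] by blast
    then show ?thesis unfolding c_def by (rule someI_ex)
  qed
  show thesis
  proof (rule that)
    show "s \<in> c s \<and> conn_on E (c s) \<and> c s \<inter> A \<noteq> {}" if "s \<in> X" for s
      using c[OF that] f[of "c s"] d by auto
    show "c s \<inter> c t = {}" if "s \<in> X" "t \<in> X" "s \<noteq> t" for s t
    proof -
      have "c s \<noteq> c t" using c[OF that(1)] c[OF that(2)] that(3) by auto
      then show ?thesis using c[OF that(1)] c[OF that(2)] d by blast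
    qed
  qed
qed

lemma conn_on_mono:
  assumes "conn_on E S" "E \<subseteq> F"
  shows "conn_on F S"
proof -
  have "(rs E S)\<^sup>* \<subseteq> (rs F S)\<^sup>*" using assms(2) by (intro rtrancl_mono) auto
  then show ?thesis using assms(1) unfolding conn_on_def by blast
qed

lemma disjoint_connectors_mono:
  assumes "disjoint_connectors E A B \<L>" "E \<subseteq> F"
  shows "disjoint_connectors F A B \<L>"
proof -
  have "conn_on F L" if "L \<in> \<L>" for L
    using assms that conn_on_mono[of E L F] unfolding disjoint_connectors_def by simp
  then show ?thesis using assms(1) unfolding disjoint_connectors_def by simp
qed

text \<open>Induction on the number of edges: if deleting the edge \<open>x y\<close> destroys the linkage, then a
  separator \<open>X\<close> of size \<open>k - 1\<close> arises, and the induction hypothesis applies on both of its sides.\<close>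

theorem menger_connectors:
  assumes "finite E" "sym E" "linked E A B k"
  obtains \<L> where "disjoint_connectors E A B \<L>" "card \<L> = k" "finite \<L>"
proof -
  have "\<exists>\<L>. disjoint_connectors E A B \<L> \<and> card \<L> = k \<and> finite \<L>"
    using assms
  proof (induction "card E" arbitrary: E A B rule: less_induct)
    case less
    note fin = less.prems(1) and symE = less.prems(2) and lk = less.prems(3)
    show ?case
    proof (cases "E = {}")
      case True
      \<comment> \<open>Without edges, single vertices of \<open>A \<inter> B\<close> are the
        connectors; fewer than \<open>k\<close> of them would form a separator.\<close>
      have "\<exists>T. T \<subseteq> A \<inter> B \<and> card T = k \<and> finite T"
      proof (cases "finite (A \<inter> B) \<and> card (A \<inter> B) < k")
        case True
        then obtain a b where ab: "a \<in> A - A \<inter> B" "b \<in> B - A \<inter> B" "(a, b) \<in> (rs E (- (A \<inter> B)))\<^sup>*"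
          using linkedD[OF lk] by blast
        then have "a = b" using \<open>E = {}\<close> by simp
        then show ?thesis using ab by auto
      next
        case False
        then show ?thesis
          using infinite_arbitrarily_large[of "A \<inter> B" k] obtain_subset_with_card_n[of k "A \<inter> B"]
          by (metis not_less)
      qed
      then obtain T where "T \<subseteq> A \<inter> B" "card T = k" "finite T" by blast
      then show ?thesis
        by (intro exI[of _ "(\<lambda>x. {x}) ` T"]) (auto simp: disjoint_connectors_def card_image)
    next
      case False
      then obtain x0 y0 where e0: "(x0, y0) \<in> E" by auto
      define E' where "E' = E - {(x0, y0), (y0, x0)}"
      have symE': "sym E'" unfolding E'_def by (rule sym_diff_edge[OF symE])
      have less': "card E'' < card E" if "E'' \<subseteq> E'" for E''
        using that e0 fin by (intro psubset_card_mono) (auto simp: E'_def)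
      have sub: "E' \<subseteq> E" by (auto simp: E'_def)
      show ?thesis
      proof (cases "linked E' A B k")
        case True
        then obtain \<L> where "disjoint_connectors E' A B \<L>" "card \<L> = k" "finite \<L>"
          using less.hyps[OF less'[OF subset_refl] finite_subset[OF sub fin] symE'] by blast
        then show ?thesis using disjoint_connectors_mono[OF _ sub] by blast
      next
        case False
        then obtain X where X: "finite X" "card X < k"
          and sep: "\<And>a b. a \<in> A - X \<Longrightarrow> b \<in> B - X \<Longrightarrow> (a, b) \<notin> (rs E' (- X))\<^sup>*"
          unfolding linked_def by blast
        \<comment> \<open>The vertices reached from a set outside \<open>X\<close> once the edge is
          deleted. In \<open>E\<close>, only the deleted edge can lead out of such a set to a vertex
          outside \<open>X\<close>.\<close>
        define R where "R A = {z. \<exists>a\<in>A - X. (a, z) \<in> (rs E' (- X))\<^sup>*}" for A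
        have RX: "z \<notin> X" if "z \<in> R C" for z C
          using that rtrancl_rs_closed[of _ z E' "- X"] by (auto simp: R_def)
        have Rself: "a \<in> R C" if "a \<in> C - X" for a C using that by (auto simp: R_def)
        have Rstep: "q \<in> R C" if p: "p \<in> R C" "(p, q) \<in> E'" "q \<notin> X" for p q C
        proof -
          obtain a where a: "a \<in> C - X" "(a, p) \<in> (rs E' (- X))\<^sup>*" using p(1) by (auto simp: R_def)
          have "(p, q) \<in> rs E' (- X)" using p RX[OF p(1)] by auto
          then have "(a, q) \<in> (rs E' (- X))\<^sup>*" using a(2) by (rule rtrancl.rtrancl_into_rtrancl[rotated])
          then show ?thesis using a(1) by (auto simp: R_def)
        qed
        have RR: "R A \<inter> R B = {}"
        proof (rule ccontr)
          assume "R A \<inter> R B \<noteq> {}"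
          then obtain z a b where "a \<in> A - X" "b \<in> B - X" "(a, z) \<in> (rs E' (- X))\<^sup>*"
            "(b, z) \<in> (rs E' (- X))\<^sup>*" by (auto simp: R_def)
          then have "(a, b) \<in> (rs E' (- X))\<^sup>*"
            using rtrancl_trans[OF _ rtrancl_sym[OF sym_rs[OF symE']]] by blast
          then show False using sep \<open>a \<in> A - X\<close> \<open>b \<in> B - X\<close> by blast
        qed
        have leave: "\<exists>p q. p \<in> R C \<and> q \<notin> R C \<and> {p, q} = {x0, y0}"
          if ab: "a \<in> C - X" "(a, b) \<in> (rs E (- X))\<^sup>*" "b \<notin> R C" for a b C
        proof -
          obtain p q where pq: "(p, q) \<in> rs E (- X)" "p \<in> R C" "q \<notin> R C"
            using rtrancl_cross[OF ab(2) Rself[OF ab(1)] ab(3)] by blast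
          then have "(p, q) \<notin> E'" using Rstep by auto
          then show ?thesis using pq by (auto simp: E'_def)
        qed
        obtain a b where ab: "a \<in> A - X" "b \<in> B - X" "(a, b) \<in> (rs E (- X))\<^sup>*"
          using linkedD[OF lk X] .
        have "b \<notin> R A" "a \<notin> R B" using Rself ab RR by blast+
        moreover have "(b, a) \<in> (rs E (- X))\<^sup>*" using rtrancl_sym[OF sym_rs[OF symE] ab(3)] .
        ultimately obtain x y x' y' where xy: "x \<in> R A" "y \<notin> R A" "{x, y} = {x0, y0}"
          and xy': "y' \<in> R B" "x' \<notin> R B" "{y', x'} = {x0, y0}"
          using leave[OF ab(1,3)] leave[OF ab(2)] by metis
        have yB: "y \<in> R B" using xy xy' RR by (metis disjoint_iff doubleton_eq_iff)
        have E': "E - E' \<subseteq> {(x, y), (y, x)}" "(x, y) \<in> E"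
          using xy(3) e0 symE by (auto simp: E'_def doubleton_eq_iff dest: symD)
        \<comment> \<open>Adding \<open>x\<close> disables the deleted edge too, so
          \<open>insert x X\<close> separates in \<open>E\<close> and has at least \<open>k\<close>
          vertices.\<close>
        have cX: "card X = k - 1"
        proof (rule ccontr)
          assume "card X \<noteq> k - 1"
          then have "finite (insert x X)" "card (insert x X) < k"
            using X card_insert_le_m1[of k X x] by (auto simp: card_insert_if)
          then obtain a b where ab: "a \<in> A - insert x X" "b \<in> B - insert x X"
            "(a, b) \<in> (rs E (- insert x X))\<^sup>*" using linkedD[OF lk] by metis
          have "rs E (- insert x X) \<subseteq> rs E' (- X)" using E'(1) by auto
          then have "(a, b) \<in> (rs E' (- X))\<^sup>*" using ab(3) rtrancl_mono by blast
          then show False using sep ab by auto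
        qed
        \<comment> \<open>Fewer than \<open>k\<close> vertices separating \<open>A\<close> from
          \<open>insert x X\<close> on the side of \<open>A\<close> would separate \<open>A\<close>
          from \<open>B\<close>. The statement is general because it is used again with the two
          sides exchanged.\<close>
        have side: "linked (rs E' (R A \<union> X)) A (insert x X) k"
          if lk: "linked E A B k" and RR: "R A \<inter> R B = {}" and x: "x \<in> R A" and y: "y \<in> R B"
            and E': "E - E' \<subseteq> {(x, y), (y, x)}" for A B x y
          unfolding linked_def
        proof (intro allI impI)
          fix Z :: "'a set" assume "finite Z" "card Z < k"
          then obtain a b where ab: "a \<in> A - Z" "b \<in> B - Z" "(a, b) \<in> (rs E (- Z))\<^sup>*"
            using linkedD[OF lk] by blast
          let ?E = "rs (rs E' (R A \<union> X)) (- Z)"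
          have "\<exists>s\<in>insert x X - Z. (a, s) \<in> ?E\<^sup>*"
          proof (rule ccontr)
            assume no: "\<not> ?thesis"
            define Q where "Q = {z. (a, z) \<in> ?E\<^sup>*}"
            have aX: "a \<notin> X" using no ab(1) by blast
            have QZ: "z \<notin> Z" if "z \<in> Q" for z
              using that ab(1) rtrancl_rs_closed[of a z _ "- Z"] by (auto simp: Q_def)
            have QS: "z \<in> R A \<union> X" if "z \<in> Q" for z
            proof -
              have "(a, z) \<in> ?E\<^sup>*" using that by (simp add: Q_def)
              then show ?thesis
                by (induction rule: rtrancl_induct) (use Rself[of a A] ab aX in auto)
            qed
            have QX: "z \<notin> insert x X" if "z \<in> Q" for z
              using no QZ[OF that] that by (auto simp: Q_def)
            have QR: "z \<in> R A" "z \<noteq> x" if "z \<in> Q" for z using QX[OF that] QS[OF that] by auto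
            have "b \<notin> Q" using QR(1)[of b] QX[of b] Rself[of b B] ab(2) RR by blast
            moreover have "a \<in> Q" by (simp add: Q_def)
            ultimately obtain p q where pq: "(p, q) \<in> rs E (- Z)" "p \<in> Q" "q \<notin> Q"
              using rtrancl_cross[OF ab(3)] by blast
            have "p \<noteq> y" using QR(1)[OF pq(2)] y RR by blast
            then have E'pq: "(p, q) \<in> E'" using pq(1) E' QR(2)[OF pq(2)] by blast
            have "q \<in> R A \<union> X" using Rstep[OF QR(1)[OF pq(2)] E'pq] by blast
            then have "(p, q) \<in> ?E" using pq(1) E'pq QR(1)[OF pq(2)] by auto
            moreover have "(a, p) \<in> ?E\<^sup>*" using pq(2) by (simp add: Q_def)
            ultimately have "q \<in> Q" unfolding Q_def by (simp add: rtrancl.rtrancl_into_rtrancl)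
            then show False using pq(3) by blast
          qed
          then show "\<exists>a\<in>A - Z. \<exists>b\<in>insert x X - Z. (a, b) \<in> ?E\<^sup>*" using ab(1) by blast
        qed
        have conn: "\<exists>c. (\<forall>s\<in>insert x X. s \<in> c s \<and> conn_on E (c s) \<and> c s \<inter> A \<noteq> {} \<and> c s \<subseteq> R A \<union> X)
            \<and> (\<forall>s\<in>insert x X. \<forall>t\<in>insert x X. s \<noteq> t \<longrightarrow> c s \<inter> c t = {})"
          if lk: "linked (rs E' (R A \<union> X)) A (insert x X) k" and x: "x \<in> R A" for A x
        proof -
          let ?E = "rs E' (R A \<union> X)"
          have "?E \<subseteq> E'" by auto
          then have "finite ?E" "card ?E < card E" using less' finite_subset[OF _ finite_subset[OF sub fin]] by auto
          then obtain \<C> where \<C>: "disjoint_connectors ?E A (insert x X) \<C>" "card \<C> = k" "finite \<C>"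
            using less.hyps[OF _ _ sym_rs[OF symE'] lk] by blast
          have "card (insert x X) = k" using RX[OF x] X cX by simp
          with \<C> X obtain c where c: "\<And>s. s \<in> insert x X \<Longrightarrow> s \<in> c s \<and> conn_on ?E (c s) \<and> c s \<inter> A \<noteq> {}"
            "\<And>s t. s \<in> insert x X \<Longrightarrow> t \<in> insert x X \<Longrightarrow> s \<noteq> t \<Longrightarrow> c s \<inter> c t = {}"
            using connectors_indexed[OF \<C>(1)] by (metis finite_insert)
          have cR: "c s \<subseteq> R A \<union> X" if s: "s \<in> insert x X" for s
          proof
            fix z assume "z \<in> c s"
            then have "(s, z) \<in> (rs ?E (c s))\<^sup>*" using c(1)[OF s] conn_onD by metis
            then show "z \<in> R A \<union> X" by (induction rule: rtrancl_induct) (use s x in auto)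
          qed
          have cE: "conn_on E (c s)" if "s \<in> insert x X" for s
            using c(1)[OF that] conn_on_mono[of ?E "c s" E] sub by auto
          show ?thesis
          proof (intro exI[of _ c] conjI ballI impI)
            fix s assume s: "s \<in> insert x X"
            show "s \<in> c s" "c s \<inter> A \<noteq> {}" using c(1)[OF s] by simp_all
            show "conn_on E (c s)" "c s \<subseteq> R A \<union> X" using cE[OF s] cR[OF s] .
            show "c s \<inter> c t = {}" if "t \<in> insert x X" "s \<noteq> t" for t using c(2)[OF s that] .
          qed
        qed
        obtain c where "(\<forall>s\<in>insert x X. s \<in> c s \<and> conn_on E (c s) \<and> c s \<inter> A \<noteq> {} \<and> c s \<subseteq> R A \<union> X)
            \<and> (\<forall>s\<in>insert x X. \<forall>t\<in>insert x X. s \<noteq> t \<longrightarrow> c s \<inter> c t = {})"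
          using conn[OF side[OF lk RR xy(1) yB E'(1)] xy(1)] ..
        note c = this[THEN conjunct1, THEN bspec] and cc = this[THEN conjunct2, rule_format]
        have RR': "R B \<inter> R A = {}" and E'': "E - E' \<subseteq> {(y, x), (x, y)}" using RR E' by auto
        obtain d where "(\<forall>s\<in>insert y X. s \<in> d s \<and> conn_on E (d s) \<and> d s \<inter> B \<noteq> {} \<and> d s \<subseteq> R B \<union> X)
            \<and> (\<forall>s\<in>insert y X. \<forall>t\<in>insert y X. s \<noteq> t \<longrightarrow> d s \<inter> d t = {})"
          using conn[OF side[OF linked_sym[OF symE lk] RR' yB xy(1) E''] yB] ..
        note d = this[THEN conjunct1, THEN bspec] and dd = this[THEN conjunct2, rule_format]
        have xX: "x \<notin> X" "y \<notin> X" using RX xy(1) yB by auto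
        \<comment> \<open>Connectors from both sides are glued at their common vertex of
          \<open>X\<close>, except that the one at \<open>x\<close> and the one at \<open>y\<close>
          are glued along the deleted edge.\<close>
        define p where "p s = (if s = x then y else s)" for s
        have p: "p s \<in> insert y X" if "s \<in> insert x X" for s using that by (auto simp: p_def)
        have pinj: "p s \<noteq> p t" if "s \<in> insert x X" "t \<in> insert x X" "s \<noteq> t" for s t
          using that xX by (auto simp: p_def)
        \<comment> \<open>The two sides share only \<open>X\<close>, and a connector contains no
          vertex of \<open>X\<close> other than its own index.\<close>
        have cd: "c s \<inter> d (p t) = {}" if st: "s \<in> insert x X" "t \<in> insert x X" "s \<noteq> t" for s t
        proof (rule ccontr)
          assume "c s \<inter> d (p t) \<noteq> {}"
          then obtain z where z: "z \<in> c s" "z \<in> d (p t)" by auto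
          then have "z \<in> X" using c[OF st(1)] d[OF p[OF st(2)]] RR by blast
          then have "z = s" using cc[of z s] c[of z] z(1) st(1) by blast
          moreover have "z = p t" using dd[of z "p t"] d[of z] z(2) p[OF st(2)] \<open>z \<in> X\<close> by blast
          ultimately show False using st xX \<open>z \<in> X\<close> by (auto simp: p_def split: if_splits)
        qed
        define g where "g s = c s \<union> d (p s)" for s
        have gconn: "conn_on E (g s)" if s: "s \<in> insert x X" for s
        proof (cases "s = x")
          case True
          then show ?thesis
            using conn_on_Un_edge[OF symE _ _ E'(2), of "c x" "d y"] c[of x] d[of y] by (simp add: g_def p_def)
        next
          case False
          then show ?thesis
            using conn_on_Un[OF symE, of "c s" "d s"] c[of s] d[of s] s by (auto simp: g_def p_def)
        qed
        have gdisj: "g s \<inter> g t = {}" if st: "s \<in> insert x X" "t \<in> insert x X" "s \<noteq> t" for s t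
          using cc[OF st] dd[OF p[OF st(1)] p[OF st(2)] pinj[OF st]] cd[OF st] cd[OF st(2,1)] st(3)
          unfolding g_def by blast
        have inj: "inj_on g (insert x X)"
        proof (rule inj_onI)
          fix s t assume st: "s \<in> insert x X" "t \<in> insert x X" "g s = g t"
          have "s \<in> g s" using c[OF st(1)] by (simp add: g_def)
          then show "s = t" using gdisj[OF st(1,2)] st(3) by blast
        qed
        have "disjoint_connectors E A B (g ` insert x X)"
          unfolding disjoint_connectors_def
        proof (intro conjI ballI impI)
          fix L assume "L \<in> g ` insert x X"
          then obtain s where s: "s \<in> insert x X" "L = g s" by blast
          show "conn_on E L" using gconn s by simp
          show "L \<inter> A \<noteq> {}" using c[OF s(1)] s(2) by (auto simp: g_def)
          show "L \<inter> B \<noteq> {}" using d[OF p[OF s(1)]] s(2) by (auto simp: g_def)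
        next
          fix L M assume "L \<in> g ` insert x X" "M \<in> g ` insert x X" "L \<noteq> M"
          then show "L \<inter> M = {}" using gdisj by blast
        qed
        moreover have "card (g ` insert x X) = k"
          using card_image[OF inj] xX X cX by simp
        ultimately show ?thesis using X by (intro exI[of _ "g ` insert x X"]) simp
      qed
    qed
  qed
  then show thesis using that by blast
qed

section \<open>Necklaces\<close>

text \<open>Pairwise intersecting connected sets that avoid \<open>v\<close> all lie in one
  component of \<open>D - {v}\<close>. The path steps from \<open>v\<close> into this component and
  continues there, with only those members still to be met.\<close>

lemma path_through_intersecting_family:
  assumes "finite D" "sym E" "conn_on E D" "v \<in> D"
    and "\<And>N. N \<in> \<N> \<Longrightarrow> conn_on E N \<and> N \<subseteq> D" "\<And>N M. N \<in> \<N> \<Longrightarrow> M \<in> \<N> \<Longrightarrow> N \<inter> M \<noteq> {}"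
  shows "\<exists>xs. xs \<noteq> [] \<and> hd xs = v \<and> distinct xs \<and> set xs \<subseteq> D \<and> successively (\<lambda>x y. (x, y) \<in> E) xs
    \<and> (\<forall>N\<in>\<N>. N \<inter> set xs \<noteq> {})"
  using assms(1,3-)
proof (induction "card D" arbitrary: D v \<N> rule: less_induct)
  case less
  note fin = less.prems(1) and conD = less.prems(2) and v = less.prems(3)
    and N = less.prems(4) and int = less.prems(5)
  show ?case
  proof (cases "\<forall>N\<in>\<N>. v \<in> N")
    case True
    then show ?thesis using v by (intro exI[of _ "[v]"]) auto
  next
    case False
    then obtain N0 where N0: "N0 \<in> \<N>" "v \<notin> N0" by auto
    then obtain r where r: "r \<in> N0" using N[OF N0(1)] conn_on_nonempty by blast
    have rD: "r \<in> D - {v}" using r N0 N by blast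
    let ?C = "comp_of E (D - {v}) r" and ?N = "{N\<in>\<N>. v \<notin> N}"
    have C: "?C \<subseteq> D - {v}" by (rule comp_of_subset[OF rD])
    obtain w where w: "w \<in> ?C" "(v, w) \<in> E"
      using conn_on_del_vertex_adj[OF \<open>sym E\<close> conD v, of r] rD by auto
    have sub: "M \<subseteq> ?C" if M: "M \<in> ?N" for M
    proof (rule comp_of_maximal[OF _ _ rD])
      have "N0 \<subseteq> ?C"
        by (rule comp_of_maximal[OF _ _ rD]) (use N[OF N0(1)] N0 r comp_of_self in auto)
      then show "M \<inter> ?C \<noteq> {}" using int[OF N0(1), of M] M by blast
      show "conn_on E M" "M \<subseteq> D - {v}" using N[of M] M by auto
    qed
    have fC: "finite ?C" by (rule finite_subset[OF C]) (use fin in simp)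
    have cC: "card ?C < card D" using C v fin by (intro psubset_card_mono) auto
    have "\<exists>xs. xs \<noteq> [] \<and> hd xs = w \<and> distinct xs \<and> set xs \<subseteq> ?C \<and> successively (\<lambda>x y. (x, y) \<in> E) xs
        \<and> (\<forall>N\<in>?N. N \<inter> set xs \<noteq> {})"
    proof (rule less.hyps[OF cC fC comp_of_conn[OF \<open>sym E\<close> rD] w(1)])
      show "conn_on E M \<and> M \<subseteq> ?C" if "M \<in> ?N" for M using sub[OF that] N[of M] that by auto
      show "M \<inter> M' \<noteq> {}" if "M \<in> ?N" "M' \<in> ?N" for M M' using int that by auto
    qed
    then obtain xs where xs: "xs \<noteq> []" "hd xs = w" "distinct xs" "set xs \<subseteq> ?C"
      "successively (\<lambda>x y. (x, y) \<in> E) xs" "\<forall>N\<in>?N. N \<inter> set xs \<noteq> {}" by blast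
    have "v \<notin> set xs" "set xs \<subseteq> D" using xs(4) C by auto
    then show ?thesis using xs v w(2)
      by (intro exI[of _ "v # xs"]) (auto simp: successively_Cons)
  qed
qed

text \<open>A walk from \<open>A\<close> to \<open>B\<close> inside \<open>L\<close> is collected
  vertex by vertex, starting afresh on each return to \<open>A\<close> and stopping at the first
  vertex of \<open>B\<close>.\<close>

lemma thin_connector:
  assumes "sym E" "conn_on E L" "L \<inter> A \<noteq> {}" "L \<inter> B \<noteq> {}" "A \<inter> B = {}"
  obtains M a b where "M \<subseteq> L" "conn_on E M" "M \<inter> A = {a}" "M \<inter> B = {b}"
proof -
  obtain a y where ay: "a \<in> L" "a \<in> A" "y \<in> L" "y \<in> B" using assms by auto
  have "(a, y) \<in> (rs E L)\<^sup>*" using conn_onD[OF assms(2) ay(1,3)] .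
  then have "\<exists>M\<subseteq>L. conn_on E M \<and> (\<exists>a'. M \<inter> A = {a'}) \<and> ((\<exists>b'. M \<inter> B = {b'}) \<or> M \<inter> B = {} \<and> y \<in> M)"
  proof (induction rule: rtrancl_induct)
    case base
    show ?case using ay assms(5) by (intro exI[of _ "{a}"]) auto
  next
    case (step y z)
    then obtain M where M: "M \<subseteq> L" "conn_on E M" "\<exists>a'. M \<inter> A = {a'}"
      "(\<exists>b'. M \<inter> B = {b'}) \<or> M \<inter> B = {} \<and> y \<in> M" by blast
    show ?case
    proof (cases "\<exists>b'. M \<inter> B = {b'}")
      case True then show ?thesis using M by blast
    next
      case False
      then have MB: "M \<inter> B = {}" "y \<in> M" using M by auto
      show ?thesis
      proof (cases "z \<in> A")
        case True
        then show ?thesis using step(2) assms(5) by (intro exI[of _ "{z}"]) auto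
      next
        case zA: False
        have "conn_on E (M \<union> {z})"
          by (rule conn_on_Un_edge[OF assms(1) M(2) conn_on_singleton _ MB(2)]) (use step(2) in auto)
        moreover have "(M \<union> {z}) \<inter> A = M \<inter> A" using zA by auto
        moreover have "(M \<union> {z}) \<inter> B = {z} \<or> (M \<union> {z}) \<inter> B = {}" using MB by auto
        ultimately show ?thesis using M step(2) by (intro exI[of _ "M \<union> {z}"]) auto
      qed
    qed
  qed
  then obtain M where M: "M \<subseteq> L" "conn_on E M" "\<exists>a'. M \<inter> A = {a'}"
      "(\<exists>b'. M \<inter> B = {b'}) \<or> M \<inter> B = {} \<and> y \<in> M" by blast
  then have "\<exists>b'. M \<inter> B = {b'}" using ay by auto
  then show thesis using M that by blast
qed

text \<open>The two edges may share an end; \<open>triangle_of_double_edge\<close> then splits the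
  bag that contains their other ends.\<close>

definition doubly_adjacent :: "'a rel \<Rightarrow> 'a set \<Rightarrow> 'a set \<Rightarrow> bool" where
  "doubly_adjacent E A B \<longleftrightarrow> (\<exists>e\<in>E \<inter> A \<times> B. \<exists>e'\<in>E \<inter> A \<times> B. e \<noteq> e')"

text \<open>Further edges between bags are allowed, since all that is extracted in the end is a
  minor.\<close>

definition necklace :: "'a rel \<Rightarrow> 'a set \<Rightarrow> nat \<Rightarrow> (nat \<Rightarrow> 'a set) \<Rightarrow> bool" where
  "necklace E S n B \<longleftrightarrow> (\<forall>i<n. conn_on E (B i) \<and> B i \<subseteq> S)
     \<and> (\<forall>i<n. \<forall>j<n. i \<noteq> j \<longrightarrow> B i \<inter> B j = {})
     \<and> (\<forall>i. Suc i < n \<longrightarrow> doubly_adjacent E (B i) (B (Suc i)))"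

lemma necklaceD:
  assumes "necklace E S n B"
  shows "i < n \<Longrightarrow> conn_on E (B i)" "i < n \<Longrightarrow> B i \<subseteq> S"
    "i < n \<Longrightarrow> j < n \<Longrightarrow> i \<noteq> j \<Longrightarrow> B i \<inter> B j = {}"
    "Suc i < n \<Longrightarrow> doubly_adjacent E (B i) (B (Suc i))"
  using assms unfolding necklace_def by simp_all

lemma conn_on_segment:
  assumes "sym E" "a < b" "\<And>l. a \<le> l \<Longrightarrow> Suc l < b \<Longrightarrow> (u l, u (Suc l)) \<in> E"
  shows "conn_on E (u ` {a..<b})"
  using assms(2,3)
proof (induction b)
  case (Suc b)
  show ?case
  proof (cases "a = b")
    case False
    then have "a < b" using Suc.prems(1) by simp
    then have e: "(u (b - 1), u b) \<in> E" using Suc.prems(2)[of "b - 1"] by (cases b) auto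
    have "conn_on E (u ` {a..<b})" using Suc.IH[OF \<open>a < b\<close>] Suc.prems(2) by simp
    then have "conn_on E (u ` {a..<b} \<union> {u b})"
      by (rule conn_on_Un_edge[OF assms(1) _ conn_on_singleton e]) (use \<open>a < b\<close> in auto)
    moreover have "u ` {a..<b} \<union> {u b} = u ` {a..<Suc b}" using Suc.prems(1) by (auto simp: less_Suc_eq)
    ultimately show ?thesis by simp
  qed simp
qed simp

text \<open>Two disjoint paths serve as rails and the sets \<open>M i\<close> as rungs, which both
  rails meet in the same order. Bag \<open>i\<close> is rung \<open>i\<close> with the stretch of
  each rail up to the next rung, so each rail supplies one edge to the next bag.\<close>

lemma necklace_of_ladder:
  assumes "sym E"
    and u: "inj_on u {..<n}" "\<And>l. Suc l < n \<Longrightarrow> (u l, u (Suc l)) \<in> E" "u ` {..<n} \<subseteq> S"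
    and v: "inj_on v {..<n'}" "\<And>l. Suc l < n' \<Longrightarrow> (v l, v (Suc l)) \<in> E" "v ` {..<n'} \<subseteq> S"
    and uv: "u ` {..<n} \<inter> v ` {..<n'} = {}"
    and r: "\<And>i j. i < j \<Longrightarrow> j < m \<Longrightarrow> r i < r j" "\<And>i. i < m \<Longrightarrow> r i < n"
    and s: "\<And>i j. i < j \<Longrightarrow> j < m \<Longrightarrow> s i < s j" "\<And>i. i < m \<Longrightarrow> s i < n'"
    and M: "\<And>i. i < m \<Longrightarrow> conn_on E (M i) \<and> M i \<subseteq> S \<and> M i \<inter> u ` {..<n} = {u (r i)} \<and> M i \<inter> v ` {..<n'} = {v (s i)}"
    and MM: "\<And>i j. i < m \<Longrightarrow> j < m \<Longrightarrow> i \<noteq> j \<Longrightarrow> M i \<inter> M j = {}"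
  shows "\<exists>B. necklace E S m B"
proof -
  \<comment> \<open>The last stretch consists of the attachment vertex alone.\<close>
  define hi where "hi t i = (if Suc i < m then t (Suc i) else Suc (t i))" for t :: "nat \<Rightarrow> nat" and i
  define seg where "seg w t i = w ` {t i..<hi t i}" for w :: "nat \<Rightarrow> 'a" and t i
  define ok where "ok w t N i \<longleftrightarrow> conn_on E (seg w t i) \<and> seg w t i \<subseteq> S \<and> w (t i) \<in> seg w t i \<and> seg w t i \<subseteq> w ` {..<N}
      \<and> (\<forall>j<m. i \<noteq> j \<longrightarrow> seg w t i \<inter> seg w t j = {} \<and> w (t j) \<notin> seg w t i)
      \<and> (Suc i < m \<longrightarrow> (\<exists>x\<in>seg w t i. (x, w (t (Suc i))) \<in> E))"
    for w :: "nat \<Rightarrow> 'a" and t N i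
  have seg: "ok w t N i"
    if w: "inj_on w {..<N}" "\<And>l. Suc l < N \<Longrightarrow> (w l, w (Suc l)) \<in> E" "w ` {..<N} \<subseteq> S"
      and t: "\<And>i j. i < j \<Longrightarrow> j < m \<Longrightarrow> t i < t j" "\<And>i. i < m \<Longrightarrow> t i < N" and i: "i < m"
    for w :: "nat \<Rightarrow> 'a" and t N i
  proof -
    have lo: "t i < hi t i" if "i < m" for i using t(1)[of i "Suc i"] by (simp add: hi_def)
    have hiN: "hi t i \<le> N" if "i < m" for i using t(2)[of "Suc i"] t(2)[of i] that by (auto simp: hi_def)
    have hi_le: "hi t i \<le> t j" if "i < j" "j < m" for i j
      using t(1)[of "Suc i" j] that by (cases "Suc i = j") (auto simp: hi_def)
    have sub: "{t i..<hi t i} \<subseteq> {..<N}" if "i < m" for i using hiN[OF that] by auto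
    have disj: "{t i..<hi t i} \<inter> {t j..<hi t j} = {}" if "i < m" "j < m" "i \<noteq> j" for i j
    proof (cases "i < j")
      case True then show ?thesis using hi_le[OF True that(2)] by auto
    next
      case False
      then have "j < i" using that(3) by simp
      then show ?thesis using hi_le[OF _ that(1)] by fastforce
    qed
    have "conn_on E (seg w t i)"
      unfolding seg_def by (rule conn_on_segment[OF \<open>sym E\<close> lo[OF i]]) (use w(2) hiN[OF i] in auto)
    moreover have "seg w t i \<subseteq> w ` {..<N}" unfolding seg_def using sub[OF i] by auto
    moreover have ti: "w (t i) \<in> seg w t i" if "i < m" for i unfolding seg_def using lo[OF that] by auto
    moreover have d: "seg w t i \<inter> seg w t j = {}" if j: "j < m" "i \<noteq> j" for j
      unfolding seg_def inj_on_image_Int[OF w(1) sub[OF i] sub[OF j(1)], symmetric] disj[OF i j(1,2)]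
      by (rule image_empty)
    moreover have "w (t j) \<notin> seg w t i" if "j < m" "i \<noteq> j" for j
      using d[OF that] ti[OF that(1)] by auto
    moreover have "\<exists>x\<in>seg w t i. (x, w (t (Suc i))) \<in> E" if si: "Suc i < m"
    proof -
      have "hi t i = t (Suc i)" using si by (simp add: hi_def)
      then have "w (t (Suc i) - 1) \<in> seg w t i" "Suc (t (Suc i) - 1) = t (Suc i)"
        using lo[OF i] unfolding seg_def by auto
      moreover have "(w (t (Suc i) - 1), w (Suc (t (Suc i) - 1))) \<in> E"
        using w(2)[of "t (Suc i) - 1"] t(2)[OF si] calculation(2) by simp
      ultimately show ?thesis by auto
    qed
    ultimately show ?thesis unfolding ok_def using w(3) i by blast
  qed
  have okD: "conn_on E (seg w t i)" "seg w t i \<subseteq> S" "w (t i) \<in> seg w t i" "seg w t i \<subseteq> w ` {..<N}"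
    "\<And>j. j < m \<Longrightarrow> i \<noteq> j \<Longrightarrow> seg w t i \<inter> seg w t j = {}" "\<And>j. j < m \<Longrightarrow> i \<noteq> j \<Longrightarrow> w (t j) \<notin> seg w t i"
    "Suc i < m \<Longrightarrow> \<exists>x\<in>seg w t i. (x, w (t (Suc i))) \<in> E"
    if "ok w t N i" for w :: "nat \<Rightarrow> 'a" and t N i
    using that unfolding ok_def by simp_all
  have "ok u r n i" if "i < m" for i
    by (rule seg) (fact u(1), erule u(2), fact u(3), erule (1) r(1), erule r(2), fact that)
  note segu = okD[OF this]
  have "ok v s n' i" if "i < m" for i
    by (rule seg) (fact v(1), erule v(2), fact v(3), erule (1) s(1), erule s(2), fact that)
  note segv = okD[OF this]
  \<comment> \<open>Rung \<open>j\<close> touches each rail only at its own attachment, which lies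
    in stretch \<open>j\<close>.\<close>
  have mu: "seg u r i \<inter> M j = {}" and mv: "seg v s i \<inter> M j = {}" if ij: "i < m" "j < m" "i \<noteq> j" for i j
  proof -
    have "seg u r i \<inter> M j \<subseteq> {u (r j)}" "seg v s i \<inter> M j \<subseteq> {v (s j)}"
      using segu(4)[OF ij(1)] segv(4)[OF ij(1)] M[OF ij(2)] by auto
    then show "seg u r i \<inter> M j = {}" "seg v s i \<inter> M j = {}"
      using segu(6)[OF ij] segv(6)[OF ij] by auto
  qed
  have suv: "seg u r i \<inter> seg v s j = {}" if "i < m" "j < m" for i j
    using segu(4)[OF that(1)] segv(4)[OF that(2)] uv by blast
  define B where "B i = seg u r i \<union> M i \<union> seg v s i" for i
  have disj: "B i \<inter> B j = {}" if ij: "i < m" "j < m" "i \<noteq> j" for i j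
    using segu(5)[OF ij] segv(5)[OF ij] mu[OF ij] mv[OF ij] mu[OF ij(2,1)] mv[OF ij(2,1)] ij(3)
      suv[OF ij(1,2)] suv[OF ij(2,1)] MM[OF ij]
    by (simp add: B_def Int_Un_distrib Int_Un_distrib2 Int_commute)
  have conn: "conn_on E (B i) \<and> B i \<subseteq> S" if i: "i < m" for i
  proof -
    have "u (r i) \<in> M i" "v (s i) \<in> M i" using M[OF i] by auto
    then have ne: "seg u r i \<inter> M i \<noteq> {}" "(seg u r i \<union> M i) \<inter> seg v s i \<noteq> {}"
      using segu(3)[OF i] segv(3)[OF i] by auto
    have c: "conn_on E (M i)" "M i \<subseteq> S" using M[OF i] by auto
    have "conn_on E (B i)"
      unfolding B_def
      by (rule conn_on_Un[OF \<open>sym E\<close> conn_on_Un[OF \<open>sym E\<close> segu(1)[OF i] c(1) ne(1)] segv(1)[OF i] ne(2)])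
    then show ?thesis unfolding B_def using segu(2)[OF i] segv(2)[OF i] c(2) by simp
  qed
  have dbl: "doubly_adjacent E (B i) (B (Suc i))" if i: "Suc i < m" for i
  proof -
    have i': "i < m" using i by simp
    obtain x where x: "x \<in> seg u r i" "(x, u (r (Suc i))) \<in> E" using segu(7)[OF i' i] by blast
    obtain y where y: "y \<in> seg v s i" "(y, v (s (Suc i))) \<in> E" using segv(7)[OF i' i] by blast
    have "u (r (Suc i)) \<in> B (Suc i)" "v (s (Suc i)) \<in> B (Suc i)"
      using segu(3)[OF i] segv(3)[OF i] unfolding B_def by auto
    moreover have "x \<in> B i" "y \<in> B i" using x y unfolding B_def by auto
    moreover have "x \<noteq> y" using x y suv[OF i' i'] by auto
    ultimately show ?thesis unfolding doubly_adjacent_def using x(2) y(2) by blast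
  qed
  have "necklace E S m B"
    unfolding necklace_def using conn disj dbl by blast
  then show ?thesis by blast
qed

text \<open>Erdos-Szekeres by way of Ramsey's theorem: pairs are coloured by whether
  \<open>q\<close> preserves their order.\<close>

lemma monotone_restriction:
  "\<exists>k\<ge>1. \<forall>I (q :: nat \<Rightarrow> nat). finite I \<and> card I \<ge> k \<and> inj_on q I \<longrightarrow>
     (\<exists>R\<subseteq>I. card R = m \<and> ((\<forall>x\<in>R. \<forall>y\<in>R. x < y \<longrightarrow> q x < q y) \<or> (\<forall>x\<in>R. \<forall>y\<in>R. x < y \<longrightarrow> q y < q x)))"
proof -
  obtain k where k: "k \<ge> 1" "\<And>(V::nat set) (E::nat set set). finite V \<and> card V \<ge> k \<Longrightarrow>
    (\<exists>R \<subseteq> V. card R = m \<and> clique R E \<or> card R = m \<and> Ramsey.indep R E)"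
    using ramsey2[of m m] by blast
  have "\<exists>R\<subseteq>I. card R = m \<and> ((\<forall>x\<in>R. \<forall>y\<in>R. x < y \<longrightarrow> q x < q y) \<or> (\<forall>x\<in>R. \<forall>y\<in>R. x < y \<longrightarrow> q y < q x))"
    if I: "finite I" "card I \<ge> k" "inj_on q I" for I and q :: "nat \<Rightarrow> nat"
  proof -
    define E where "E = {{x, y} | x y. x < y \<and> q x < q y}"
    have E: "{x, y} \<in> E \<longleftrightarrow> q x < q y" if "x < y" for x y
      using that by (auto simp: E_def doubleton_eq_iff)
    obtain R where R: "R \<subseteq> I" "card R = m" "clique R E \<or> Ramsey.indep R E"
      using k(2)[of I E] I by blast
    from R(3) show ?thesis
    proof
      assume "clique R E"
      then have "q x < q y" if "x \<in> R" "y \<in> R" "x < y" for x y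
        using E[OF that(3)] that by (auto simp: clique_def)
      then show ?thesis using R by blast
    next
      assume "Ramsey.indep R E"
      then have *: "\<not> q x < q y" if "x \<in> R" "y \<in> R" "x < y" for x y
        using E[OF that(3)] that by (auto simp: Ramsey.indep_def)
      have "q y < q x" if "x \<in> R" "y \<in> R" "x < y" for x y
      proof -
        have "q x \<noteq> q y" using inj_onD[OF I(3), of x y] R(1) that by auto
        then show ?thesis using *[OF that] by simp
      qed
      then show ?thesis using R by blast
    qed
  qed
  then show ?thesis using k(1) by blast
qed

text \<open>The path is cut behind the shortest prefix for which the members meeting it cannot be
  hit by fewer than \<open>k\<close> vertices. For every smaller \<open>Z\<close>, some member
  meeting the prefix and some member meeting the rest both avoid \<open>Z\<close>; as they
  intersect, they connect the two parts.\<close>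

lemma subfamily_linkage:
  assumes "sym E" "k \<ge> 1"
    and N: "\<And>N. N \<in> \<N> \<Longrightarrow> conn_on E N" "\<And>N M. N \<in> \<N> \<Longrightarrow> M \<in> \<N> \<Longrightarrow> N \<inter> M \<noteq> {}"
    and xs: "\<And>N. N \<in> \<N> \<Longrightarrow> N \<inter> set xs \<noteq> {}"
    and unhit: "\<And>Z. finite Z \<Longrightarrow> card Z < 2 * k \<Longrightarrow> \<exists>N\<in>\<N>. N \<inter> Z = {}"
  shows "\<exists>j. linked E (set (take j xs)) (set (drop j xs)) k"
proof -
  define hit where "hit j \<longleftrightarrow> (\<exists>Z. finite Z \<and> card Z < k \<and> (\<forall>N\<in>\<N>. N \<inter> set (take j xs) \<noteq> {} \<longrightarrow> N \<inter> Z \<noteq> {}))" for j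
  have "\<not> hit (length xs)" unfolding hit_def using unhit xs by fastforce
  define j where "j = (LEAST j. \<not> hit j)"
  have j: "\<not> hit j" unfolding j_def by (rule LeastI) fact
  have "hit 0" unfolding hit_def using \<open>k \<ge> 1\<close> by (intro exI[of _ "{}"]) auto
  then have "j \<noteq> 0" using j by metis
  then obtain i where i: "j = Suc i" by (cases j) auto
  have "hit i" using not_less_Least[of i "\<lambda>j. \<not> hit j"] i unfolding j_def by auto
  then obtain Z1 where *: "finite Z1 \<and> card Z1 < k \<and> (\<forall>N\<in>\<N>. N \<inter> set (take i xs) \<noteq> {} \<longrightarrow> N \<inter> Z1 \<noteq> {})"
    unfolding hit_def ..
  then have Z1: "finite Z1" "card Z1 < k"
    "\<And>N. N \<in> \<N> \<Longrightarrow> N \<inter> set (take i xs) \<noteq> {} \<Longrightarrow> N \<inter> Z1 \<noteq> {}" by simp_all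
  show ?thesis
  proof (rule exI[of _ j], unfold linked_def, intro allI impI)
    fix Z :: "'a set" assume Z: "finite Z" "card Z < k"
    then have "\<not> (\<forall>N\<in>\<N>. N \<inter> set (take j xs) \<noteq> {} \<longrightarrow> N \<inter> Z \<noteq> {})"
      using j unfolding hit_def by simp
    then obtain N1 where N1: "N1 \<in> \<N>" "N1 \<inter> set (take j xs) \<noteq> {}" "N1 \<inter> Z = {}" by blast
    have "\<exists>N2\<in>\<N>. N2 \<inter> set (drop j xs) \<noteq> {} \<and> N2 \<inter> Z = {}"
    proof -
      \<comment> \<open>\<open>Z1\<close> hits the members meeting the prefix without its last
        vertex \<open>xs ! i\<close>. As \<open>Z\<close> and \<open>Z1\<close> have at most
        \<open>k - 1\<close> vertices each, the union has fewer than \<open>2 * k\<close>, and a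
        member missing it can meet the path only behind the prefix.\<close>
      let ?Z = "Z \<union> (Z1 \<union> {xs ! i})"
      have "card ?Z \<le> card Z + (card Z1 + card {xs ! i})"
        using card_Un_le[of Z "Z1 \<union> {xs ! i}"] card_Un_le[of Z1 "{xs ! i}"] by linarith
      then have "card ?Z < 2 * k" using Z Z1 by simp
      then obtain N2 where N2: "N2 \<in> \<N>" "N2 \<inter> ?Z = {}" using unhit[of ?Z] Z Z1 by auto
      have t: "set (take j xs) \<subseteq> insert (xs ! i) (set (take i xs))"
        unfolding i by (cases "i < length xs") (auto simp: take_Suc_conv_app_nth)
      have "N2 \<inter> set (take i xs) = {}" using Z1(3)[OF N2(1)] N2(2) by blast
      then have "N2 \<inter> set (take j xs) = {}" using t N2(2) by blast
      moreover have "set xs = set (take j xs) \<union> set (drop j xs)" by (metis append_take_drop_id set_append)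
      ultimately have "N2 \<inter> set (drop j xs) \<noteq> {}" using xs[OF N2(1)] by blast
      then show ?thesis using N2 by blast
    qed
    then obtain N2 where N2: "N2 \<in> \<N>" "N2 \<inter> set (drop j xs) \<noteq> {}" "N2 \<inter> Z = {}" by blast
    obtain a b where ab: "a \<in> N1 \<inter> set (take j xs)" "b \<in> N2 \<inter> set (drop j xs)" using N1(2) N2(2) by blast
    have conn: "conn_on E (N1 \<union> N2)"
      using conn_on_Un[OF \<open>sym E\<close> N(1)[OF N1(1)] N(1)[OF N2(1)] N(2)[OF N1(1) N2(1)]] .
    have "(a, b) \<in> (rs E (N1 \<union> N2))\<^sup>*" using conn_onD[OF conn, of a b] ab by blast
    then have "(a, b) \<in> (rs E (- Z))\<^sup>*" by (rule rtrancl_rs_mono) (use N1(3) N2(3) in blast)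
    moreover have "a \<in> set (take j xs) - Z" "b \<in> set (drop j xs) - Z" using ab N1(3) N2(3) by blast+
    ultimately show "\<exists>a\<in>set (take j xs) - Z. \<exists>b\<in>set (drop j xs) - Z. (a, b) \<in> (rs E (- Z))\<^sup>*" by blast
  qed
qed

text \<open>Thinned connectors attach to each part of the path in one vertex, distinct ones in
  distinct vertices. Some \<open>m\<close> of them attach in the same or in the opposite order on
  the two parts; in the latter case the second part is traversed backwards.\<close>

lemma necklace_of_linked_path:
  assumes "sym E" "distinct xs" "set xs \<subseteq> V" "successively (\<lambda>x y. (x, y) \<in> E) xs"
    and \<L>: "disjoint_connectors E (set (take j xs)) (set (drop j xs)) \<L>" "finite \<L>" "\<And>L. L \<in> \<L> \<Longrightarrow> L \<subseteq> V"
    and mono: "\<And>I (q :: nat \<Rightarrow> nat). finite I \<Longrightarrow> card I \<ge> card \<L> \<Longrightarrow> inj_on q I \<Longrightarrow>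
     (\<exists>R\<subseteq>I. card R = m \<and> ((\<forall>x\<in>R. \<forall>y\<in>R. x < y \<longrightarrow> q x < q y) \<or> (\<forall>x\<in>R. \<forall>y\<in>R. x < y \<longrightarrow> q y < q x)))"
  shows "\<exists>B. necklace E V m B"
proof -
  let ?n = "length xs"
  have step: "(xs ! l, xs ! Suc l) \<in> E" if "Suc l < ?n" for l
    using assms(4) that by (simp add: successively_conv_nth)
  have nth_eq: "xs ! a = xs ! b \<longleftrightarrow> a = b" if "a < ?n" "b < ?n" for a b
    using nth_eq_iff_index_eq[OF assms(2) that] .
  define A where "A = set (take j xs)"
  define D where "D = set (drop j xs)"
  define n where "n = min j ?n"
  define n' where "n' = ?n - n"
  have A: "A = (\<lambda>l. xs ! l) ` {..<n}"
  proof -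
    have "take j xs = take n xs" by (simp add: n_def min_def)
    then show ?thesis using nth_image[of n xs] by (simp add: A_def n_def atLeast0LessThan)
  qed
  have drop: "drop j xs = drop n xs" by (simp add: n_def min_def)
  have D: "D = (\<lambda>l. xs ! (n + l)) ` {..<n'}"
  proof -
    have "set (drop n xs) = (!) (drop n xs) ` {..<n'}"
      using nth_image[of "length (drop n xs)" "drop n xs"] by (simp add: n'_def atLeast0LessThan)
    also have "\<dots> = (\<lambda>l. xs ! (n + l)) ` {..<n'}"
      by (intro image_cong) (auto simp: n'_def n_def)
    finally show ?thesis unfolding D_def drop .
  qed
  have nn: "n + n' = ?n" by (simp add: n'_def n_def)
  have AD: "A \<inter> D = {}" unfolding A D using nth_eq nn by auto
  have LL: "L \<inter> L' = {}" if "L \<in> \<L>" "L' \<in> \<L>" "L \<noteq> L'" for L L'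
    using \<L>(1) that by (auto simp: disjoint_connectors_def)
  have thin: "\<exists>M p q. M \<subseteq> L \<and> conn_on E M \<and> p < n \<and> q < n' \<and> M \<inter> A = {xs ! p} \<and> M \<inter> D = {xs ! (n + q)}"
    if L: "L \<in> \<L>" for L
  proof -
    have "conn_on E L" "L \<inter> A \<noteq> {}" "L \<inter> D \<noteq> {}"
      using \<L>(1) L by (auto simp: disjoint_connectors_def A_def D_def)
    then obtain M a b where M: "M \<subseteq> L" "conn_on E M" "M \<inter> A = {a}" "M \<inter> D = {b}"
      using thin_connector[OF \<open>sym E\<close> _ _ _ AD] by metis
    have "a \<in> A" "b \<in> D" using M by blast+
    then obtain p q where "p < n" "q < n'" "a = xs ! p" "b = xs ! (n + q)" unfolding A D by blast
    then show ?thesis using M by blast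
  qed
  then obtain M p q where Mpq: "\<And>L. L \<in> \<L> \<Longrightarrow> M L \<subseteq> L \<and> conn_on E (M L) \<and> p L < n \<and> q L < n'
      \<and> M L \<inter> A = {xs ! p L} \<and> M L \<inter> D = {xs ! (n + q L)}"
    by metis
  have pinj: "inj_on p \<L>"
  proof (rule inj_onI)
    fix L L' assume *: "L \<in> \<L>" "L' \<in> \<L>" "p L = p L'"
    then have "xs ! p L \<in> L \<inter> L'" using Mpq[of L] Mpq[of L'] by auto
    then show "L = L'" using LL * by blast
  qed
  have qinj: "q L \<noteq> q L'" if *: "L \<in> \<L>" "L' \<in> \<L>" "L \<noteq> L'" for L L'
  proof
    assume "q L = q L'"
    then have "xs ! (n + q L) \<in> L \<inter> L'" using Mpq[of L] Mpq[of L'] * by auto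
    then show False using LL * by blast
  qed
  \<comment> \<open>Connectors are indexed by their position on the first part, so that
    \<open>q\<close> becomes an injection between positions.\<close>
  define L where "L = inv_into \<L> p"
  have L: "L i \<in> \<L>" "p (L i) = i" if "i \<in> p ` \<L>" for i
    using that by (auto simp: L_def inv_into_into f_inv_into_f)
  have "inj_on (\<lambda>i. q (L i)) (p ` \<L>)"
  proof (rule inj_onI)
    fix i i' assume *: "i \<in> p ` \<L>" "i' \<in> p ` \<L>" "q (L i) = q (L i')"
    then have eq: "L i = L i'" using qinj[OF L(1) L(1), of i i'] by blast
    have "i = p (L i)" by (rule L(2)[OF *(1), symmetric])
    also have "\<dots> = i'" unfolding eq by (rule L(2)[OF *(2)])
    finally show "i = i'" .
  qed
  moreover have "card (p ` \<L>) = card \<L>" by (rule card_image[OF pinj])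
  ultimately obtain R where R: "R \<subseteq> p ` \<L>" "card R = m"
    "(\<forall>x\<in>R. \<forall>y\<in>R. x < y \<longrightarrow> q (L x) < q (L y)) \<or> (\<forall>x\<in>R. \<forall>y\<in>R. x < y \<longrightarrow> q (L y) < q (L x))"
    using mono[of "p ` \<L>" "\<lambda>i. q (L i)"] \<L>(2) by auto
  have finR: "finite R" using R(1) \<L>(2) finite_subset by blast
  define r where "r i = sorted_list_of_set R ! i" for i
  have len: "length (sorted_list_of_set R) = m" using R(2) by simp
  have rR: "r i \<in> R" if "i < m" for i
    using that len nth_mem[of i "sorted_list_of_set R"] finR by (simp add: r_def)
  have r: "r i < r i'" if "i < i'" "i' < m" for i i'
    unfolding r_def by (rule sorted_wrt_nth_less[OF strict_sorted_list_of_set]) (use that len in auto)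
  have rL: "L (r i) \<in> \<L>" "p (L (r i)) = r i" if "i < m" for i
    using L[of "r i"] rR[OF that] R(1) by auto
  have LrL: "L (r i) \<noteq> L (r i')" if "i < m" "i' < m" "i \<noteq> i'" for i i'
  proof -
    have "r i \<noteq> r i'" using r[of i i'] r[of i' i] that by (metis less_irrefl nat_neq_iff)
    then show ?thesis using rL(2)[OF that(1)] rL(2)[OF that(2)] by metis
  qed
  have rn: "r i < n" if "i < m" for i using rL[OF that] Mpq[of "L (r i)"] by auto
  have MM: "M (L (r i)) \<inter> M (L (r i')) = {}" if "i < m" "i' < m" "i \<noteq> i'" for i i'
  proof -
    have "M (L (r i)) \<subseteq> L (r i)" "M (L (r i')) \<subseteq> L (r i')"
      using Mpq[OF rL(1)[OF that(1)]] Mpq[OF rL(1)[OF that(2)]] by blast+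
    then show ?thesis using LL[OF rL(1)[OF that(1)] rL(1)[OF that(2)] LrL[OF that]] by blast
  qed
  have MV: "conn_on E (M (L (r i)))" "M (L (r i)) \<subseteq> V" "M (L (r i)) \<inter> A = {xs ! r i}"
    "M (L (r i)) \<inter> D = {xs ! (n + q (L (r i)))}" "q (L (r i)) < n'" if "i < m" for i
    using Mpq[OF rL(1)[OF that]] rL(2)[OF that] \<L>(3)[OF rL(1)[OF that]] by auto
  have u: "inj_on (\<lambda>l. xs ! l) {..<n}" "(\<lambda>l. xs ! l) ` {..<n} \<subseteq> V"
    using nn nth_eq assms(3) by (auto simp: inj_on_def)
  have DV: "D \<subseteq> V" using assms(3) set_drop_subset[of j xs] by (auto simp: D_def)
  from R(3) show ?thesis
  proof
    assume inc: "\<forall>x\<in>R. \<forall>y\<in>R. x < y \<longrightarrow> q (L x) < q (L y)"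
    show ?thesis
    proof (rule necklace_of_ladder[where u = "\<lambda>l. xs ! l" and n = n and v = "\<lambda>l. xs ! (n + l)" and n' = n'
          and r = r and s = "\<lambda>i. q (L (r i))" and M = "\<lambda>i. M (L (r i))" and S = V and m = m, OF \<open>sym E\<close> u(1) _ u(2)])
      show "(xs ! l, xs ! Suc l) \<in> E" if "Suc l < n" for l using step that nn by simp
      show "inj_on (\<lambda>l. xs ! (n + l)) {..<n'}" using nn nth_eq by (auto simp: inj_on_def)
      show "(xs ! (n + l), xs ! (n + Suc l)) \<in> E" if "Suc l < n'" for l using step[of "n + l"] that nn by simp
      show "(\<lambda>l. xs ! (n + l)) ` {..<n'} \<subseteq> V" using DV D by simp
      show "(\<lambda>l. xs ! l) ` {..<n} \<inter> (\<lambda>l. xs ! (n + l)) ` {..<n'} = {}" using AD A D by simp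
      show "q (L (r i)) < q (L (r i'))" if "i < i'" "i' < m" for i i'
        using inc r[OF that] rR[of i] rR[of i'] that by auto
      show "conn_on E (M (L (r i))) \<and> M (L (r i)) \<subseteq> V \<and> M (L (r i)) \<inter> (\<lambda>l. xs ! l) ` {..<n} = {xs ! r i}
          \<and> M (L (r i)) \<inter> (\<lambda>l. xs ! (n + l)) ` {..<n'} = {xs ! (n + q (L (r i)))}" if "i < m" for i
        using MV[OF that] A D by simp
    qed (use r rn MV MM in auto)
  next
    assume dec: "\<forall>x\<in>R. \<forall>y\<in>R. x < y \<longrightarrow> q (L y) < q (L x)"
    have D': "D = (\<lambda>l. xs ! (?n - 1 - l)) ` {..<n'}"
    proof -
      have "{..<n'} = (\<lambda>l. n' - 1 - l) ` {..<n'}"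
      proof
        show "{..<n'} \<subseteq> (\<lambda>l. n' - 1 - l) ` {..<n'}"
        proof
          fix l assume "l \<in> {..<n'}"
          then show "l \<in> (\<lambda>l. n' - 1 - l) ` {..<n'}" by (intro image_eqI[of _ _ "n' - 1 - l"]) auto
        qed
      qed auto
      then have "D = (\<lambda>l. xs ! (n + l)) ` (\<lambda>l. n' - 1 - l) ` {..<n'}"
        unfolding D by (rule arg_cong[of _ _ "image (\<lambda>l. xs ! (n + l))"])
      also have "\<dots> = (\<lambda>l. xs ! (n + (n' - 1 - l))) ` {..<n'}" by (rule image_image)
      also have "\<dots> = (\<lambda>l. xs ! (?n - 1 - l)) ` {..<n'}"
        using nn by (intro image_cong arg_cong[of _ _ "(!) xs"]) auto
      finally show ?thesis .
    qed
    show ?thesis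
    proof (rule necklace_of_ladder[where u = "\<lambda>l. xs ! l" and n = n and v = "\<lambda>l. xs ! (?n - 1 - l)" and n' = n'
          and r = r and s = "\<lambda>i. n' - 1 - q (L (r i))" and M = "\<lambda>i. M (L (r i))" and S = V and m = m, OF \<open>sym E\<close> u(1) _ u(2)])
      show "(xs ! l, xs ! Suc l) \<in> E" if "Suc l < n" for l using step that nn by simp
      show "inj_on (\<lambda>l. xs ! (?n - 1 - l)) {..<n'}"
      proof (rule inj_onI)
        fix a b assume *: "a \<in> {..<n'}" "b \<in> {..<n'}" "xs ! (?n - 1 - a) = xs ! (?n - 1 - b)"
        then have "?n - 1 - a = ?n - 1 - b" using nth_eq[of "?n - 1 - a" "?n - 1 - b"] nn by auto
        then show "a = b" using * nn by auto
      qed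
      show "(xs ! (?n - 1 - l), xs ! (?n - 1 - Suc l)) \<in> E" if "Suc l < n'" for l
      proof -
        have "Suc (?n - 1 - Suc l) = ?n - 1 - l" "Suc (?n - 1 - Suc l) < ?n" using that nn by auto
        then show ?thesis using step[of "?n - 1 - Suc l"] \<open>sym E\<close> by (metis symD)
      qed
      show "(\<lambda>l. xs ! (?n - 1 - l)) ` {..<n'} \<subseteq> V" using DV D' by simp
      show "(\<lambda>l. xs ! l) ` {..<n} \<inter> (\<lambda>l. xs ! (?n - 1 - l)) ` {..<n'} = {}" using AD A D' by simp
      show "n' - 1 - q (L (r i)) < n' - 1 - q (L (r i'))" if i: "i < i'" "i' < m" for i i'
      proof -
        have "q (L (r i')) < q (L (r i))" using dec r[OF i] rR[of i] rR[of i'] i by auto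
        then show ?thesis using MV(5)[of i] MV(5)[of i'] i by auto
      qed
      show "conn_on E (M (L (r i))) \<and> M (L (r i)) \<subseteq> V \<and> M (L (r i)) \<inter> (\<lambda>l. xs ! l) ` {..<n} = {xs ! r i}
          \<and> M (L (r i)) \<inter> (\<lambda>l. xs ! (?n - 1 - l)) ` {..<n'} = {xs ! (?n - 1 - (n' - 1 - q (L (r i))))}" if i: "i < m" for i
      proof -
        have "?n - 1 - (n' - 1 - q (L (r i))) = n + q (L (r i))" using MV(5)[OF i] nn by auto
        then show ?thesis using MV[OF i] A D' by simp
      qed
      show "n' - 1 - q (L (r i)) < n'" if "i < m" for i using MV(5)[OF that] by auto
    qed (use r rn MM in auto)
  qed
qed

text \<open>Erdos-Posa property: a path meeting all members is cut into two parts with \<open>k\<close> disjoint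
  connections between them, and these form a ladder by Ramsey's theorem.\<close>

lemma intersecting_family_hitting_set:
  "\<exists>k. \<forall>(E :: 'a rel) V \<N>. finite V \<longrightarrow> sym E \<longrightarrow> conn_on E V \<longrightarrow> (\<forall>N\<in>\<N>. conn_on E N \<and> N \<subseteq> V)
     \<longrightarrow> (\<forall>N\<in>\<N>. \<forall>M\<in>\<N>. N \<inter> M \<noteq> {}) \<longrightarrow> (\<nexists>B. necklace E V m B)
     \<longrightarrow> (\<exists>Z. finite Z \<and> card Z \<le> k \<and> (\<forall>N\<in>\<N>. N \<inter> Z \<noteq> {}))"
proof -
  obtain k where k0: "k \<ge> 1 \<and> (\<forall>I (q :: nat \<Rightarrow> nat). finite I \<and> card I \<ge> k \<and> inj_on q I \<longrightarrow>
     (\<exists>R\<subseteq>I. card R = m \<and> ((\<forall>x\<in>R. \<forall>y\<in>R. x < y \<longrightarrow> q x < q y) \<or> (\<forall>x\<in>R. \<forall>y\<in>R. x < y \<longrightarrow> q y < q x))))"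
    using monotone_restriction[of m] ..
  note k = k0[THEN conjunct1] and kR = k0[THEN conjunct2, rule_format, OF conjI[OF _ conjI]]
  \<comment> \<open>Finding members on both sides of the cut takes up fewer than
    \<open>2 * k\<close> vertices.\<close>
  have main: "\<exists>Z. finite Z \<and> card Z \<le> 2 * k \<and> (\<forall>N\<in>\<N>. N \<inter> Z \<noteq> {})"
    if fin: "finite V" and "sym E" and V: "conn_on E V" and N: "\<forall>N\<in>\<N>. conn_on E N \<and> N \<subseteq> V"
      and int: "\<forall>N\<in>\<N>. \<forall>M\<in>\<N>. N \<inter> M \<noteq> {}" and no: "\<nexists>B. necklace E V m B"
    for E :: "'a rel" and V \<N>
  proof (rule ccontr)
    assume contr: "\<not> ?thesis"
    have unhit: "\<exists>N\<in>\<N>. N \<inter> Z = {}" if "finite Z" "card Z < 2 * k" for Z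
      using contr that by (meson less_imp_le)
    obtain v where "v \<in> V" using conn_on_nonempty[OF V] by blast
    have N': "\<And>N. N \<in> \<N> \<Longrightarrow> conn_on E N \<and> N \<subseteq> V" "\<And>N M. N \<in> \<N> \<Longrightarrow> M \<in> \<N> \<Longrightarrow> N \<inter> M \<noteq> {}"
      using N int by auto
    have "\<exists>xs. xs \<noteq> [] \<and> hd xs = v \<and> distinct xs \<and> set xs \<subseteq> V \<and> successively (\<lambda>x y. (x, y) \<in> E) xs
        \<and> (\<forall>N\<in>\<N>. N \<inter> set xs \<noteq> {})"
      by (rule path_through_intersecting_family[OF fin \<open>sym E\<close> V \<open>v \<in> V\<close>]) (erule N'(1), erule (1) N'(2))
    then obtain xs where xs: "xs \<noteq> []" "distinct xs" "set xs \<subseteq> V" "successively (\<lambda>x y. (x, y) \<in> E) xs"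
      "\<forall>N\<in>\<N>. N \<inter> set xs \<noteq> {}" by blast
    \<comment> \<open>The restriction to \<open>V\<close> makes the relation finite, as
      \<open>menger_connectors\<close> requires, and keeps the connectors inside
      \<open>V\<close>.\<close>
    let ?E = "rs E V"
    have conn': "conn_on ?E N" if "N \<in> \<N>" for N
    proof -
      have "rs ?E N = rs E N" using N'(1)[OF that] by blast
      then show ?thesis using N'(1)[OF that] by (simp add: conn_on_def)
    qed
    have "\<exists>j. linked ?E (set (take j xs)) (set (drop j xs)) k"
      by (rule subfamily_linkage[OF sym_rs[OF \<open>sym E\<close>] k])
         (erule conn', erule (1) N'(2), erule bspec[OF xs(5)], erule (1) unhit)
    then obtain j where j: "linked ?E (set (take j xs)) (set (drop j xs)) k" ..
    have "finite ?E" using fin by simp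
    then obtain \<L> where L: "disjoint_connectors ?E (set (take j xs)) (set (drop j xs)) \<L>" "card \<L> = k" "finite \<L>"
      using menger_connectors[OF _ sym_rs[OF \<open>sym E\<close>] j] by blast
    have LV: "L \<subseteq> V" if "L \<in> \<L>" for L
    proof
      fix z assume z: "z \<in> L"
      have L': "conn_on ?E L" "L \<inter> set (take j xs) \<noteq> {}" using L(1) that by (auto simp: disjoint_connectors_def)
      then obtain a where a: "a \<in> L" "a \<in> V" using set_take_subset[of j xs] xs(3) by blast
      have "(a, z) \<in> (rs ?E L)\<^sup>*" using conn_onD[OF L'(1) a(1) z] .
      then show "z \<in> V" by (induction rule: rtrancl_induct) (use a in auto)
    qed
    have "\<exists>B. necklace E V m B"
    proof (rule necklace_of_linked_path[OF \<open>sym E\<close> xs(2,3,4) _ L(3) LV])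
      show "disjoint_connectors E (set (take j xs)) (set (drop j xs)) \<L>"
        by (rule disjoint_connectors_mono[OF L(1)]) simp
    qed (assumption, unfold L(2), erule (2) kR)
    then show False using no by blast
  qed
  show ?thesis by (intro exI[of _ "2 * k"] allI impI) (rule main; assumption)
qed

section \<open>Graphs without long necklaces\<close>

lemma doubly_adjacent_mono:
  "doubly_adjacent E A B \<Longrightarrow> E \<subseteq> F \<Longrightarrow> A \<subseteq> A' \<Longrightarrow> B \<subseteq> B' \<Longrightarrow> doubly_adjacent F A' B'"
  unfolding doubly_adjacent_def by blast

lemma doubly_adjacent_sym:
  assumes "sym E" "doubly_adjacent E A B"
  shows "doubly_adjacent E B A"
proof -
  obtain a b a' b' where "(a, b) \<in> E \<inter> A \<times> B" "(a', b') \<in> E \<inter> A \<times> B" "(a, b) \<noteq> (a', b')"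
    using assms(2) unfolding doubly_adjacent_def by auto
  then have "(b, a) \<in> E \<inter> B \<times> A" "(b', a') \<in> E \<inter> B \<times> A" "(b, a) \<noteq> (b', a')"
    using assms(1) by (auto dest: symD)
  then show ?thesis unfolding doubly_adjacent_def by blast
qed

lemma necklaceI:
  assumes "\<And>i. i < n \<Longrightarrow> conn_on E (B i)" "\<And>i. i < n \<Longrightarrow> B i \<subseteq> S"
    "\<And>i j. i < j \<Longrightarrow> j < n \<Longrightarrow> B i \<inter> B j = {}"
    "\<And>i. Suc i < n \<Longrightarrow> doubly_adjacent E (B i) (B (Suc i))"
  shows "necklace E S n B"
proof -
  have "B i \<inter> B j = {}" if "i < n" "j < n" "i \<noteq> j" for i j
    using assms(3)[of i j] assms(3)[of j i] that by (cases "i < j") auto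
  then show ?thesis using assms(1,2,4) by (simp add: necklace_def)
qed

lemma necklace_mono:
  assumes "necklace E S n B" "E \<subseteq> F" "S \<subseteq> S'"
  shows "necklace F S' n B"
proof (rule necklaceI)
  show "conn_on F (B i)" if "i < n" for i using conn_on_mono[OF necklaceD(1)[OF assms(1) that] assms(2)] .
  show "B i \<subseteq> S'" if "i < n" for i using necklaceD(2)[OF assms(1) that] assms(3) by simp
  show "B i \<inter> B j = {}" if "i < j" "j < n" for i j using necklaceD(3)[OF assms(1), of i j] that by simp
  show "doubly_adjacent F (B i) (B (Suc i))" if "Suc i < n" for i
    using doubly_adjacent_mono[OF necklaceD(4)[OF assms(1) that] assms(2)] by simp
qed

lemma necklace_take: "necklace E S n B \<Longrightarrow> m \<le> n \<Longrightarrow> necklace E S m B"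
  by (simp add: necklace_def)

lemma necklace_rev:
  assumes "sym E" "necklace E S n B"
  shows "necklace E S n (\<lambda>i. B (n - 1 - i))"
proof (rule necklaceI)
  note d = necklaceD[OF assms(2)]
  show "conn_on E (B (n - 1 - i))" "B (n - 1 - i) \<subseteq> S" if "i < n" for i
    using d(1,2)[of "n - 1 - i"] that by auto
  show "B (n - 1 - i) \<inter> B (n - 1 - j) = {}" if "i < j" "j < n" for i j
    by (rule d(3)) (use that in auto)
  show "doubly_adjacent E (B (n - 1 - i)) (B (n - 1 - Suc i))" if "Suc i < n" for i
  proof -
    have "Suc (n - 1 - Suc i) = n - 1 - i" "Suc (n - 1 - Suc i) < n" using that by auto
    then show ?thesis using doubly_adjacent_sym[OF assms(1) d(4)[of "n - 1 - Suc i"]] by simp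
  qed
qed

lemma necklace_append:
  assumes B: "necklace E S (Suc n) B" and C: "necklace E S m C"
    and disj: "\<And>i j. i < Suc n \<Longrightarrow> j < m \<Longrightarrow> B i \<inter> C j = {}"
    and adj: "0 < m \<Longrightarrow> doubly_adjacent E (B n) (C 0)"
  shows "necklace E S (Suc n + m) (\<lambda>i. if i \<le> n then B i else C (i - Suc n))"
proof (rule necklaceI)
  note b = necklaceD[OF B] and c = necklaceD[OF C]
  show "conn_on E (if i \<le> n then B i else C (i - Suc n))" if "i < Suc n + m" for i
    using b(1)[of i] c(1)[of "i - Suc n"] that by auto
  show "(if i \<le> n then B i else C (i - Suc n)) \<subseteq> S" if "i < Suc n + m" for i
    using b(2)[of i] c(2)[of "i - Suc n"] that by simp
  show "(if i \<le> n then B i else C (i - Suc n)) \<inter> (if j \<le> n then B j else C (j - Suc n)) = {}"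
    if "i < j" "j < Suc n + m" for i j
    using b(3)[of i j] c(3)[of "i - Suc n" "j - Suc n"] disj[of i "j - Suc n"] that by simp
  show "doubly_adjacent E (if i \<le> n then B i else C (i - Suc n)) (if Suc i \<le> n then B (Suc i) else C (Suc i - Suc n))"
    if "Suc i < Suc n + m" for i
  proof -
    consider "i < n" | "i = n" | "n < i" by linarith
    then show ?thesis
    proof cases
      case 1 then show ?thesis using b(4)[of i] by simp
    next
      case 2 then show ?thesis using adj that by simp
    next
      case 3
      then have "Suc (i - Suc n) = i - n" using that by simp
      then show ?thesis using c(4)[of "i - Suc n"] 3 that by simp
    qed
  qed
qed

lemma necklace_enlarge_last:
  assumes B: "necklace E S (Suc n) B" and W: "B n \<subseteq> W" "conn_on E W" "W \<subseteq> S" "\<And>i. i < n \<Longrightarrow> B i \<inter> W = {}"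
  shows "necklace E S (Suc n) (B(n := W))"
proof (rule necklaceI)
  note b = necklaceD[OF B]
  show "conn_on E ((B(n := W)) i)" "(B(n := W)) i \<subseteq> S" if "i < Suc n" for i
    using b(1,2)[of i] W that by auto
  show "(B(n := W)) i \<inter> (B(n := W)) j = {}" if "i < j" "j < Suc n" for i j
    using b(3)[of i j] W(4)[of i] that by auto
  show "doubly_adjacent E ((B(n := W)) i) ((B(n := W)) (Suc i))" if "Suc i < Suc n" for i
    using doubly_adjacent_mono[OF b(4)[OF that] subset_refl subset_refl, of W] b(4)[OF that] W(1) that by simp
qed

text \<open>Of the two halves ending in bag \<open>i\<close> the longer one is kept, reversed if it
  lies behind \<open>i\<close>; bag \<open>i\<close> is then last, ready for a junction.\<close>

lemma necklace_half:
  assumes "sym E" "necklace E S n B" "i < n"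
  obtains B' where "necklace E S (Suc (max i (n - 1 - i))) B'" "B' (max i (n - 1 - i)) = B i"
    "\<And>j. j < max i (n - 1 - i) \<Longrightarrow> \<exists>l<n. l \<noteq> i \<and> B' j = B l"
proof (cases "n - 1 - i \<le> i")
  case True
  then have m: "max i (n - 1 - i) = i" by simp
  show thesis
  proof (rule that[of B], unfold m)
    show "necklace E S (Suc i) B" using assms(3) by (intro necklace_take[OF assms(2)]) simp
    show "\<exists>l<n. l \<noteq> i \<and> B j = B l" if "j < i" for j
      using that assms(3) by (intro exI[of _ j]) auto
  qed simp
next
  case False
  then have m: "max i (n - 1 - i) = n - 1 - i" by simp
  show thesis
  proof (rule that[of "\<lambda>j. B (n - 1 - j)"], unfold m)
    show "necklace E S (Suc (n - 1 - i)) (\<lambda>j. B (n - 1 - j))"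
      using assms(3) by (intro necklace_take[OF necklace_rev[OF assms(1,2)]]) simp
    show "B (n - 1 - (n - 1 - i)) = B i" using assms(3) by simp
    show "\<exists>l<n. l \<noteq> i \<and> B (n - 1 - j) = B l" if "j < n - 1 - i" for j
      using that by (intro exI[of _ "n - 1 - j"]) auto
  qed
qed

text \<open>\<open>W\<close> merges bag \<open>i\<close> of the first necklace with bag
  \<open>k\<close> of the second, and the longer half of each is attached to it; the merged bag
  counts once.\<close>

lemma necklace_join_at:
  assumes "sym E" and B: "necklace E S n B" and C: "necklace E S n C"
    and BC: "\<And>i j. i < n \<Longrightarrow> j < n \<Longrightarrow> B i \<inter> C j = {}"
    and ik: "i < n" "k < n"
    and W: "conn_on E W" "W \<subseteq> S" "B i \<subseteq> W" "C k \<subseteq> W"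
    "\<And>l. l < n \<Longrightarrow> l \<noteq> i \<Longrightarrow> B l \<inter> W = {}" "\<And>l. l < n \<Longrightarrow> l \<noteq> k \<Longrightarrow> C l \<inter> W = {}"
  shows "\<exists>D. necklace E S (Suc (max i (n - 1 - i)) + max k (n - 1 - k)) D"
proof -
  define p q where "p = max i (n - 1 - i)" and "q = max k (n - 1 - k)"
  obtain B' where B': "necklace E S (Suc p) B'" "B' p = B i" "\<And>j. j < p \<Longrightarrow> \<exists>l<n. l \<noteq> i \<and> B' j = B l"
    using necklace_half[OF \<open>sym E\<close> B ik(1)] unfolding p_def[symmetric] by blast
  obtain C' where C': "necklace E S (Suc q) C'" "C' q = C k" "\<And>j. j < q \<Longrightarrow> \<exists>l<n. l \<noteq> k \<and> C' j = C l"
    using necklace_half[OF \<open>sym E\<close> C ik(2)] unfolding q_def[symmetric] by blast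
  have BW: "B' j \<inter> W = {}" if "j < p" for j using B'(3)[OF that] W(5) by metis
  have CW: "C' j \<inter> W = {}" if "j < q" for j using C'(3)[OF that] W(6) by metis
  have n1: "necklace E S (Suc p) (B'(p := W))"
    by (rule necklace_enlarge_last[OF B'(1)]) (use B'(2) W BW in auto)
  have n2: "necklace E S q (\<lambda>j. C' (q - 1 - j))"
    using necklace_rev[OF \<open>sym E\<close> necklace_take[OF C'(1), of q]] by simp
  have "necklace E S (Suc p + q) (\<lambda>i. if i \<le> p then (B'(p := W)) i else C' (q - 1 - (i - Suc p)))"
  proof (rule necklace_append[OF n1 n2])
    show "(B'(p := W)) a \<inter> C' (q - 1 - j) = {}" if aj: "a < Suc p" "j < q" for a j
    proof (cases "a = p")
      case True
      then show ?thesis using CW[of "q - 1 - j"] aj by auto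
    next
      case False
      then have "a < p" using aj by simp
      then obtain l where l: "l < n" "B' a = B l" using B'(3) by blast
      have "q - 1 - j < q" using aj by simp
      then obtain l' where "l' < n" "C' (q - 1 - j) = C l'" using C'(3) by blast
      then show ?thesis using BC[OF l(1)] l False by simp
    qed
    show "doubly_adjacent E ((B'(p := W)) p) (C' (q - 1 - 0))" if "0 < q"
    proof -
      have "doubly_adjacent E (C' (q - 1)) (C' q)" using necklaceD(4)[OF C'(1), of "q - 1"] that by simp
      then have "doubly_adjacent E (C' q) (C' (q - 1))" by (rule doubly_adjacent_sym[OF \<open>sym E\<close>])
      then show ?thesis using doubly_adjacent_mono[OF _ subset_refl W(4) subset_refl] C'(2) by simp
    qed
  qed
  then show ?thesis unfolding p_def q_def by blast
qed

text \<open>Here \<open>W\<close> replaces only bag \<open>i\<close>, and bag \<open>k\<close>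
  survives as its neighbour, which gains one bag over \<open>necklace_join_at\<close>.\<close>

lemma necklace_join_double:
  assumes "sym E" and B: "necklace E S n B" and C: "necklace E S n C"
    and BC: "\<And>i j. i < n \<Longrightarrow> j < n \<Longrightarrow> B i \<inter> C j = {}"
    and ik: "i < n" "k < n"
    and W: "conn_on E W" "W \<subseteq> S" "B i \<subseteq> W"
    "\<And>l. l < n \<Longrightarrow> l \<noteq> i \<Longrightarrow> B l \<inter> W = {}" "\<And>l. l < n \<Longrightarrow> C l \<inter> W = {}"
    and adj: "doubly_adjacent E W (C k)"
  shows "\<exists>D. necklace E S (Suc (max i (n - 1 - i)) + Suc (max k (n - 1 - k))) D"
proof -
  define p q where "p = max i (n - 1 - i)" and "q = max k (n - 1 - k)"
  obtain B' where B': "necklace E S (Suc p) B'" "B' p = B i" "\<And>j. j < p \<Longrightarrow> \<exists>l<n. l \<noteq> i \<and> B' j = B l"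
    using necklace_half[OF \<open>sym E\<close> B ik(1)] unfolding p_def[symmetric] by blast
  obtain C' where C': "necklace E S (Suc q) C'" "C' q = C k" "\<And>j. j < q \<Longrightarrow> \<exists>l<n. l \<noteq> k \<and> C' j = C l"
    using necklace_half[OF \<open>sym E\<close> C ik(2)] unfolding q_def[symmetric] by blast
  have Cl: "\<exists>l<n. C' j = C l" if "j < Suc q" for j
    using C'(2,3) ik that by (metis less_antisym)
  have BW: "B' j \<inter> W = {}" if "j < p" for j using B'(3)[OF that] W(4) by metis
  have n1: "necklace E S (Suc p) (B'(p := W))"
    by (rule necklace_enlarge_last[OF B'(1)]) (use B'(2) W BW in auto)
  have n2: "necklace E S (Suc q) (\<lambda>j. C' (q - j))"
    using necklace_rev[OF \<open>sym E\<close> C'(1)] by simp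
  have "necklace E S (Suc p + Suc q) (\<lambda>i. if i \<le> p then (B'(p := W)) i else C' (q - (i - Suc p)))"
  proof (rule necklace_append[OF n1 n2])
    show "(B'(p := W)) a \<inter> C' (q - j) = {}" if "a < Suc p" "j < Suc q" for a j
    proof -
      have "q - j < Suc q" by simp
      then obtain l' where l': "l' < n" "C' (q - j) = C l'" using Cl by blast
      show ?thesis
      proof (cases "a = p")
        case True
        then show ?thesis using W(5)[OF l'(1)] l'(2) by auto
      next
        case False
        then have "a < p" using that by simp
        then obtain l where l: "l < n" "B' a = B l" using B'(3) by blast
        then show ?thesis using BC[OF l(1) l'(1)] l l' False by simp
      qed
    qed
    show "doubly_adjacent E ((B'(p := W)) p) (C' (q - 0))" using adj C'(2) by simp
  qed
  then show ?thesis unfolding p_def q_def by blast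
qed

lemma conn_on_necklace:
  assumes "sym E" "necklace E S (Suc n) B"
  shows "conn_on E (\<Union>i<Suc n. B i)"
  using assms(2)
proof (induction n)
  case 0
  then show ?case using necklaceD(1)[OF 0, of 0] by (simp add: lessThan_Suc)
next
  case (Suc n)
  have IH: "conn_on E (\<Union>i<Suc n. B i)" using Suc.IH[OF necklace_take[OF Suc.prems]] by simp
  obtain a b where "(a, b) \<in> E" "a \<in> B n" "b \<in> B (Suc n)"
    using necklaceD(4)[OF Suc.prems, of n] unfolding doubly_adjacent_def by auto
  then have "conn_on E ((\<Union>i<Suc n. B i) \<union> B (Suc n))"
    by (intro conn_on_Un_edge[OF assms(1) IH necklaceD(1)[OF Suc.prems]]) auto
  moreover have "(\<Union>i<Suc n. B i) \<union> B (Suc n) = (\<Union>i<Suc (Suc n). B i)" by (auto simp: lessThan_Suc)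
  ultimately show ?case by simp
qed

text \<open>A path between two disjoint longest necklaces contracts to a longer necklace unless it attaches
  to the middle bag of both; in that case a second edge, which exists since there are no bridges,
  makes the two middle bags consecutive.\<close>

lemma longest_necklaces_intersect:
  assumes "sym E" "E \<subseteq> V \<times> V" "conn_on E V" and nobr: "\<And>x y. (x, y) \<in> E \<Longrightarrow> \<not> bridge_in E x y"
    and B: "necklace E V n B" and C: "necklace E V n C" and n: "n \<ge> 1"
    and no: "\<nexists>D. necklace E V (Suc n) D"
  shows "(\<Union>i<n. B i) \<inter> (\<Union>i<n. C i) \<noteq> {}"
proof
  assume disj: "(\<Union>i<n. B i) \<inter> (\<Union>i<n. C i) = {}"
  define N1 N2 where "N1 = (\<Union>i<n. B i)" and "N2 = (\<Union>i<n. C i)"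
  note b = necklaceD[OF B] and c = necklaceD[OF C]
  have short: "m \<le> n" if "necklace E V m D" for m D
    using no necklace_take[OF that, of "Suc n"] by (meson not_less_eq_eq)
  have BC: "B i \<inter> C j = {}" if "i < n" "j < n" for i j using disj that by blast
  obtain n0 where n0: "n = Suc n0" using n by (cases n) auto
  have cN1: "conn_on E N1" using conn_on_necklace[OF assms(1)] B unfolding N1_def n0 by blast
  have NV: "N1 \<subseteq> V" "N2 \<subseteq> V" using b(2) c(2) unfolding N1_def N2_def by blast+
  have BN: "B i \<subseteq> N1" and CN: "C i \<subseteq> N2" if "i < n" for i using that unfolding N1_def N2_def by blast+
  obtain r where r: "r \<in> B 0" using conn_on_nonempty[OF b(1)[of 0]] n by auto
  have rN: "r \<in> N1" using r BN[of 0] n by auto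
  obtain c0 where c0: "c0 \<in> N2" using conn_on_nonempty[OF c(1)[of 0]] CN[of 0] n by auto
  have rV: "r \<in> V - N2" using rN NV disj unfolding N1_def N2_def by blast
  \<comment> \<open>What the first necklace reaches without touching the second; every edge leaving
    \<open>Q\<close> ends in the second.\<close>
  define Q where "Q = comp_of E (V - N2) r"
  have QV: "Q \<subseteq> V - N2" unfolding Q_def by (rule comp_of_subset[OF rV])
  have cQ: "conn_on E Q" unfolding Q_def by (rule comp_of_conn[OF assms(1) rV])
  have rQ: "r \<in> Q" by (simp add: Q_def)
  have N1Q: "N1 \<subseteq> Q" unfolding Q_def
    by (rule comp_of_maximal[OF cN1 _ rV])
       (use NV disj rN in \<open>auto simp: N1_def N2_def\<close>)
  have leave: "y \<in> N2" if "(x, y) \<in> E" "x \<in> Q" "y \<notin> Q" for x y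
    using comp_of_closed[of x E "V - N2" r y] that rV assms(2) unfolding Q_def by blast
  \<comment> \<open>A route from \<open>q\<close> that meets the first necklace in one vertex only,
    hence in a single bag.\<close>
  have first: "\<exists>X m. X \<subseteq> Q \<and> conn_on E X \<and> q \<in> X \<and> X \<inter> N1 = {m}" if q: "q \<in> Q" for q
  proof (cases "q \<in> N1")
    case True
    then show ?thesis using q by (intro exI[of _ "{q}"] exI[of _ q]) auto
  next
    case False
    obtain M a b where M: "M \<subseteq> Q" "conn_on E M" "M \<inter> N1 = {a}" "M \<inter> {q} = {b}"
      by (rule thin_connector[OF assms(1) cQ, of N1 "{q}"]) (use rN rQ False q in auto)
    have "q \<in> M" using M(4) by (cases "q \<in> M") simp_all
    then show ?thesis using M(1,2,3) by (intro exI[of _ M] exI[of _ a]) simp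
  qed
  define p where "p = (n - 1) div 2"
  \<comment> \<open>The middle bag, enlarged by all that it reaches in \<open>Q\<close> outside the
    other bags.\<close>
  define R where "R = comp_of E (Q - (N1 - B p)) (SOME z. z \<in> B p)"
  have attach: "n = 2 * p + 1 \<and> y \<in> C p \<and> x \<in> R" if xy: "(x, y) \<in> E" "x \<in> Q" "y \<notin> Q" for x y
  proof -
    obtain k where k: "k < n" "y \<in> C k" using leave[OF xy] unfolding N2_def by blast
    obtain X m where X: "X \<subseteq> Q" "conn_on E X" "x \<in> X" "X \<inter> N1 = {m}" using first[OF xy(2)] by blast
    then obtain i where i: "i < n" "m \<in> B i" unfolding N1_def by blast
    have mX: "m \<in> X" using X(4) by auto
    have BX: "conn_on E (B i \<union> X)"
      by (rule conn_on_Un[OF assms(1) b(1)[OF i(1)] X(2)]) (use i mX in blast)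
    have W: "conn_on E (B i \<union> X \<union> C k)"
      by (rule conn_on_Un_edge[OF assms(1) BX c(1)[OF k(1)] xy(1)]) (use X k in auto)
    have XC: "C l \<inter> X = {}" if "l < n" for l using CN[OF that] X(1) QV by blast
    have XB: "B l \<inter> X = {}" if "l < n" "l \<noteq> i" for l
    proof -
      have "B l \<inter> X \<subseteq> {m}" using BN[OF that(1)] X(4) by blast
      then show ?thesis using b(3)[OF that(1) i(1) that(2)] i(2) by blast
    qed
    have "\<exists>D. necklace E V (Suc (max i (n - 1 - i)) + max k (n - 1 - k)) D"
    proof (rule necklace_join_at[OF assms(1) B C BC i(1) k(1) W])
      show "B i \<union> X \<union> C k \<subseteq> V" using b(2)[OF i(1)] c(2)[OF k(1)] X(1) QV by blast
      show "B l \<inter> (B i \<union> X \<union> C k) = {}" if "l < n" "l \<noteq> i" for l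
        using b(3)[OF that(1) i(1) that(2)] XB[OF that] BC[OF that(1) k(1)] by (simp add: Int_Un_distrib)
      show "C l \<inter> (B i \<union> X \<union> C k) = {}" if "l < n" "l \<noteq> k" for l
        using c(3)[OF that(1) k(1) that(2)] XC[OF that(1)] BC[OF i(1) that(1)]
        by (simp add: Int_Un_distrib Int_commute)
    qed auto
    then have le: "Suc (max i (n - 1 - i)) + max k (n - 1 - k) \<le> n" using short by blast
    \<comment> \<open>Each of the two maxima is at least half of \<open>n - 1\<close>, and their sum
      is at most \<open>n - 1\<close>; so equality holds, and \<open>i\<close> and \<open>k\<close>
      are both the middle index.\<close>
    have "i \<le> max i (n - 1 - i)" "n - 1 - i \<le> max i (n - 1 - i)" "k \<le> max k (n - 1 - k)"
      "n - 1 - k \<le> max k (n - 1 - k)" by simp_all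
    with le have ik: "n = 2 * i + 1" "n = 2 * k + 1" using i(1) k(1) by linarith+
    then have ip: "i = p" "k = p" unfolding p_def by auto
    have pB: "(SOME z. z \<in> B p) \<in> B p" using i(2) ip by (auto intro: someI)
    have Xp: "z \<in> B p" if "z \<in> X" "z \<in> N1" for z
    proof -
      have "z \<in> X \<inter> N1" using that by simp
      then show ?thesis using i(2) ip(1) unfolding X(4) by simp
    qed
    have sub: "B i \<union> X \<subseteq> Q - (N1 - B p)"
      using X(1) Xp ip(1) BN[OF i(1)] N1Q by auto
    have "B i \<union> X \<subseteq> R" unfolding R_def
      by (rule comp_of_maximal[OF BX sub]) (use pB ip sub in auto)
    then show ?thesis using X(3) k ik ip by auto
  qed
  have c0Q: "c0 \<notin> Q" "c0 \<in> V" using c0 QV NV by auto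
  have "(r, c0) \<in> (rs E V)\<^sup>*" using conn_onD[OF assms(3)] rV c0Q by blast
  then obtain x y where xy: "(x, y) \<in> rs E V" "x \<in> Q" "y \<notin> Q" using rtrancl_cross[OF _ rQ c0Q(1)] by blast
  then have xyE: "(x, y) \<in> E" by simp
  \<comment> \<open>Since \<open>(x, y)\<close> is no bridge, a second edge leaves \<open>Q\<close>,
    and it too runs from \<open>R\<close> to \<open>C p\<close>.\<close>
  have "(x, y) \<in> (E - {(x, y), (y, x)})\<^sup>*" using nobr[OF xyE] by (simp add: bridge_in_def)
  then obtain x' y' where xy': "(x', y') \<in> E - {(x, y), (y, x)}" "x' \<in> Q" "y' \<notin> Q"
    using rtrancl_cross[OF _ xy(2,3)] by blast
  have a: "n = 2 * p + 1" "y \<in> C p" "x \<in> R" using attach[OF xyE xy(2,3)] by auto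
  have a': "y' \<in> C p" "x' \<in> R" using attach[OF _ xy'(2,3)] xy'(1) by auto
  have pn: "p < n" using a(1) by simp
  have pB: "(SOME z. z \<in> B p) \<in> B p" using conn_on_nonempty[OF b(1)[OF pn]] by (simp add: some_in_eq)
  have pQ: "(SOME z. z \<in> B p) \<in> Q - (N1 - B p)" using pB BN[OF pn] N1Q by blast
  have BR: "B p \<subseteq> R" unfolding R_def
  proof (rule comp_of_maximal[OF b(1)[OF pn] _ pQ])
    show "B p \<subseteq> Q - (N1 - B p)" using BN[OF pn] N1Q by auto
    show "B p \<inter> comp_of E (Q - (N1 - B p)) (SOME z. z \<in> B p) \<noteq> {}"
      using IntI[OF pB comp_of_self] by auto
  qed
  have RQ: "R \<subseteq> Q - (N1 - B p)" unfolding R_def by (rule comp_of_subset[OF pQ])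
  have "\<exists>D. necklace E V (Suc (max p (n - 1 - p)) + Suc (max p (n - 1 - p))) D"
  proof (rule necklace_join_double[OF assms(1) B C BC pn pn _ _ BR])
    show "conn_on E R" unfolding R_def by (rule comp_of_conn[OF assms(1) pQ])
    show "R \<subseteq> V" using RQ QV by blast
    show "B l \<inter> R = {}" if "l < n" "l \<noteq> p" for l
    proof -
      have "B l \<subseteq> N1 - B p" using BN[OF that(1)] b(3)[OF that(1) pn that(2)] by blast
      then show ?thesis using RQ by blast
    qed
    show "C l \<inter> R = {}" if "l < n" for l using CN[OF that] RQ QV by blast
    have "(x, y) \<in> E \<inter> R \<times> C p" "(x', y') \<in> E \<inter> R \<times> C p" "(x, y) \<noteq> (x', y')"
      using a a' xyE xy' by auto
    then show "doubly_adjacent E R (C p)" unfolding doubly_adjacent_def by blast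
  qed
  moreover have "Suc (max p (n - 1 - p)) + Suc (max p (n - 1 - p)) = Suc n" using a(1) by simp
  ultimately show False using no by (simp only:)
qed

section \<open>Necklaces and bridges under contraction\<close>

lemma contraction_map_conn:
  assumes c: "contraction_map f E S F W" and "conn_on E A" "A \<subseteq> S"
  shows "conn_on F (f ` A)"
  unfolding conn_on_def
proof (intro conjI ballI)
  note cd = contraction_mapD[OF c]
  show "f ` A \<noteq> {}" using conn_on_nonempty[OF assms(2)] by blast
  fix u v assume "u \<in> f ` A" "v \<in> f ` A"
  then obtain x y where xy: "x \<in> A" "y \<in> A" "u = f x" "v = f y" by blast
  have "(x, y) \<in> (rs E A)\<^sup>*" using conn_onD[OF assms(2) xy(1,2)] .
  then have "(f x, f y) \<in> (rs F (f ` A))\<^sup>*"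
  proof (induction rule: rtrancl_induct)
    case (step y z)
    show ?case
    proof (cases "f y = f z")
      case True
      show ?thesis using step(3) unfolding True .
    next
      case False
      then have "(f y, f z) \<in> rs F (f ` A)" using cd(2)[of y z] step(2) assms(3) by auto
      with step(3) show ?thesis by (rule rtrancl.rtrancl_into_rtrancl)
    qed
  qed simp
  then show "(u, v) \<in> (rs F (f ` A))\<^sup>*" using xy by simp
qed

text \<open>Preimages of bags are connected, and the two edges between consecutive bags have
  different lifts because \<open>f\<close> recovers them.\<close>

lemma contraction_map_lift_necklace:
  assumes c: "contraction_map f E S F W" and B: "necklace F W n B"
  shows "necklace E S n (\<lambda>i. {x\<in>S. f x \<in> B i})"
proof (rule necklaceI)
  note b = necklaceD[OF B]
  show "conn_on E {x\<in>S. f x \<in> B i}" if "i < n" for i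
    by (rule contraction_map_lift_conn[OF c b(1)[OF that] b(2)[OF that]])
  show "{x\<in>S. f x \<in> B i} \<inter> {x\<in>S. f x \<in> B j} = {}" if "i < j" "j < n" for i j
    using b(3)[of i j] that by auto
  show "doubly_adjacent E {x\<in>S. f x \<in> B i} {x\<in>S. f x \<in> B (Suc i)}" if i: "Suc i < n" for i
  proof -
    have lift: "\<exists>x y. (x, y) \<in> E \<inter> {x\<in>S. f x \<in> B i} \<times> {x\<in>S. f x \<in> B (Suc i)} \<and> f x = u \<and> f y = v"
      if uv: "(u, v) \<in> F \<inter> B i \<times> B (Suc i)" for u v
    proof -
      have "u \<in> W" "v \<in> W" using uv b(2)[of i] b(2)[OF i] i by auto
      then obtain x y where "x \<in> S" "y \<in> S" "(x, y) \<in> E" "f x = u" "f y = v"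
        using contraction_mapD(3)[OF c] uv by blast
      then show ?thesis using uv by blast
    qed
    obtain u v u' v' where uv: "(u, v) \<in> F \<inter> B i \<times> B (Suc i)" "(u', v') \<in> F \<inter> B i \<times> B (Suc i)"
      "(u, v) \<noteq> (u', v')"
      using b(4)[OF i] unfolding doubly_adjacent_def by auto
    obtain x y where 1: "(x, y) \<in> E \<inter> {x\<in>S. f x \<in> B i} \<times> {x\<in>S. f x \<in> B (Suc i)}" "f x = u" "f y = v"
      using lift[OF uv(1)] by blast
    obtain x' y' where 2: "(x', y') \<in> E \<inter> {x\<in>S. f x \<in> B i} \<times> {x\<in>S. f x \<in> B (Suc i)}" "f x' = u'" "f y' = v'"
      using lift[OF uv(2)] by blast
    have "(x, y) \<noteq> (x', y')" using 1(2,3) 2(2,3) uv(3) by auto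
    then show ?thesis unfolding doubly_adjacent_def using 1(1) 2(1) by blast
  qed
qed auto

text \<open>As all edges inside fibres are bridges, a bridge of the contraction would lift to a
  bridge of \<open>G\<close>, and that one would have been contracted.\<close>

lemma contract_bridges_bridgeless:
  assumes G: "pair_graph G" and uv: "(u, v) \<in> parcs (contract_bridges G)"
  shows "\<not> bridge_in (parcs (contract_bridges G)) u v"
proof
  note g = pair_graphD[OF G] and H = pair_graph_contract_bridges[OF G]
  note h = pair_graphD[OF H]
  let ?f = "contract_rep G (bridges G)"
  have c: "contraction_map ?f (parcs G) (pverts G) (parcs (contract_bridges G)) (pverts (contract_bridges G))"
    by (rule contraction_map_bridges[OF G])
  have sub: "bridges G \<subseteq> pverts G \<times> pverts G" using g(2) by (auto simp: bridges_def)
  have rep: "?f a = ?f b \<longleftrightarrow> (a, b) \<in> (bridges G)\<^sup>*" if "a \<in> pverts G" "b \<in> pverts G" for a b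
    using contract_rep(3)[OF sub sym_bridges[OF G] that] .
  assume br: "bridge_in (parcs (contract_bridges G)) u v"
  obtain x y where xy: "x \<in> pverts G" "y \<in> pverts G" "(x, y) \<in> parcs G" "?f x = u" "?f y = v"
    using contraction_mapD(3)[OF c, of u v] uv h(2) by blast
  have ne: "?f x \<noteq> ?f y" using xy uv h(4) by auto
  have "bridge_in (rs (parcs G) (pverts G)) x y"
  proof (rule bridge_lift[OF c g(3) h(3,2) _ _ ne])
    show "bridge_in (rs (parcs G) (pverts G)) a b"
      if "a \<in> pverts G" "b \<in> pverts G" "(a, b) \<in> parcs G" "?f a = ?f b" for a b
      using fibre_edge_bridge[OF G that(3)] rep[OF that(1,2)] that(4) unfolding g(5) by blast
  qed (use xy br in auto)
  then have "(x, y) \<in> bridges G" using xy(3) unfolding g(5) bridges_iff[OF G] by blast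
  then show False using rep[OF xy(1,2)] ne by auto
qed

section \<open>Bounding bridge-depth by the length of necklaces\<close>

lemma bridge_depth_empty: "pverts G = {} \<Longrightarrow> bridge_depth G = 0"
  by (subst bridge_depth.simps) simp

lemma bridge_depth_disconnected_le:
  assumes "pair_graph G" "\<not> connected (with_proj G)" "pverts G \<noteq> {}"
    "\<And>x. x \<in> pverts G \<Longrightarrow> bridge_depth (pinduce G (comp_of (parcs G) (pverts G) x)) \<le> c"
  shows "bridge_depth G \<le> c"
proof -
  have "bridge_depth G = Max ((\<lambda>C. bridge_depth (pinduce G C)) ` comp_of (parcs G) (pverts G) ` pverts G)"
    using assms(1-3) by (subst bridge_depth.simps) (auto simp: sccs_verts_pair_graph)
  also have "\<dots> \<le> c"
    using assms(3,4) pair_graphD(1)[OF assms(1)] by (subst Max_le_iff) auto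
  finally show ?thesis .
qed

lemma bridge_depth_connected_le:
  assumes "pair_graph G" "connected (with_proj G)" "v \<in> pverts (contract_bridges G)"
  shows "bridge_depth G \<le> Suc (bridge_depth (pdel_verts (contract_bridges G) {v}))"
proof -
  have "pverts G \<noteq> {}" using assms(3) by (auto simp: contract_bridges_def pcontract_def)
  moreover have "finite (pverts (contract_bridges G))"
    using pair_graphD(1)[OF pair_graph_contract_bridges[OF assms(1)]] .
  ultimately show ?thesis using assms by (simp add: bridge_depth_connected)
qed

lemma component_psubset:
  assumes "pair_graph G" "\<not> connected (with_proj G)" "x \<in> pverts G"
  shows "comp_of (parcs G) (pverts G) x \<subset> pverts G"
  by (rule sccs_verts_psubset[OF assms(1) _ assms(2)]) (simp add: sccs_verts_pair_graph[OF assms(1)] assms(3))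

text \<open>The vertices of \<open>Z\<close> are deleted one by one at the cost of one unit each.
  Every deletion comes after a contraction of bridges, so the rest of \<open>Z\<close> is carried
  along as its image; components are treated side by side with the same \<open>Z\<close>.\<close>

lemma bridge_depth_hitting_set:
  fixes G :: "'a pair_pre_digraph"
  assumes F: "\<And>G :: 'a pair_pre_digraph. pair_graph G \<Longrightarrow> \<nexists>B. necklace (parcs G) (pverts G) m B \<Longrightarrow> bridge_depth G \<le> F"
    and "pair_graph G" "finite Z" "\<And>B. necklace (parcs G) (pverts G) m B \<Longrightarrow> (\<Union>i<m. B i) \<inter> Z \<noteq> {}"
  shows "bridge_depth G \<le> card Z + F"
  using assms(2-)
proof (induction "card (pverts G)" arbitrary: G Z rule: less_induct)
  case less
  note G = less.prems(1) and Z = less.prems(2) and hit = less.prems(3)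
  note g = pair_graphD[OF G]
  consider "pverts G = {}" | "pverts G \<noteq> {}" "\<not> connected (with_proj G)"
    | "connected (with_proj G)" "Z \<inter> pverts G = {}" | z where "connected (with_proj G)" "z \<in> Z \<inter> pverts G"
    by blast
  then show ?case
  proof cases
    case 1
    then show ?thesis by (simp add: bridge_depth_empty)
  next
    case 2
    show ?thesis
    proof (rule bridge_depth_disconnected_le[OF G 2(2,1)])
      fix x assume x: "x \<in> pverts G"
      let ?C = "comp_of (parcs G) (pverts G) x"
      have C: "?C \<subset> pverts G" by (rule component_psubset[OF G 2(2) x])
      show "bridge_depth (pinduce G ?C) \<le> card Z + F"
      proof (rule less.hyps[OF _ pair_graph_pinduce[OF G] Z])
        show "card (pverts (pinduce G ?C)) < card (pverts G)" using C g(1) by (auto intro: psubset_card_mono)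
        show "?C \<subseteq> pverts G" using C by blast
        fix B assume "necklace (parcs (pinduce G ?C)) (pverts (pinduce G ?C)) m B"
        then have "necklace (parcs G) (pverts G) m B" by (rule necklace_mono) (use C in auto)
        then show "(\<Union>i<m. B i) \<inter> Z \<noteq> {}" by (rule hit)
      qed
    qed
  next
    case 3
    have "\<nexists>B. necklace (parcs G) (pverts G) m B"
    proof
      assume "\<exists>B. necklace (parcs G) (pverts G) m B"
      then obtain B where B: "necklace (parcs G) (pverts G) m B" ..
      have "(\<Union>i<m. B i) \<subseteq> pverts G" using necklaceD(2)[OF B] by blast
      then show False using hit[OF B] 3(2) by blast
    qed
    then show ?thesis using F[OF G] by simp
  next
    case (4 z)
    let ?H = "contract_bridges G" and ?f = "contract_rep G (bridges G)"
    define v where "v = ?f z"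
    have c: "contraction_map ?f (parcs G) (pverts G) (parcs ?H) (pverts ?H)"
      by (rule contraction_map_bridges[OF G])
    have v: "v \<in> pverts ?H" using contraction_mapD(1)[OF c] 4(2) unfolding v_def by blast
    let ?K = "pdel_verts ?H {v}"
    define Z' where "Z' = ?f ` (Z - {z})"
    have "bridge_depth ?K \<le> card Z' + F"
    proof (rule less.hyps[OF card_contract_bridges_del[OF G v] pair_graph_pdel_verts[OF pair_graph_contract_bridges[OF G]]])
      show "finite Z'" using Z by (simp add: Z'_def)
      fix B assume B: "necklace (parcs ?K) (pverts ?K) m B"
      define S where "S = {x\<in>pverts G. ?f x \<in> pverts ?H - {v}}"
      have cK: "contraction_map ?f (parcs G) S (parcs ?K) (pverts ?K)"
        using contraction_map_restrict[OF c, of "pverts ?H - {v}"] unfolding S_def by (simp add: pdel_verts_def)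
      \<comment> \<open>The lifted necklace avoids the whole fibre of \<open>z\<close>, so
        \<open>Z\<close> has to hit it in another vertex.\<close>
      have "necklace (parcs G) (pverts G) m (\<lambda>i. {x\<in>S. ?f x \<in> B i})"
        by (rule necklace_mono[OF contraction_map_lift_necklace[OF cK B]]) (auto simp: S_def)
      then obtain x i where xi: "i < m" "x \<in> S" "?f x \<in> B i" "x \<in> Z" using hit by blast
      have "x \<noteq> z" using xi(2) unfolding S_def v_def by blast
      then have "?f x \<in> Z'" using xi(4) unfolding Z'_def by blast
      then show "(\<Union>i<m. B i) \<inter> Z' \<noteq> {}" using xi(1,3) by blast
    qed
    moreover have "Suc (card Z') \<le> card Z"
    proof -
      have "card Z' \<le> card (Z - {z})" unfolding Z'_def using Z by (intro card_image_le) simp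
      then show ?thesis using 4(2) Z card_Suc_Diff1[of Z z] by auto
    qed
    ultimately show ?thesis using bridge_depth_connected_le[OF G 4(1) v] by linarith
  qed
qed

text \<open>The bound grows from \<open>F\<close> to \<open>Suc (k + F)\<close>: \<open>k\<close>
  for a set hitting all necklaces of length \<open>m\<close> in the bridge contraction, and one for
  the vertex given up on passing to that contraction.\<close>

theorem bridge_depth_bounded_of_no_necklace:
  "\<exists>F. \<forall>G :: 'a pair_pre_digraph. pair_graph G \<longrightarrow> (\<nexists>B. necklace (parcs G) (pverts G) m B) \<longrightarrow> bridge_depth G \<le> F"
proof (induction m)
  case 0
  then show ?case by (auto simp: necklace_def)
next
  case (Suc m)
  then obtain F where F: "\<And>G :: 'a pair_pre_digraph. pair_graph G \<Longrightarrow> \<nexists>B. necklace (parcs G) (pverts G) m B \<Longrightarrow> bridge_depth G \<le> F"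
    by blast
  obtain k where k: "\<forall>(E :: 'a rel) V \<N>. finite V \<longrightarrow> sym E \<longrightarrow> conn_on E V \<longrightarrow> (\<forall>N\<in>\<N>. conn_on E N \<and> N \<subseteq> V)
     \<longrightarrow> (\<forall>N\<in>\<N>. \<forall>M\<in>\<N>. N \<inter> M \<noteq> {}) \<longrightarrow> (\<nexists>B. necklace E V (Suc m) B)
     \<longrightarrow> (\<exists>Z. finite Z \<and> card Z \<le> k \<and> (\<forall>N\<in>\<N>. N \<inter> Z \<noteq> {}))"
    using intersecting_family_hitting_set[of "Suc m"] ..
  have conn: "bridge_depth G \<le> Suc (k + F)"
    if G: "pair_graph G" and cG: "connected (with_proj G)" and no: "\<nexists>B. necklace (parcs G) (pverts G) (Suc m) B"
    for G :: "'a pair_pre_digraph"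
  proof -
    let ?H = "contract_bridges G" and ?f = "contract_rep G (bridges G)"
    have c: "contraction_map ?f (parcs G) (pverts G) (parcs ?H) (pverts ?H)"
      by (rule contraction_map_bridges[OF G])
    note H = pair_graph_contract_bridges[OF G]
    note h = pair_graphD[OF H]
    have cH: "conn_on (parcs ?H) (pverts ?H)"
      using contraction_map_conn[OF c _ subset_refl] cG
      unfolding connected_iff_conn_on[OF G] contraction_mapD(1)[OF c] by blast
    have noH: "\<nexists>B. necklace (parcs ?H) (pverts ?H) (Suc m) B"
      using contraction_map_lift_necklace[OF c] no by blast
    \<comment> \<open>The recursion passes from \<open>G\<close> to its contraction only by deleting
      a vertex, so an arbitrary one is given up.\<close>
    obtain v where v: "v \<in> pverts ?H" using conn_on_nonempty[OF cH] by blast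
    \<comment> \<open>A single vertex is a necklace of length 1, so a nonempty graph cannot exclude
      that length.\<close>
    have m: "m \<ge> 1"
    proof (rule ccontr)
      assume "\<not> m \<ge> 1"
      then have "necklace (parcs ?H) (pverts ?H) (Suc m) (\<lambda>_. {v})" using v by (simp add: necklace_def)
      then show False using noH by blast
    qed
    define \<N> where "\<N> = {\<Union>i<m. B i | B. necklace (parcs ?H) (pverts ?H) m B}"
    have "\<exists>Z. finite Z \<and> card Z \<le> k \<and> (\<forall>N\<in>\<N>. N \<inter> Z \<noteq> {})"
    proof (rule k[rule_format, OF h(1,3) cH _ _ noH])
      fix N assume "N \<in> \<N>"
      then obtain B where B: "N = (\<Union>i<m. B i)" "necklace (parcs ?H) (pverts ?H) m B" unfolding \<N>_def by blast
      obtain m' where m': "m = Suc m'" using m by (cases m) auto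
      have "conn_on (parcs ?H) N" using conn_on_necklace[OF h(3)] B unfolding m' by blast
      moreover have "N \<subseteq> pverts ?H" using necklaceD(2)[OF B(2)] B(1) by blast
      ultimately show "conn_on (parcs ?H) N \<and> N \<subseteq> pverts ?H" ..
      fix M assume "M \<in> \<N>"
      then obtain C where C: "M = (\<Union>i<m. C i)" "necklace (parcs ?H) (pverts ?H) m C" unfolding \<N>_def by blast
      show "N \<inter> M \<noteq> {}" unfolding B(1) C(1)
        by (rule longest_necklaces_intersect[OF h(3,2) cH _ B(2) C(2) m noH])
           (rule contract_bridges_bridgeless[OF G])
    qed
    then obtain Z where Z: "finite Z" "card Z \<le> k" "\<forall>N\<in>\<N>. N \<inter> Z \<noteq> {}" by blast
    have "bridge_depth (pdel_verts ?H {v}) \<le> card Z + F"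
    proof (rule bridge_depth_hitting_set[OF F pair_graph_pdel_verts[OF H] Z(1)])
      fix B assume "necklace (parcs (pdel_verts ?H {v})) (pverts (pdel_verts ?H {v})) m B"
      then have "necklace (parcs ?H) (pverts ?H) m B"
        by (rule necklace_mono) (auto simp: pdel_verts_def)
      then show "(\<Union>i<m. B i) \<inter> Z \<noteq> {}" using Z(3) unfolding \<N>_def by blast
    qed
    then show ?thesis using bridge_depth_connected_le[OF G cG v] Z(2) by linarith
  qed
  have "bridge_depth G \<le> Suc (k + F)"
    if G: "pair_graph G" and no: "\<nexists>B. necklace (parcs G) (pverts G) (Suc m) B" for G :: "'a pair_pre_digraph"
  proof -
    consider "pverts G = {}" | "connected (with_proj G)" | "pverts G \<noteq> {}" "\<not> connected (with_proj G)" by blast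
    then show ?thesis
    proof cases
      case 1
      then show ?thesis by (simp add: bridge_depth_empty)
    next
      case 2
      then show ?thesis using conn[OF G _ no] by blast
    next
      case 3
      show ?thesis
      proof (rule bridge_depth_disconnected_le[OF G 3(2,1)])
        fix x assume x: "x \<in> pverts G"
        let ?C = "comp_of (parcs G) (pverts G) x"
        have C: "?C \<subseteq> pverts G" using component_psubset[OF G 3(2) x] by blast
        have pg: "pair_graph (pinduce G ?C)" by (rule pair_graph_pinduce[OF G C])
        have "conn_on (parcs G) ?C" by (rule comp_of_conn[OF pair_graphD(3)[OF G] x])
        moreover have "rs (parcs (pinduce G ?C)) ?C = rs (parcs G) ?C" by auto
        ultimately have cc: "connected (with_proj (pinduce G ?C))"
          unfolding connected_iff_conn_on[OF pg] by (simp add: conn_on_def)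
        have "\<nexists>B. necklace (parcs (pinduce G ?C)) (pverts (pinduce G ?C)) (Suc m) B"
        proof
          assume "\<exists>B. necklace (parcs (pinduce G ?C)) (pverts (pinduce G ?C)) (Suc m) B"
          then obtain B where "necklace (parcs (pinduce G ?C)) (pverts (pinduce G ?C)) (Suc m) B" ..
          then have "necklace (parcs G) (pverts G) (Suc m) B" by (rule necklace_mono) (use C in auto)
          then show False using no by blast
        qed
        then show "bridge_depth (pinduce G ?C) \<le> Suc (k + F)" by (rule conn[OF pg cc])
      qed
    qed
  qed
  then show ?case by blast
qed

section \<open>Minors\<close>

lemma graph_minor_trans: "graph_minor H K \<Longrightarrow> graph_minor K G \<Longrightarrow> graph_minor H G"
  by (induction rule: graph_minor.induct) (auto intro: graph_minor.intros)

lemma digraph_iso_image: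
  assumes G: "pair_graph G" and inj: "inj_on f (pverts G)"
    and V: "pverts H = f ` pverts G" and A: "parcs H = map_prod f f ` parcs G"
  shows "digraph_iso (with_proj G) (with_proj H)"
proof -
  note g = pair_graphD[OF G]
  interpret pair_graph G by fact
  let ?h = "\<lparr>iso_verts = f, iso_arcs = map_prod f f, iso_head = snd, iso_tail = fst\<rparr>"
  have "inj_on (map_prod f f) (parcs G)"
    by (rule inj_on_subset[OF map_prod_inj_on[OF inj inj] g(2)])
  then have "pre_digraph.digraph_isomorphism (with_proj G) ?h"
    using inj wf_digraph_axioms by (simp add: pre_digraph.digraph_isomorphism_def)
  moreover have "with_proj H = app_iso ?h (with_proj G)"
    by (simp add: with_proj_def app_iso_def V A)
  ultimately show ?thesis unfolding digraph_iso_def by blast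
qed

lemma rtrancl_single_edge:
  assumes "(a, b) \<in> {(p, q), (q, p)}\<^sup>*"
  shows "a = b \<or> {a, b} = {p, q}"
  using assms by (induction rule: rtrancl_induct) auto

lemma conn_on_cong: "rs E A = rs F A \<Longrightarrow> conn_on E A \<longleftrightarrow> conn_on F A"
  by (simp add: conn_on_def)

text \<open>Branch sets determine a minor: vertices outside all of them are deleted and edges inside
  one are contracted. Once the branch sets are single vertices covering \<open>G\<close>, surplus
  edges are deleted until \<open>G\<close> is a copy of \<open>H\<close>.\<close>

lemma minor_of_model:
  assumes "pair_graph G" and H: "pair_graph H"
    and "\<And>u. u \<in> pverts H \<Longrightarrow> conn_on (parcs G) (\<phi> u)" "\<And>u. u \<in> pverts H \<Longrightarrow> \<phi> u \<subseteq> pverts G"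
    and "\<And>u v. u \<in> pverts H \<Longrightarrow> v \<in> pverts H \<Longrightarrow> u \<noteq> v \<Longrightarrow> \<phi> u \<inter> \<phi> v = {}"
    and "\<And>u v. (u, v) \<in> parcs H \<Longrightarrow> \<exists>x\<in>\<phi> u. \<exists>y\<in>\<phi> v. (x, y) \<in> parcs G"
  shows "graph_minor H G"
  using assms(1,3-)
proof (induction "card (pverts G) + card (parcs G)" arbitrary: G \<phi> rule: less_induct)
  case less
  note G = less.prems(1) and con = less.prems(2) and sub = less.prems(3)
    and disj = less.prems(4) and arc = less.prems(5)
  note g = pair_graphD[OF G] and h = pair_graphD[OF H]
  have finE: "finite (parcs G)" using finite_subset[OF g(2)] g(1) by simp
  consider w where "w \<in> pverts G" "\<And>u. u \<in> pverts H \<Longrightarrow> w \<notin> \<phi> u"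
    | u x y where "u \<in> pverts H" "x \<in> \<phi> u" "y \<in> \<phi> u" "x \<noteq> y"
    | "\<And>u x y. u \<in> pverts H \<Longrightarrow> x \<in> \<phi> u \<Longrightarrow> y \<in> \<phi> u \<Longrightarrow> x = y"
      "\<And>w. w \<in> pverts G \<Longrightarrow> \<exists>u\<in>pverts H. w \<in> \<phi> u"
    by blast
  then show ?case
  proof cases
    case (1 w)
    let ?K = "pdel_verts G {w}"
    have K: "parcs ?K = rs (parcs G) (pverts G - {w})" by (simp add: pdel_verts_def)
    have sub': "\<phi> u \<subseteq> pverts G - {w}" if "u \<in> pverts H" for u using sub[OF that] 1(2)[OF that] by blast
    have "graph_minor H ?K"
    proof (rule less.hyps[OF _ pair_graph_pdel_verts[OF G]])
      have "card (pverts ?K) < card (pverts G)" unfolding pverts_pdel_verts by (rule card_Diff1_less[OF g(1) 1(1)])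
      moreover have "card (parcs ?K) \<le> card (parcs G)" unfolding K by (intro card_mono finE) auto
      ultimately show "card (pverts ?K) + card (parcs ?K) < card (pverts G) + card (parcs G)" by linarith
      show "conn_on (parcs ?K) (\<phi> u)" if u: "u \<in> pverts H" for u
      proof -
        have "rs (parcs ?K) (\<phi> u) = rs (parcs G) (\<phi> u)" unfolding K using sub'[OF u] by auto
        then show ?thesis using con[OF u] conn_on_cong by metis
      qed
      show "\<phi> u \<subseteq> pverts ?K" if "u \<in> pverts H" for u using sub'[OF that] by simp
      show "\<phi> u \<inter> \<phi> v = {}" if "u \<in> pverts H" "v \<in> pverts H" "u \<noteq> v" for u v using disj[OF that] .
      show "\<exists>x\<in>\<phi> u. \<exists>y\<in>\<phi> v. (x, y) \<in> parcs ?K" if uv: "(u, v) \<in> parcs H" for u v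
      proof -
        have "u \<in> pverts H" "v \<in> pverts H" using uv h(2) by auto
        then show ?thesis using arc[OF uv] sub' unfolding K by blast
      qed
    qed
    moreover have "graph_minor ?K G" by (rule graph_minor.del_vert[OF graph_minor.refl 1(1)])
    ultimately show ?thesis by (rule graph_minor_trans)
  next
    case (2 u x0 y0)
    have "(x0, y0) \<in> (rs (parcs G) (\<phi> u))\<^sup>*" using conn_onD[OF con[OF 2(1)] 2(2,3)] .
    then obtain x y where xy: "(x, y) \<in> rs (parcs G) (\<phi> u)"
      using 2(4) by (metis converse_rtranclE)
    let ?B = "{(x, y), (y, x)}"
    let ?K = "pcontract G ?B" and ?f = "contract_rep G ?B"
    have B: "?B \<subseteq> parcs G" "sym ?B" using xy g(3) by (auto simp: sym_def)
    have c: "contraction_map ?f (parcs G) (pverts G) (parcs ?K) (pverts ?K)"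
      by (rule contraction_map_pcontract[OF G B])
    have BV: "?B \<subseteq> pverts G \<times> pverts G" using B(1) g(2) by blast
    have xyV: "x \<in> pverts G" "y \<in> pverts G" "x \<noteq> y" using BV xy g(4) by auto
    have rep: "?f a = ?f b \<Longrightarrow> a = b \<or> {a, b} = {x, y}" if "a \<in> pverts G" "b \<in> pverts G" for a b
      using contract_rep(3)[OF BV B(2) that] rtrancl_single_edge[of a b x y] by blast
    have fxy: "?f x = ?f y" using contract_rep(3)[OF BV B(2) xyV(1,2)] by auto
    have disj': "?f ` \<phi> v \<inter> ?f ` \<phi> w = {}" if vw: "v \<in> pverts H" "w \<in> pverts H" "v \<noteq> w" for v w
    proof (rule ccontr)
      assume "?f ` \<phi> v \<inter> ?f ` \<phi> w \<noteq> {}"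
      then obtain a b where ab: "a \<in> \<phi> v" "b \<in> \<phi> w" "?f a = ?f b" by auto
      have "a = b \<or> {a, b} = {x, y}" using rep[OF _ _ ab(3)] ab(1,2) sub vw by blast
      then show False
      proof
        assume "a = b" then show False using ab disj[OF vw] by auto
      next
        assume "{a, b} = {x, y}"
        then have "a \<in> \<phi> u" "b \<in> \<phi> u" using xy by (auto simp: doubleton_eq_iff)
        then have "v = u" "w = u" using disj[OF vw(1) 2(1)] disj[OF vw(2) 2(1)] ab by auto
        then show False using vw by simp
      qed
    qed
    have "graph_minor H ?K"
    proof (rule less.hyps[where \<phi> = "\<lambda>w. ?f ` \<phi> w", OF _ pair_graph_pcontract[OF G]])
      have "\<not> inj_on ?f (pverts G)" using fxy xyV by (auto dest: inj_onD)
      then have "card (?f ` pverts G) < card (pverts G)"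
        using card_image_le[OF g(1), of ?f] eq_card_imp_inj_on[OF g(1), of ?f] by linarith
      then have "card (pverts ?K) < card (pverts G)" by (simp add: pcontract_def)
      moreover have "card (parcs ?K) \<le> card (parcs G)"
      proof -
        have "parcs ?K \<subseteq> map_prod ?f ?f ` parcs G" by (auto simp: pcontract_def)
        then have "card (parcs ?K) \<le> card (map_prod ?f ?f ` parcs G)" using finE by (intro card_mono) auto
        also have "\<dots> \<le> card (parcs G)" by (rule card_image_le[OF finE])
        finally show ?thesis .
      qed
      ultimately show "card (pverts ?K) + card (parcs ?K) < card (pverts G) + card (parcs G)" by linarith
      show "conn_on (parcs ?K) (?f ` \<phi> v)" if "v \<in> pverts H" for v
        by (rule contraction_map_conn[OF c con[OF that] sub[OF that]])
      show "?f ` \<phi> v \<subseteq> pverts ?K" if "v \<in> pverts H" for v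
        using contraction_mapD(1)[OF c] sub[OF that] by blast
      show "?f ` \<phi> v \<inter> ?f ` \<phi> w = {}" if "v \<in> pverts H" "w \<in> pverts H" "v \<noteq> w" for v w
        by (rule disj'[OF that])
      show "\<exists>x\<in>?f ` \<phi> v. \<exists>y\<in>?f ` \<phi> w. (x, y) \<in> parcs ?K" if vw: "(v, w) \<in> parcs H" for v w
      proof -
        have vw': "v \<in> pverts H" "w \<in> pverts H" "v \<noteq> w" using vw h(2,4) by auto
        obtain a b where ab: "a \<in> \<phi> v" "b \<in> \<phi> w" "(a, b) \<in> parcs G" using arc[OF vw] by blast
        have "?f a \<noteq> ?f b" using disj'[OF vw'] ab by blast
        then have "(?f a, ?f b) \<in> parcs ?K"
          using contraction_mapD(2)[OF c _ _ ab(3)] sub[OF vw'(1)] sub[OF vw'(2)] ab by blast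
        then show ?thesis using ab by blast
      qed
    qed
    moreover have "graph_minor ?K G"
      by (rule graph_minor.contract_edge[OF graph_minor.refl]) (use xy in auto)
    ultimately show ?thesis by (rule graph_minor_trans)
  next
    case 3
    define f where "f u = (SOME x. x \<in> \<phi> u)" for u
    have f: "\<phi> u = {f u}" if u: "u \<in> pverts H" for u
    proof -
      have "f u \<in> \<phi> u" unfolding f_def using conn_on_nonempty[OF con[OF u]] by (simp add: some_in_eq)
      then show ?thesis using 3(1)[OF u] by auto
    qed
    have V: "pverts G = f ` pverts H"
    proof
      show "pverts G \<subseteq> f ` pverts H" using 3(2) f by fastforce
      show "f ` pverts H \<subseteq> pverts G" using sub f by fastforce
    qed
    have inj: "inj_on f (pverts H)"
    proof (rule inj_onI)
      fix u v assume "u \<in> pverts H" "v \<in> pverts H" "f u = f v"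
      then show "u = v" using disj[of u v] f by auto
    qed
    have sub_arc: "map_prod f f ` parcs H \<subseteq> parcs G"
    proof clarsimp
      fix u v assume uv: "(u, v) \<in> parcs H"
      then have "u \<in> pverts H" "v \<in> pverts H" using h(2) by auto
      then show "(f u, f v) \<in> parcs G" using arc[OF uv] f by auto
    qed
    show ?thesis
    proof (cases "parcs G = map_prod f f ` parcs H")
      case True
      let ?k = "the_inv_into (pverts H) f"
      have kf: "?k (f u) = u" if "u \<in> pverts H" for u using the_inv_into_f_f[OF inj that] .
      have "digraph_iso (with_proj G) (with_proj H)"
      proof (rule digraph_iso_image[OF G, of ?k])
        show "inj_on ?k (pverts G)" unfolding V by (rule inj_on_the_inv_into[OF inj])
        show "pverts H = ?k ` pverts G" unfolding V image_image using kf by simp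
        have "map_prod ?k ?k (map_prod f f e) = e" if "e \<in> parcs H" for e
          using that h(2) kf by (cases e) auto
        then show "parcs H = map_prod ?k ?k ` parcs G" unfolding True image_image by simp
      qed
      then show ?thesis by (rule graph_minor.iso[OF graph_minor.refl])
    next
      case False
      then obtain x y where xy: "(x, y) \<in> parcs G" "(x, y) \<notin> map_prod f f ` parcs H" using sub_arc by auto
      then have yx: "(y, x) \<notin> map_prod f f ` parcs H" using h(3) by (auto dest: symD)
      let ?K = "pdel_edge G x y"
      have K: "parcs ?K = parcs G - {(x, y), (y, x)}" "pverts ?K = pverts G" by (simp_all add: pdel_edge_def)
      have "graph_minor H ?K"
      proof (rule less.hyps[OF _ pair_graph_pdel_edge[OF G]])
        have "card (parcs ?K) < card (parcs G)" unfolding K using xy finE by (intro psubset_card_mono) auto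
        then show "card (pverts ?K) + card (parcs ?K) < card (pverts G) + card (parcs G)" by (simp add: K(2))
        show "conn_on (parcs ?K) (\<phi> u)" if "u \<in> pverts H" for u unfolding f[OF that] by simp
        show "\<phi> u \<subseteq> pverts ?K" if "u \<in> pverts H" for u using sub[OF that] K(2) by simp
        show "\<phi> u \<inter> \<phi> v = {}" if "u \<in> pverts H" "v \<in> pverts H" "u \<noteq> v" for u v using disj[OF that] .
        show "\<exists>a\<in>\<phi> u. \<exists>b\<in>\<phi> v. (a, b) \<in> parcs ?K" if uv: "(u, v) \<in> parcs H" for u v
        proof -
          have "u \<in> pverts H" "v \<in> pverts H" using uv h(2) by auto
          moreover have "(f u, f v) \<in> map_prod f f ` parcs H" using uv by force
          then have "(f u, f v) \<in> parcs ?K" using sub_arc xy yx K(1) by auto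
          ultimately show ?thesis using f by auto
        qed
      qed
      moreover have "graph_minor ?K G" by (rule graph_minor.del_edge[OF graph_minor.refl xy(1)])
      ultimately show ?thesis by (rule graph_minor_trans)
    qed
  qed
qed

text \<open>\<open>Q\<close> is the component of \<open>y\<close> in \<open>B - {x}\<close>; the
  remainder stays connected through \<open>x\<close>.\<close>

lemma conn_on_split:
  assumes "sym E" "conn_on E B" "x \<in> B" "y \<in> B" "x \<noteq> y"
  obtains P Q where "P \<union> Q = B" "P \<inter> Q = {}" "conn_on E P" "conn_on E Q" "x \<in> P" "y \<in> Q"
    "\<exists>p\<in>P. \<exists>q\<in>Q. (p, q) \<in> E"
proof -
  let ?Q = "comp_of E (B - {x}) y"
  have yB: "y \<in> B - {x}" using assms by auto
  have Q: "?Q \<subseteq> B - {x}" by (rule comp_of_subset[OF yB])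
  obtain w where "w \<in> ?Q" "(x, w) \<in> E"
    using conn_on_del_vertex_adj[OF assms(1,2,3,4)] assms(5) by metis
  then show thesis
    using that[of "B - ?Q" ?Q] Q assms(3) comp_of_conn[OF assms(1) yB]
      conn_on_Diff_comp[OF assms(1,2,3,4)] assms(5) by auto
qed

definition linked_to :: "'a rel \<Rightarrow> 'a set \<Rightarrow> 'a set \<Rightarrow> bool" where
  "linked_to E A B \<longleftrightarrow> (\<exists>a\<in>A. \<exists>b\<in>B. (a, b) \<in> E)"

lemma linked_to_sym: "sym E \<Longrightarrow> linked_to E A B \<Longrightarrow> linked_to E B A"
  unfolding linked_to_def by (meson symD)

text \<open>Two distinct edges differ at an end in \<open>B\<close> or in \<open>C\<close>;
  splitting that bag between the differing ends gives three pairwise adjacent sets. \<open>z\<close>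
  and \<open>z'\<close> are the places where neighbouring triangles attach, so the sets are ordered
  to have these in \<open>U\<close> and \<open>X\<close>.\<close>

lemma triangle_of_double_edge:
  assumes E: "sym E" and B: "conn_on E B" and C: "conn_on E C" and "B \<inter> C = {}"
    and "doubly_adjacent E B C" and z: "z \<in> B" "z' \<in> C"
  shows "\<exists>U W X. U \<union> W \<union> X \<subseteq> B \<union> C \<and> conn_on E U \<and> conn_on E W \<and> conn_on E X
    \<and> U \<inter> W = {} \<and> W \<inter> X = {} \<and> U \<inter> X = {}
    \<and> linked_to E U W \<and> linked_to E W X \<and> linked_to E U X \<and> z \<in> U \<and> z' \<in> X"
proof -
  obtain x c y d where e: "(x, c) \<in> E" "x \<in> B" "c \<in> C" "(y, d) \<in> E" "y \<in> B" "d \<in> C" "(x, c) \<noteq> (y, d)"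
    using assms(5) unfolding doubly_adjacent_def by auto
  show ?thesis
  proof (cases "x = y")
    case False
    obtain P Q where PQ: "P \<union> Q = B" "P \<inter> Q = {}" "conn_on E P" "conn_on E Q" "x \<in> P" "y \<in> Q"
      "\<exists>p\<in>P. \<exists>q\<in>Q. (p, q) \<in> E"
      using conn_on_split[OF E B e(2,5) False] .
    have l: "linked_to E P Q" "linked_to E P C" "linked_to E Q C"
      using PQ e unfolding linked_to_def by blast+
    have d: "P \<inter> C = {}" "Q \<inter> C = {}" using PQ(1) assms(4) by blast+
    show ?thesis
    proof (cases "z \<in> P")
      case True
      then show ?thesis using PQ(1-4) l d C z
        by (intro exI[of _ P] exI[of _ Q] exI[of _ C]) auto
    next
      case False
      then show ?thesis using PQ(1-4) l d C z linked_to_sym[OF E l(1)]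
        by (intro exI[of _ Q] exI[of _ P] exI[of _ C]) auto
    qed
  next
    case True
    then have "c \<noteq> d" using e by simp
    obtain P Q where PQ: "P \<union> Q = C" "P \<inter> Q = {}" "conn_on E P" "conn_on E Q" "c \<in> P" "d \<in> Q"
      "\<exists>p\<in>P. \<exists>q\<in>Q. (p, q) \<in> E"
      using conn_on_split[OF E C e(3,6) \<open>c \<noteq> d\<close>] .
    have l: "linked_to E P Q" "linked_to E B P" "linked_to E B Q"
      using PQ e unfolding linked_to_def by blast+
    have d: "B \<inter> P = {}" "B \<inter> Q = {}" using PQ(1) assms(4) by blast+
    show ?thesis
    proof (cases "z' \<in> P")
      case True
      then show ?thesis using PQ(1-4) l d B z linked_to_sym[OF E l(1)]
        by (intro exI[of _ B] exI[of _ Q] exI[of _ P]) auto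
    next
      case False
      then show ?thesis using PQ(1-4) l d B z
        by (intro exI[of _ B] exI[of _ P] exI[of _ Q]) auto
    qed
  qed
qed

section \<open>Triangle paths\<close>

text \<open>The triangle path: triangles on \<open>3i, 3i + 1, 3i + 2\<close>, and \<open>3i + 2\<close> is joined to \<open>3i + 3\<close>.\<close>

definition triangle_path_next :: "nat \<Rightarrow> nat \<Rightarrow> bool" where
  "triangle_path_next m n \<longleftrightarrow> n = Suc m \<or> m mod 3 = 0 \<and> n = Suc (Suc m)"

definition triangle_path_arcs :: "nat rel" where
  "triangle_path_arcs = {(m, n). triangle_path_next m n \<or> triangle_path_next n m}"

lemma sym_triangle_path_arcs: "sym triangle_path_arcs"
  by (auto simp: triangle_path_arcs_def sym_def)

lemma div_mod_3_cases:
  fixes m :: nat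
  obtains q where "m = 3 * q" "m div 3 = q" "m mod 3 = 0"
  | q where "m = 3 * q + 1" "m div 3 = q" "m mod 3 = 1"
  | q where "m = 3 * q + 2" "m div 3 = q" "m mod 3 = 2"
proof -
  have m: "m = 3 * (m div 3) + m mod 3" by simp
  have "m mod 3 = 0 \<or> m mod 3 = 1 \<or> m mod 3 = 2" by linarith
  then show thesis
  proof (elim disjE)
    assume r: "m mod 3 = 0"
    show thesis by (rule that(1)[OF _ HOL.refl r]) (use m r in linarith)
  next
    assume r: "m mod 3 = 1"
    show thesis by (rule that(2)[OF _ HOL.refl r]) (use m r in linarith)
  next
    assume r: "m mod 3 = 2"
    show thesis by (rule that(3)[OF _ HOL.refl r]) (use m r in linarith)
  qed
qed

lemma same_triangle_arc:
  assumes "m div 3 = n div 3" "m \<noteq> n"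
  shows "(m, n) \<in> triangle_path_arcs"
  using assms unfolding triangle_path_arcs_def triangle_path_next_def
  by (cases m rule: div_mod_3_cases; cases n rule: div_mod_3_cases) simp_all

lemma triangle_path_next_div:
  assumes "triangle_path_next a b" "a div 3 \<noteq> b div 3"
  shows "b div 3 = Suc (a div 3) \<and> a = 3 * (a div 3) + 2 \<and> b = 3 * (b div 3)"
proof (cases a rule: div_mod_3_cases)
  case (1 q)
  then have "b = 3 * q + 1 \<or> b = 3 * q + 2" using assms(1) by (auto simp: triangle_path_next_def)
  then have "b div 3 = q" by linarith
  then show ?thesis using assms(2) 1 by simp
next
  case (2 q)
  then have "b = 3 * q + 2" using assms(1) by (auto simp: triangle_path_next_def)
  then have "b div 3 = q" by linarith
  then show ?thesis using assms(2) 2 by simp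
next
  case (3 q)
  then have b: "b = 3 * q + 3" using assms(1) by (auto simp: triangle_path_next_def)
  then have "b div 3 = Suc q" by linarith
  then show ?thesis using 3 b by simp
qed

text \<open>For \<open>t \<ge> 1\<close> these are the vertices of degree 2 in the triangle path on
  \<open>{..<3 * t}\<close>: the tips and the two ends.\<close>

definition triangle_path_block :: "nat \<Rightarrow> nat set" where
  "triangle_path_block t = insert 0 (insert (3 * t - 1) ((\<lambda>i. 3 * i + 1) ` {..<t}))"

text \<open>The \<open>t\<close> triangles cover the vertices by cliques, and an independent set
  takes at most one vertex from each.\<close>

lemma alpha_triangle_path_le:
  "alpha triangle_path_arcs {..<3 * t} \<le> t"
proof (rule alpha_le)
  fix I assume I: "I \<subseteq> {..<3 * t}" "independent_in triangle_path_arcs I"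
  have "inj_on (\<lambda>m. m div 3) I"
  proof (rule inj_onI, rule ccontr)
    fix m n assume mn: "m \<in> I" "n \<in> I" "m div 3 = n div 3" "m \<noteq> n"
    have "(m, n) \<in> triangle_path_arcs" by (rule same_triangle_arc[OF mn(3,4)])
    then show False using I(2) mn unfolding independent_in_def by blast
  qed
  then have "card I = card ((\<lambda>m. m div 3) ` I)" by (simp add: card_image)
  also have "\<dots> \<le> card {..<t}" using I(1) by (intro card_mono) auto
  finally show "card I \<le> t" by simp
qed simp

text \<open>What remains are the ends of the \<open>t - 1\<close> edges connecting consecutive
  triangles, numbered by \<open>(m + 1) div 3 - 1\<close>; an independent set takes at most one end
  of each.\<close>

lemma alpha_triangle_path_blocked:
  assumes "t \<ge> 1"
  shows "alpha triangle_path_arcs ({..<3 * t} - triangle_path_block t) \<le> t - 1"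
proof (rule alpha_le)
  fix I assume I: "I \<subseteq> {..<3 * t} - triangle_path_block t" "independent_in triangle_path_arcs I"
  have rng: "m < 3 * t" "m \<noteq> 0" "m \<noteq> 3 * t - 1" "m mod 3 \<noteq> 1" if "m \<in> I" for m
  proof -
    have m: "m \<in> {..<3 * t}" "m \<notin> triangle_path_block t" using I(1) that by auto
    then show "m < 3 * t" "m \<noteq> 0" "m \<noteq> 3 * t - 1" by (auto simp: triangle_path_block_def)
    show "m mod 3 \<noteq> 1"
    proof
      assume "m mod 3 = 1"
      then obtain q where q: "m = 3 * q + 1" by (cases m rule: div_mod_3_cases) auto
      then have "q < t" using m(1) by simp
      then show False using m(2) q unfolding triangle_path_block_def by blast
    qed
  qed
  have third: "\<exists>q. (m = 3 * q + 2 \<or> m = 3 * q + 3) \<and> (m + 1) div 3 - 1 = q"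
    if "m \<noteq> 0" "m mod 3 \<noteq> 1" for m :: nat
  proof (cases m rule: div_mod_3_cases)
    case (1 q)
    then show ?thesis using that by (intro exI[of _ "q - 1"]) auto
  next
    case (3 q)
    then show ?thesis by (intro exI[of _ q]) auto
  qed (use that in simp)
  have "inj_on (\<lambda>m. (m + 1) div 3 - 1) I"
  proof (rule inj_onI, rule ccontr)
    fix m n assume mn: "m \<in> I" "n \<in> I" "(m + 1) div 3 - 1 = (n + 1) div 3 - 1" "m \<noteq> n"
    obtain q where q: "m = 3 * q + 2 \<or> m = 3 * q + 3" "(m + 1) div 3 - 1 = q" using third rng(2,4)[OF mn(1)] by blast
    obtain q' where q': "n = 3 * q' + 2 \<or> n = 3 * q' + 3" "(n + 1) div 3 - 1 = q'" using third rng(2,4)[OF mn(2)] by blast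
    have "q = q'" using q(2) q'(2) mn(3) by simp
    then have "n = Suc m \<or> m = Suc n" using q(1) q'(1) mn(4) by auto
    then have "(m, n) \<in> triangle_path_arcs" unfolding triangle_path_arcs_def triangle_path_next_def by auto
    then show False using I(2) mn unfolding independent_in_def by blast
  qed
  then have "card I = card ((\<lambda>m. (m + 1) div 3 - 1) ` I)" by (simp add: card_image)
  also have "\<dots> \<le> card {..<t - 1}"
  proof (intro card_mono)
    show "(\<lambda>m. (m + 1) div 3 - 1) ` I \<subseteq> {..<t - 1}"
    proof (rule image_subsetI)
      fix m assume m: "m \<in> I"
      obtain q where q: "m = 3 * q + 2 \<or> m = 3 * q + 3" "(m + 1) div 3 - 1 = q" using third rng(2,4)[OF m] by blast
      have "q < t - 1" using q(1) rng(1,3)[OF m] by linarith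
      then show "(m + 1) div 3 - 1 \<in> {..<t - 1}" using q(2) by simp
    qed
  qed simp
  finally show "card I \<le> t - 1" by simp
qed simp

text \<open>With \<open>y\<close> kept, one vertex can be taken from each triangle: \<open>y\<close>
  from its own, the corner \<open>3 * j + 2\<close> from those before it and \<open>3 * j\<close>
  from those after it. Two of these could only be adjacent along a connecting edge with
  \<open>y\<close> as an end, but no vertex of the block is such an end.\<close>

lemma alpha_triangle_path_unblocked:
  assumes y: "y \<in> triangle_path_block t" and "t \<ge> 1"
  shows "alpha triangle_path_arcs ({..<3 * t} - (triangle_path_block t - {y})) \<ge> t"
proof -
  define i where "i = y div 3"
  define w where "w j = (if j < i then 3 * j + 2 else if j = i then y else 3 * j)" for j
  have yc: "y = 0 \<or> y = 3 * t - 1 \<or> y = 3 * i + 1 \<and> i < t"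
    using y unfolding triangle_path_block_def i_def by auto
  have it: "i < t" using yc \<open>t \<ge> 1\<close> unfolding i_def by auto
  have wdiv: "w j div 3 = j" for j
  proof -
    consider "j < i" | "j = i" | "i < j" by linarith
    then show ?thesis
    proof cases
      case 1
      then have "w j = 3 * j + 2" by (simp add: w_def)
      then show ?thesis by linarith
    qed (simp_all add: w_def i_def)
  qed
  have inj: "inj_on w {..<t}" by (rule inj_on_inverseI[of _ "\<lambda>m. m div 3"]) (rule wdiv)
  have w_lt: "w j < 3 * t" if "j < t" for j using that wdiv[of j] by linarith
  have w_un: "w j \<notin> triangle_path_block t - {y}" if "j < t" for j
  proof -
    consider "j < i" "w j = 3 * j + 2" | "w j = y" | "i < j" "w j = 3 * j" unfolding w_def by force
    then show ?thesis
    proof cases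
      case 1
      have "3 * j + 2 \<noteq> 3 * k + 1" for k :: nat by arith
      then show ?thesis using 1 it unfolding triangle_path_block_def by auto
    next
      case 3
      have "3 * j \<noteq> 3 * k + 1" for k :: nat by arith
      moreover have "3 * j \<noteq> 3 * t - 1" using it by arith
      ultimately show ?thesis using 3 unfolding triangle_path_block_def by auto
    qed simp
  qed
  have nadj: "\<not> triangle_path_next (w j) (w k)" if jk: "j < t" "k < t" for j k
  proof
    assume n: "triangle_path_next (w j) (w k)"
    have "j \<noteq> k" using n unfolding triangle_path_next_def by auto
    have "w j div 3 \<noteq> w k div 3" unfolding wdiv by (rule \<open>j \<noteq> k\<close>)
    from triangle_path_next_div[OF n this]
    have kk: "k = Suc j \<and> w j = 3 * j + 2 \<and> w k = 3 * k" unfolding wdiv .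
    have k: "k = Suc j" and wj: "w j = 3 * j + 2" and wk: "w k = 3 * k"
      using kk by blast+
    have "j \<le> i" using wj unfolding w_def by (cases "i < j") simp_all
    moreover have "i \<le> k" using wk unfolding w_def by (cases "k < i") simp_all
    ultimately consider "i = j" | "i = k" using k by linarith
    then show False
    proof cases
      case 1
      then have "y = 3 * j + 2" using wj by (simp add: w_def)
      then show False using yc jk k 1 by linarith
    next
      case 2
      then have "y = 3 * k" using wk by (simp add: w_def)
      then show False using yc jk k 2 by linarith
    qed
  qed
  have "independent_in triangle_path_arcs (w ` {..<t})"
    using nadj unfolding independent_in_def triangle_path_arcs_def by auto
  moreover have "w ` {..<t} \<subseteq> {..<3 * t} - (triangle_path_block t - {y})" using w_lt w_un by auto
  ultimately have "card (w ` {..<t}) \<le> alpha triangle_path_arcs ({..<3 * t} - (triangle_path_block t - {y}))"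
    by (intro alpha_ge) auto
  then show ?thesis by (simp add: card_image[OF inj])
qed

lemma card_triangle_path_block:
  assumes "t \<ge> 1"
  shows "card (triangle_path_block t) = t + 2"
proof -
  have 1: "3 * t - 1 \<notin> (\<lambda>i. 3 * i + 1) ` {..<t}" using assms by auto
  have 2: "0 \<notin> insert (3 * t - 1) ((\<lambda>i. 3 * i + 1) ` {..<t})" using assms by auto
  have "card ((\<lambda>i::nat. 3 * i + 1) ` {..<t}) = t" by (subst card_image) (auto simp: inj_on_def)
  then show ?thesis unfolding triangle_path_block_def using 1 2 by simp
qed

lemma triangle_path_block_subset: "t \<ge> 1 \<Longrightarrow> triangle_path_block t \<subseteq> {..<3 * t}"
  unfolding triangle_path_block_def by auto

lemma alpha_image:
  assumes inj: "inj_on g S" and T: "T \<subseteq> S" "finite T"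
  shows "alpha (map_prod g g ` rs A S) (g ` T) = alpha A T"
proof (rule antisym)
  have arc: "(g m, g n) \<in> map_prod g g ` rs A S \<longleftrightarrow> (m, n) \<in> A" if "m \<in> S" "n \<in> S" for m n
    using that inj_onD[OF inj] by auto
  show "alpha (map_prod g g ` rs A S) (g ` T) \<le> alpha A T"
  proof (rule alpha_le)
    fix I assume I: "I \<subseteq> g ` T" "independent_in (map_prod g g ` rs A S) I"
    define J where "J = {m\<in>T. g m \<in> I}"
    have IJ: "I = g ` J" using I(1) unfolding J_def by auto
    have "independent_in A J" unfolding independent_in_def
    proof (intro ballI notI)
      fix m n assume mn: "m \<in> J" "n \<in> J" "(m, n) \<in> A"
      then have J: "m \<in> S" "n \<in> S" "g m \<in> I" "g n \<in> I" using T(1) by (auto simp: J_def)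
      have "(m, n) \<notin> A"
        using I(2)[unfolded independent_in_def, rule_format, OF J(3,4)] unfolding arc[OF J(1,2)] .
      then show False using mn(3) by simp
    qed
    then have "card J \<le> alpha A T" by (intro alpha_ge[OF T(2)]) (auto simp: J_def)
    moreover have "card I \<le> card J" unfolding IJ using T(2) by (intro card_image_le) (simp add: J_def)
    ultimately show "card I \<le> alpha A T" by simp
  qed (use T in simp)
  obtain J where J: "J \<subseteq> T" "independent_in A J" "card J = alpha A T" using alpha_witness[OF T(2)] .
  have "independent_in (map_prod g g ` rs A S) (g ` J)" unfolding independent_in_def
  proof (intro ballI notI)
    fix a b assume "a \<in> g ` J" "b \<in> g ` J" and ab: "(a, b) \<in> map_prod g g ` rs A S"
    then obtain m n where mn: "m \<in> J" "n \<in> J" "a = g m" "b = g n" by blast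
    then have "m \<in> S" "n \<in> S" using J(1) T(1) by auto
    then have "(m, n) \<in> A" using ab arc mn(3,4) by simp
    then show False using J(2)[unfolded independent_in_def, rule_format, OF mn(1,2)] by simp
  qed
  then have "card (g ` J) \<le> alpha (map_prod g g ` rs A S) (g ` T)"
    using J(1) T(2) by (intro alpha_ge) auto
  moreover have "card (g ` J) = card J" using inj_on_subset[OF inj, of J] J(1) T(1) by (intro card_image) blast
  ultimately show "alpha A T \<le> alpha (map_prod g g ` rs A S) (g ` T)" using J(3) by simp
qed

text \<open>The path is built on natural numbers, and \<open>g\<close> copies it into the vertex
  type shared by all graphs of the family.\<close>

definition triangle_path_graph :: "(nat \<Rightarrow> 'a) \<Rightarrow> nat \<Rightarrow> 'a pair_pre_digraph" where
  "triangle_path_graph g t =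
     \<lparr>pverts = g ` {..<3 * t}, parcs = map_prod g g ` rs triangle_path_arcs {..<3 * t}\<rparr>"

lemma pair_graph_triangle_path:
  assumes "inj_on g {..<3 * t}"
  shows "pair_graph (triangle_path_graph g t)"
  unfolding pair_graph_iff
proof (intro conjI allI)
  show "sym (parcs (triangle_path_graph g t))"
    using sym_triangle_path_arcs by (auto simp: triangle_path_graph_def sym_def)
  show "(v, v) \<notin> parcs (triangle_path_graph g t)" for v
  proof
    assume "(v, v) \<in> parcs (triangle_path_graph g t)"
    then obtain m n where mn: "(m, n) \<in> triangle_path_arcs" "m < 3 * t" "n < 3 * t" "g m = g n"
      by (auto simp: triangle_path_graph_def)
    then have "m = n" using inj_onD[OF assms] by simp
    then show False using mn(1) by (simp add: triangle_path_arcs_def triangle_path_next_def)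
  qed
qed (auto simp: triangle_path_graph_def)

lemma minimal_blocking_set_triangle_path:
  assumes inj: "inj_on g {..<3 * t}" and t: "t \<ge> 1"
  shows "minimal_blocking_set (triangle_path_graph g t) (g ` triangle_path_block t)"
proof -
  let ?G = "triangle_path_graph g t" and ?S = "{..<3 * t}" and ?Y = "triangle_path_block t"
  have alpha: "alpha (parcs ?G) (g ` T) = alpha triangle_path_arcs T" if "T \<subseteq> ?S" for T
    unfolding triangle_path_graph_def pair_pre_digraph.simps
    by (rule alpha_image[OF inj that finite_subset[OF that]]) simp
  have V: "pverts ?G = g ` ?S" by (simp add: triangle_path_graph_def)
  have diff: "g ` ?S - g ` Z = g ` (?S - Z)" if "Z \<subseteq> ?S" for Z
    using inj_on_image_set_diff[OF inj _ that, of ?S] by auto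
  have Y: "?Y \<subseteq> ?S" using triangle_path_block_subset[OF t] .
  have top: "alpha (parcs ?G) (pverts ?G) \<le> t" unfolding V alpha[OF subset_refl] by (rule alpha_triangle_path_le)
  have low: "t \<le> alpha (parcs ?G) (g ` (?S - (?Y - {y})))" if "y \<in> ?Y" for y
    unfolding alpha[OF Diff_subset] by (rule alpha_triangle_path_unblocked[OF that t])
  have fin: "finite (g ` ?S)" by simp
  have "0 \<in> ?Y" by (simp add: triangle_path_block_def)
  then have "t \<le> alpha (parcs ?G) (g ` (?S - (?Y - {0})))" by (rule low)
  also have "\<dots> \<le> alpha (parcs ?G) (pverts ?G)" unfolding V by (rule alpha_mono[OF fin]) auto
  finally have geq: "t \<le> alpha (parcs ?G) (pverts ?G)" .
  have "alpha (parcs ?G) (pverts ?G - g ` ?Y) \<le> t - 1"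
    unfolding V diff[OF Y] alpha[OF Diff_subset] by (rule alpha_triangle_path_blocked[OF t])
  then have "alpha (parcs ?G) (pverts ?G - g ` ?Y) < alpha (parcs ?G) (pverts ?G)" using geq t by linarith
  then have bl: "blocking_set ?G (g ` ?Y)" unfolding blocking_set_alpha using Y V by auto
  have "\<not> blocking_set ?G Z" if Z: "Z \<subset> g ` ?Y" for Z
  proof -
    \<comment> \<open>\<open>Z\<close> lacks some vertex of the block, so it deletes no more than
      the block without that vertex does, and \<open>t\<close> independent vertices survive.\<close>
    obtain y where y: "y \<in> ?Y" "g y \<notin> Z" using Z by auto
    have "g ` (?S - (?Y - {y})) \<subseteq> g ` ?S - Z"
    proof (rule image_subsetI)
      fix m assume m: "m \<in> ?S - (?Y - {y})"
      have "g m \<notin> Z"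
      proof
        assume "g m \<in> Z"
        then obtain m' where "m' \<in> ?Y" "g m = g m'" using Z by blast
        then have "m = m'" using inj_onD[OF inj, of m m'] m Y by blast
        then show False using \<open>m' \<in> ?Y\<close> m y \<open>g m \<in> Z\<close> by blast
      qed
      then show "g m \<in> g ` ?S - Z" using m by blast
    qed
    then have "alpha (parcs ?G) (g ` (?S - (?Y - {y}))) \<le> alpha (parcs ?G) (pverts ?G - Z)"
      unfolding V using fin by (intro alpha_mono) auto
    then have "\<not> alpha (parcs ?G) (pverts ?G - Z) < alpha (parcs ?G) (pverts ?G)"
      using low[OF y(1)] top by linarith
    then show ?thesis unfolding blocking_set_alpha by blast
  qed
  then show ?thesis unfolding minimal_blocking_set_def using bl by blast
qed

text \<open>Bags \<open>2 * i\<close> and \<open>2 * i + 1\<close> give triangle \<open>i\<close>.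
  Of the double edge to the next pair one edge \<open>e i\<close> is kept, and its ends
  \<open>z' i\<close> and \<open>z (Suc i)\<close> must lie in the corners at which triangles
  \<open>i\<close> and \<open>Suc i\<close> are joined.\<close>

lemma triangle_path_of_necklace:
  assumes E: "sym E" and B: "necklace E V (2 * t) B"
  shows "\<exists>c. (\<forall>m<3 * t. conn_on E (c m) \<and> c m \<subseteq> V) \<and> (\<forall>m<3 * t. \<forall>n<3 * t. m \<noteq> n \<longrightarrow> c m \<inter> c n = {})
    \<and> (\<forall>m<3 * t. \<forall>n<3 * t. triangle_path_next m n \<longrightarrow> linked_to E (c m) (c n))"
proof -
  note b = necklaceD[OF B]
  have "\<exists>e. Suc i < t \<longrightarrow> e \<in> E \<inter> B (2 * i + 1) \<times> B (2 * i + 2)" for i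
  proof (cases "Suc i < t")
    case True
    then have "doubly_adjacent E (B (2 * i + 1)) (B (2 * i + 2))" using b(4)[of "2 * i + 1"] by simp
    then show ?thesis unfolding doubly_adjacent_def by blast
  qed simp
  then obtain e where e: "\<And>i. Suc i < t \<Longrightarrow> e i \<in> E \<inter> B (2 * i + 1) \<times> B (2 * i + 2)" by metis
  \<comment> \<open>The first triangle has no predecessor and the last no successor; any vertex of
    the bag will do there.\<close>
  define z where "z i = (if i = 0 then SOME x. x \<in> B 0 else snd (e (i - 1)))" for i
  define z' where "z' i = (if Suc i < t then fst (e i) else SOME x. x \<in> B (2 * i + 1))" for i
  have z: "z i \<in> B (2 * i)" if i: "i < t" for i
  proof (cases i)
    case 0
    have "B 0 \<noteq> {}" using conn_on_nonempty[OF b(1)[of 0]] i by simp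
    then show ?thesis using 0 by (simp add: z_def some_in_eq)
  next
    case (Suc j)
    then have "e j \<in> E \<inter> B (2 * j + 1) \<times> B (2 * j + 2)" using e i by simp
    then show ?thesis using Suc by (auto simp: z_def)
  qed
  have z': "z' i \<in> B (2 * i + 1)" if i: "i < t" for i
  proof (cases "Suc i < t")
    case True
    then show ?thesis using e[OF True] by (auto simp: z'_def)
  next
    case False
    have "B (2 * i + 1) \<noteq> {}" using conn_on_nonempty[OF b(1)[of "2 * i + 1"]] i by simp
    then show ?thesis using False by (simp add: z'_def some_in_eq)
  qed
  have zz: "(z' i, z (Suc i)) \<in> E" if "Suc i < t" for i
    using e[OF that] that by (simp add: z_def z'_def)
  define P where "P i U W X \<longleftrightarrow> U \<union> W \<union> X \<subseteq> B (2 * i) \<union> B (2 * i + 1) \<and> conn_on E U \<and> conn_on E W \<and> conn_on E X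
    \<and> U \<inter> W = {} \<and> W \<inter> X = {} \<and> U \<inter> X = {}
    \<and> linked_to E U W \<and> linked_to E W X \<and> linked_to E U X \<and> z i \<in> U \<and> z' i \<in> X" for i U W X
  have "\<exists>U W X. i < t \<longrightarrow> P i U W X" for i
  proof (cases "i < t")
    case True
    have "\<exists>U W X. P i U W X" unfolding P_def
      by (rule triangle_of_double_edge[OF E])
         (use True b(1)[of "2 * i"] b(1)[of "2 * i + 1"] b(3)[of "2 * i" "2 * i + 1"] b(4)[of "2 * i"] z z' in simp_all)
    then show ?thesis by blast
  qed simp
  then obtain U W X where "\<And>i. i < t \<longrightarrow> P i (U i) (W i) (X i)" by metis
  then have P: "P i (U i) (W i) (X i)" if "i < t" for i using that by simp
  note P' = P[unfolded P_def]
  define c where "c m = (if m mod 3 = 0 then U (m div 3) else if m mod 3 = 1 then W (m div 3) else X (m div 3))" for m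
  have cU: "c (3 * q) = U q" and cW: "c (3 * q + 1) = W q" and cX: "c (3 * q + 2) = X q" for q
  proof -
    have "(3 * q + 1) mod 3 = 1" "(3 * q + 1) div 3 = q" "(3 * q + 2) mod 3 = 2" "(3 * q + 2) div 3 = q" by presburger+
    then show "c (3 * q) = U q" "c (3 * q + 1) = W q" "c (3 * q + 2) = X q" unfolding c_def by simp_all
  qed
  note c_eq = cU cW[simplified] cX[simplified]
  have csub: "c m \<subseteq> B (2 * (m div 3)) \<union> B (2 * (m div 3) + 1) \<and> conn_on E (c m)" if "m < 3 * t" for m
  proof -
    have "m div 3 < t" using that by linarith
    from P'[OF this] show ?thesis unfolding c_def by simp
  qed
  show ?thesis
  proof (intro exI[of _ c] conjI allI impI)
    fix m assume m: "m < 3 * t"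
    show "conn_on E (c m)" using csub[OF m] by simp
    have "m div 3 < t" using m by linarith
    then have "B (2 * (m div 3)) \<subseteq> V" "B (2 * (m div 3) + 1) \<subseteq> V" by (simp_all add: b(2))
    then show "c m \<subseteq> V" using csub[OF m] by blast
    fix n assume n: "n < 3 * t"
    show "c m \<inter> c n = {}" if "m \<noteq> n"
    proof (cases "m div 3 = n div 3")
      case False
      define i j where "i = m div 3" and "j = n div 3"
      have ij: "i < t" "j < t" "i \<noteq> j" using m n False unfolding i_def j_def by linarith+
      have "2 * i \<noteq> 2 * j" "2 * i + 1 \<noteq> 2 * j + 1" "2 * i \<noteq> 2 * j + 1" "2 * i + 1 \<noteq> 2 * j"
        "2 * i < 2 * t" "2 * i + 1 < 2 * t" "2 * j < 2 * t" "2 * j + 1 < 2 * t"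
        using ij by presburger+
      then have "(B (2 * i) \<union> B (2 * i + 1)) \<inter> (B (2 * j) \<union> B (2 * j + 1)) = {}"
        by (simp add: Int_Un_distrib Int_Un_distrib2 b(3))
      then show ?thesis using csub[OF m] csub[OF n] unfolding i_def j_def by blast
    next
      case True
      define q where "q = m div 3"
      have q: "q < t" using m unfolding q_def by linarith
      have d: "U q \<inter> W q = {}" "W q \<inter> X q = {}" "U q \<inter> X q = {}" using P'[OF q] by simp_all
      then have d': "W q \<inter> U q = {}" "X q \<inter> W q = {}" "X q \<inter> U q = {}" by (simp_all add: Int_commute)
      have m': "m = 3 * q \<or> m = 3 * q + 1 \<or> m = 3 * q + 2" and n': "n = 3 * q \<or> n = 3 * q + 1 \<or> n = 3 * q + 2"
        using True unfolding q_def by linarith+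
      show ?thesis
        using m' n' \<open>m \<noteq> n\<close> by (elim disjE) (simp_all add: c_eq d d')
    qed
    assume next': "triangle_path_next m n"
    show "linked_to E (c m) (c n)"
    proof (cases m rule: div_mod_3_cases)
      case (1 q)
      have q: "q < t" using 1 m by linarith
      have "n = 3 * q + 1 \<or> n = 3 * q + 2" using next' 1 unfolding triangle_path_next_def by auto
      then show ?thesis using P'[OF q] 1(1) by (elim disjE) (simp_all add: c_eq)
    next
      case (2 q)
      have q: "q < t" using 2 m by linarith
      have "n = 3 * q + 2" using next' 2 unfolding triangle_path_next_def by auto
      then show ?thesis using P'[OF q] 2(1) by (simp add: c_eq)
    next
      case (3 q)
      have nq: "n = 3 * Suc q" using next' 3 unfolding triangle_path_next_def by auto
      have q: "q < t" "Suc q < t" using n unfolding nq by simp_all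
      have "z' q \<in> X q" "z (Suc q) \<in> U (Suc q)" using P'[OF q(1)] P'[OF q(2)] by simp_all
      then have "linked_to E (X q) (U (Suc q))" using zz[OF q(2)] unfolding linked_to_def by blast
      then show ?thesis unfolding 3(1) nq cU cX .
    qed
  qed
qed

lemma large_minimal_blocking_set_of_necklace:
  assumes G: "pair_graph G" and B: "necklace (parcs G) (pverts G) (2 * t) B" and t: "t \<ge> 1"
  shows "\<exists>H Y. graph_minor H G \<and> minimal_blocking_set H Y \<and> card Y = t + 2"
proof -
  note g = pair_graphD[OF G]
  obtain c where c0: "(\<forall>m<3 * t. conn_on (parcs G) (c m) \<and> c m \<subseteq> pverts G)
      \<and> (\<forall>m<3 * t. \<forall>n<3 * t. m \<noteq> n \<longrightarrow> c m \<inter> c n = {})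
      \<and> (\<forall>m<3 * t. \<forall>n<3 * t. triangle_path_next m n \<longrightarrow> linked_to (parcs G) (c m) (c n))"
    using triangle_path_of_necklace[OF g(3) B] ..
  note c = c0[THEN conjunct1, rule_format, THEN conjunct1] c0[THEN conjunct1, rule_format, THEN conjunct2]
    and disj = c0[THEN conjunct2, THEN conjunct1, rule_format]
    and lnk = c0[THEN conjunct2, THEN conjunct2, rule_format]
  \<comment> \<open>Each branch set is named by one of its own vertices, which makes the copy of the
    triangle path injective.\<close>
  define v where "v m = (SOME x. x \<in> c m)" for m
  have v: "v m \<in> c m" if "m < 3 * t" for m
    unfolding v_def using conn_on_nonempty[OF c(1)[OF that]] by (simp add: some_in_eq)
  have inj: "inj_on v {..<3 * t}"
  proof (rule inj_onI, rule ccontr)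
    fix m n assume mn: "m \<in> {..<3 * t}" "n \<in> {..<3 * t}" "v m = v n" "m \<noteq> n"
    then have "v m \<in> c m \<inter> c n" using v[of m] v[of n] by simp
    moreover have "c m \<inter> c n = {}" using disj[of m n] mn by blast
    ultimately show False by blast
  qed
  let ?H = "triangle_path_graph v t"
  define \<phi> where "\<phi> u = c (the_inv_into {..<3 * t} v u)" for u
  have \<phi>: "\<phi> (v m) = c m" if "m < 3 * t" for m
    unfolding \<phi>_def using the_inv_into_f_f[OF inj, of m] that by simp
  have Hv: "\<exists>m<3 * t. u = v m" if "u \<in> pverts ?H" for u using that by (auto simp: triangle_path_graph_def)
  have "graph_minor ?H G"
  proof (rule minor_of_model[OF G pair_graph_triangle_path[OF inj], where \<phi> = \<phi>])
    fix u assume "u \<in> pverts ?H"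
    then obtain m where m: "m < 3 * t" "u = v m" using Hv by blast
    show "conn_on (parcs G) (\<phi> u)" "\<phi> u \<subseteq> pverts G" unfolding m(2) \<phi>[OF m(1)] by (rule c[OF m(1)])+
    fix w assume "w \<in> pverts ?H" "u \<noteq> w"
    then obtain n where n: "n < 3 * t" "w = v n" using Hv by blast
    have "m \<noteq> n" using \<open>u \<noteq> w\<close> m(2) n(2) by auto
    then show "\<phi> u \<inter> \<phi> w = {}" unfolding m(2) n(2) \<phi>[OF m(1)] \<phi>[OF n(1)] by (rule disj[OF m(1) n(1)])
  next
    fix u w assume "(u, w) \<in> parcs ?H"
    then obtain m n where mn: "m < 3 * t" "n < 3 * t" "u = v m" "w = v n" "(m, n) \<in> triangle_path_arcs"
      by (auto simp: triangle_path_graph_def)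
    have "linked_to (parcs G) (c m) (c n)"
      using mn(5) lnk[OF mn(1,2)] linked_to_sym[OF g(3) lnk[OF mn(2,1)]]
      unfolding triangle_path_arcs_def by blast
    then show "\<exists>x\<in>\<phi> u. \<exists>y\<in>\<phi> w. (x, y) \<in> parcs G"
      unfolding mn(3,4) \<phi>[OF mn(1)] \<phi>[OF mn(2)] linked_to_def .
  qed
  moreover have "minimal_blocking_set ?H (v ` triangle_path_block t)"
    by (rule minimal_blocking_set_triangle_path[OF inj t])
  moreover have "card (v ` triangle_path_block t) = t + 2"
    using card_image[OF inj_on_subset[OF inj triangle_path_block_subset[OF t]]] card_triangle_path_block[OF t]
    by simp
  ultimately show ?thesis by blast
qed

theorem theorem2:
  fixes \<F> :: "'a pair_pre_digraph set"
  assumes "\<And>G. G \<in> \<F> \<Longrightarrow> pair_graph G"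
    and "minor_closed \<F>"
  shows "(\<exists>c. \<forall>G\<in>\<F>. bridge_depth G \<le> c)
     \<longleftrightarrow> (\<exists>b. \<forall>G\<in>\<F>. \<forall>Y. minimal_blocking_set G Y \<longrightarrow> card Y \<le> b)"
proof
  assume "\<exists>c. \<forall>G\<in>\<F>. bridge_depth G \<le> c"
  then obtain c where c: "\<And>G. G \<in> \<F> \<Longrightarrow> bridge_depth G \<le> c" by blast
  have "card Y \<le> 2 ^ c" if "G \<in> \<F>" "minimal_blocking_set G Y" for G Y
  proof -
    have "card Y \<le> 2 ^ bridge_depth G"
      by (rule minimal_blocking_set_bridge_depth[OF assms(1)[OF that(1)] that(2)])
    also have "\<dots> \<le> 2 ^ c" using c[OF that(1)] by (intro power_increasing) auto
    finally show ?thesis .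
  qed
  then show "\<exists>b. \<forall>G\<in>\<F>. \<forall>Y. minimal_blocking_set G Y \<longrightarrow> card Y \<le> b" by blast
next
  assume "\<exists>b. \<forall>G\<in>\<F>. \<forall>Y. minimal_blocking_set G Y \<longrightarrow> card Y \<le> b"
  then obtain b where b: "\<And>G Y. G \<in> \<F> \<Longrightarrow> minimal_blocking_set G Y \<Longrightarrow> card Y \<le> b" by blast
  \<comment> \<open>A necklace of length \<open>2 * t\<close> yields a minimal blocking set of size
    \<open>t + 2\<close> in a minor; \<open>t = Suc b\<close> puts this above \<open>b\<close> and
    satisfies \<open>t \<ge> 1\<close>.\<close>
  obtain c where c: "\<forall>G :: 'a pair_pre_digraph. pair_graph G \<longrightarrow>
      (\<nexists>B. necklace (parcs G) (pverts G) (2 * Suc b) B) \<longrightarrow> bridge_depth G \<le> c"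
    using bridge_depth_bounded_of_no_necklace[of "2 * Suc b"] ..
  have "bridge_depth G \<le> c" if G: "G \<in> \<F>" for G
  proof (rule c[rule_format, OF assms(1)[OF G]])
    show "\<nexists>B. necklace (parcs G) (pverts G) (2 * Suc b) B"
    proof
      assume "\<exists>B. necklace (parcs G) (pverts G) (2 * Suc b) B"
      then obtain B where B: "necklace (parcs G) (pverts G) (2 * Suc b) B" ..
      have "\<exists>H Y. graph_minor H G \<and> minimal_blocking_set H Y \<and> card Y = Suc b + 2"
        by (rule large_minimal_blocking_set_of_necklace[OF assms(1)[OF G] B]) simp
      then obtain H Y where HY: "graph_minor H G" "minimal_blocking_set H Y" "card Y = Suc b + 2" by blast
      have "H \<in> \<F>" using assms(2) G HY(1) unfolding minor_closed_def by blast
      then show False using b[OF _ HY(2)] HY(3) by simp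
    qed
  qed
  then show "\<exists>c. \<forall>G\<in>\<F>. bridge_depth G \<le> c" by blast
qed

end
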